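(* Let $X$ be a smooth hypertoric variety with generic stability parameter $\theta$ and generic cocharacter $\sigma$, and $X'$ its 3d mirror. Under the identification of parameters $(z_i,a_i,\hbar)\mapsto(a_i',z_i',\hbar^{-1})$, for all $\mathbf p,\mathbf q\in X^{\mathbb T}$ and the corresponding fixed points $\mathbf p',\mathbf q'\in(X')^{\mathbb T'}$, $$\frac{\mathrm{Stab}_\sigma(\mathbf p)|_{\mathbf q}}{\mathrm{Stab}_\sigma(\mathbf q)|_{\mathbf q}}=\frac{\mathrm{Stab}'_{\sigma'}(\mathbf q')|_{\mathbf p'}}{\mathrm{Stab}'_{\sigma'}(\mathbf p')|_{\mathbf p'}}.$$
   Context: Hypertoric varieties. Fix an exact sequence $0\to\mathbb Z^k\xrightarrow{\iota}\mathbb Z^n\xrightarrow{\beta}\mathbb Z^d\to0$, $e_i$ the standard basis of $\mathbb Z^n$, $e_i^*$ the dual basis, $\mathsf K=(\mathbb C^* )^k$, $\mathsf T=(\mathbb C^* )^n$, $\mathsf A=\mathsf T/\mathsf K$. $\mathsf K$ acts via $\iota$ on $T^*\mathbb C^n$ with moment map $\mu(z,w)=\iota^\vee(z_1w_1,\dots,z_nw_n)$. For generic $\theta\in(\mathbb Z^k)^\vee$ with lift $\widetilde\theta\in(\mathbb Z^n)^\vee$, $X=\mu^{-1}(0)/\!/_\theta\mathsf K=\mu^{-1}(0)^s/\mathsf K$ is smooth. $\mathbb T=\mathsf T\times\mathbb C_\hbar^*$ acts on $X$, $\mathbb C^*_\hbar$ scaling cotangent directions with character $\hbar^{-1}$;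 equivariant parameters $a_1,\dots,a_n,\hbar$. $L_i=\mu^{-1}(0)^s\times_{\mathsf K}\mathbb C_{e_i^*}$, with class (Chern root) $x_i$. $\sigma\in\mathbb Z^d$ is a generic cocharacter of $\mathsf A$ ($X^\sigma=X^{\mathbb T}$) with lift $\widetilde\sigma\in\mathbb Z^n$. Fixed points. $H_i=\{x\in(\mathbb R^d)^\vee:\langle x,\beta(e_i)\rangle=-\langle\widetilde\theta,e_i\rangle\}$, $H_i^\pm$: $\langle x,\beta(e_i)\rangle\ge$ (resp. $\le$) $-\langle\widetilde\theta,e_i\rangle$. Fixed points are $d$-subsets $\mathbf p\subset\{1,\dots,n\}$ with $\bigcap_{i\in\mathbf p}H_i\neq\emptyset$ (a vertex). $\mathcal A_{\mathbf p}$ is the complement of $\mathbf p$, $\mathcal A_{\mathbf p}^\pm=\{i\notin\mathbf p:\mathbf p\in H_i^\pm\}$; integers $C_{ij}=C_{ij}(\mathbf p)$ ($i\in\mathbf p,j\notin\mathbf p$) are defined by $\beta(e_j)=-\sum_{i\in\mathbf p}C_{ij}\beta(e_i)$; $\mathbf p^\pm=\{i\in\mathbf p:\pm(\widetilde\sigma_i-\sum_{j\notin\mathbf p}C_{ij}\widetilde\sigma_j)>0\}$. Restrictions: $x_i|_{\mathbf p}=1$ ($i\in\mathcal A_{\mathbf p}^+$), $\hbar^{-1}$ ($i\in\mathcal A_{\mathbf p}^-$), $a_i\prod_{j\notin\mathbf p}a_j^{-C_{ij}}\hbar^{-\sum_{j\in\mathcal A_{\mathbf p}^-}C_{ij}}$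 ($i\in\mathbf p$). Kähler parameters $z_1,\dots,z_n$ are coordinates on $\mathsf T^\vee$; $\zeta_j(\mathbf p)=z_j\prod_{i\in\mathbf p}z_i^{C_{ij}}$ for $j\notin\mathbf p$. Elliptic stable envelope. Fix $q$ with $|q|<1$; $\vartheta(x)=(x^{1/2}-x^{-1/2})\prod_{m\ge1}(1-q^mx)(1-q^mx^{-1})$. $E=\mathbb C^*/q^{\mathbb Z}$, $\mathcal E_{\mathbb T}=E^{n+1}$ (coordinates $a_i,\hbar$), $\mathcal E_{\mathsf T^\vee}=E^n$ (coordinates $z_i$), $\mathsf S(X)=E^k$ (elliptic Chern roots $s_j$), $x_i=a_i\prod_js_j^{\iota_{ij}}$. The equivariant elliptic cohomology scheme $\mathrm{Ell}_{\mathbb T}(X)\subset\mathsf S(X)\times\mathcal E_{\mathbb T}$ is the union of components $\mathsf O_{\mathbf p}\cong\mathcal E_{\mathbb T}$ ($\mathbf p\in X^{\mathbb T}$), on which $x_i=x_i|_{\mathbf p}$; $\mathsf E_{\mathbb T}(X)=\mathrm{Ell}_{\mathbb T}(X)\times\mathcal E_{\mathsf T^\vee}$, and $|_{\mathbf q}$ denotes restriction to $\mathsf O_{\mathbf q}\times\mathcal E_{\mathsf T^\vee}$. $\mathcal T(\mathbf p)$ is the pullback to $\mathsf E_{\mathbb T}(X)$ of the line bundle on $\mathsf S(X)\times\mathcal E_{\mathbb T}\times\mathcal E_{\mathsf T^\vee}$ whose sections have the $q$-quasi-periods of $$\prod_{i\in\mathbf p^+}\vartheta(\hbar x_i)\prod_{i\in\mathbf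 p^-}\vartheta(x_i)\prod_{j\in\mathcal A_{\mathbf p}^+}\frac{\vartheta(x_j\zeta_j(\mathbf p)\hbar^{-\sum_{i\in\mathbf p^+}C_{ij}})}{\vartheta(\zeta_j(\mathbf p)\hbar^{-\sum_{i\in\mathbf p^+}C_{ij}})}\prod_{j\in\mathcal A_{\mathbf p}^-}\frac{\vartheta(x_j\zeta_j(\mathbf p)\hbar^{-\sum_{i\in\mathbf p^+}C_{ij}})}{\vartheta(\hbar^{-1}\zeta_j(\mathbf p)\hbar^{-\sum_{i\in\mathbf p^+}C_{ij}})}.$$ $\mathrm{Stab}_\sigma(\mathbf p)$ (for the polarization $T_X^{1/2}=\sum_iL_i-\mathcal O^{\oplus k}$) is the unique (Aganagic–Okounkov) section of $\mathcal T(\mathbf p)$, holomorphic over $\mathcal E_{\mathbb T}$, meromorphic over $\mathcal E_{\mathsf T^\vee}$ and in $\hbar$, such that (i) it is supported on the full attracting set $\mathrm{Attr}^f_\sigma(\mathbf p)$ (the minimal closed subset containing $\mathbf p$ and closed under taking $\mathrm{Attr}_\sigma(\cdot)$, where $\mathrm{Attr}_\sigma(\mathbf q)=\{x:\lim_{t\to0}\sigma(t)x=\mathbf q\}$), and (ii) $\mathrm{Stab}_\sigma(\mathbf p)|_{\mathbf p}=\prod_{i\in\mathbf p^+}\vartheta(\hbar x_i|_{\mathbf p})\prod_{i\in\mathbf p^-}\vartheta(x_i|_{\mathbf p})$. Mirror. $X'$ is the hypertoric variety of the dual sequence $0\to(\mathbb Z^d)^\vee\xrightarrow{\beta^\vee}(\mathbb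 Z^n)^\vee\xrightarrow{\iota^\vee}(\mathbb Z^k)^\vee\to0$ with $\widetilde\theta'=-\widetilde\sigma$, $\widetilde\sigma'=-\widetilde\theta$; all its data are primed, and $\mathrm{Stab}'_{\sigma'}$ is its elliptic stable envelope. Fixed points correspond by $\mathbf p\mapsto\mathbf p'=\{1,\dots,n\}\setminus\mathbf p$. The identification of parameters sets $z_i=a_i'$, $a_i=z_i'$, and the parameter $\hbar$ of $X'$ equal to $\hbar^{-1}$. *)

theory Defs
  imports "HOL-Analysis.Analysis"
begin

section \<open>Coordinate spaces and holomorphic functions\<close>

text \<open>
  The space of vectors with coordinates in \<open>I\<close> is the set of functions vanishing off \<open>I\<close>;
  its topology is the one induced from the product topology. Indices \<open>1, ..., n\<close> of the
  mathematical text are \<open>0, ..., n - 1\<close> here.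
\<close>

definition vec_space :: "'i set \<Rightarrow> ('i \<Rightarrow> 'a::zero) set" where
  "vec_space I = {v. \<forall>i. i \<notin> I \<longrightarrow> v i = 0}"

text \<open>
  Holomorphic functions of several complex variables: continuous and holomorphic in each
  variable separately (for finite \<open>I\<close>).
\<close>

definition holo_on :: "'i set \<Rightarrow> ('i \<Rightarrow> complex) set \<Rightarrow> (('i \<Rightarrow> complex) \<Rightarrow> complex) \<Rightarrow> bool" where
  "holo_on I U f \<longleftrightarrow>
     openin (top_of_set (vec_space I)) U \<and> continuous_on U f \<and>
     (\<forall>u\<in>U. \<forall>i\<in>I. (\<lambda>t. f (u(i := t))) field_differentiable (at (u i)))"


section \<open>Hypertoric data\<close>

text \<open>
  \<open>iota i j\<close> is the \<open>e\<^sub>i\<close>-coefficient of the image of the \<open>j\<close>-th basis vector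
  of \<open>\<int>\<^sup>k\<close>, and \<open>beta l i\<close> is the \<open>l\<close>-th coefficient of the image of \<open>e\<^sub>i\<close>
  in \<open>\<int>\<^sup>d\<close>. \<open>theta_lift\<close> and \<open>sigma_lift\<close> are the lifts of \<open>\<theta>\<close> and \<open>\<sigma>\<close>.
\<close>

record hypertoric =
  dim_n :: nat
  dim_k :: nat
  dim_d :: nat
  iota :: "nat \<Rightarrow> nat \<Rightarrow> int"
  beta :: "nat \<Rightarrow> nat \<Rightarrow> int"
  theta_lift :: "nat \<Rightarrow> int"
  sigma_lift :: "nat \<Rightarrow> int"

definition iota_map :: "hypertoric \<Rightarrow> (nat \<Rightarrow> int) \<Rightarrow> nat \<Rightarrow> int" where
  "iota_map H s = (\<lambda>i. if i < dim_n H then \<Sum>j<dim_k H. iota H i j * s j else 0)"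

definition beta_map :: "hypertoric \<Rightarrow> (nat \<Rightarrow> int) \<Rightarrow> nat \<Rightarrow> int" where
  "beta_map H v = (\<lambda>l. if l < dim_d H then \<Sum>i<dim_n H. beta H l i * v i else 0)"

definition exact_data :: "hypertoric \<Rightarrow> bool" where
  "exact_data H \<longleftrightarrow>
     inj_on (iota_map H) (vec_space {..<dim_k H}) \<and>
     iota_map H ` vec_space {..<dim_k H}
       = {v \<in> vec_space {..<dim_n H}. beta_map H v = (\<lambda>_. 0)} \<and>
     beta_map H ` vec_space {..<dim_n H} = vec_space {..<dim_d H}"

definition theta_char :: "hypertoric \<Rightarrow> nat \<Rightarrow> int" where
  "theta_char H j = (\<Sum>i<dim_n H. iota H i j * theta_lift H i)"

definition mirror :: "hypertoric \<Rightarrow> hypertoric" where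
  "mirror H =
     \<lparr> dim_n = dim_n H, dim_k = dim_d H, dim_d = dim_k H,
       iota = (\<lambda>i l. beta H l i), beta = (\<lambda>j i. iota H i j),
       theta_lift = (\<lambda>i. - sigma_lift H i), sigma_lift = (\<lambda>i. - theta_lift H i) \<rparr>"


section \<open>The variety\<close>

type_synonym phase = "(nat \<Rightarrow> complex) \<times> (nat \<Rightarrow> complex)"

definition phase_space :: "hypertoric \<Rightarrow> phase set" where
  "phase_space H = vec_space {..<dim_n H} \<times> vec_space {..<dim_n H}"

definition torus_act :: "(nat \<Rightarrow> complex) \<Rightarrow> complex \<Rightarrow> phase \<Rightarrow> phase" where
  "torus_act a h x = ((\<lambda>i. a i * fst x i), (\<lambda>i. inverse h * inverse (a i) * snd x i))"

definition K_torus :: "hypertoric \<Rightarrow> (nat \<Rightarrow> complex) set" where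
  "K_torus H = {g \<in> vec_space {..<dim_k H}. \<forall>j<dim_k H. g j \<noteq> 0}"

definition K_incl :: "hypertoric \<Rightarrow> (nat \<Rightarrow> complex) \<Rightarrow> nat \<Rightarrow> complex" where
  "K_incl H g i = (\<Prod>j<dim_k H. g j powi iota H i j)"

definition K_act :: "hypertoric \<Rightarrow> (nat \<Rightarrow> complex) \<Rightarrow> phase \<Rightarrow> phase" where
  "K_act H g = torus_act (K_incl H g) 1"

definition K_orbit :: "hypertoric \<Rightarrow> phase \<Rightarrow> phase set" where
  "K_orbit H x = (\<lambda>g. K_act H g x) ` K_torus H"

definition moment_zero :: "hypertoric \<Rightarrow> phase set" where
  "moment_zero H =
     {(z, w) \<in> phase_space H. \<forall>j<dim_k H. (\<Sum>i<dim_n H. of_int (iota H i j) * (z i * w i)) = 0}"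

inductive poly_fun :: "nat \<Rightarrow> (phase \<Rightarrow> complex) \<Rightarrow> bool" for n where
  "poly_fun n (\<lambda>_. c)"
| "i < n \<Longrightarrow> poly_fun n (\<lambda>x. fst x i)"
| "i < n \<Longrightarrow> poly_fun n (\<lambda>x. snd x i)"
| "poly_fun n f \<Longrightarrow> poly_fun n g \<Longrightarrow> poly_fun n (\<lambda>x. f x + g x)"
| "poly_fun n f \<Longrightarrow> poly_fun n g \<Longrightarrow> poly_fun n (\<lambda>x. f x * g x)"

text \<open>
  GIT stability. The sign convention (a semi-invariant satisfies
  \<open>f (g x) = \<theta>(g)\<^sup>m f x\<close>) is the one for which the fixed point of a vertex has
  \<open>z\<^sub>i \<noteq> 0\<close> exactly on \<open>A_plus\<close> and \<open>w\<^sub>i \<noteq> 0\<close> exactly on \<open>A_minus\<close>.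
\<close>

definition semistable :: "hypertoric \<Rightarrow> phase set" where
  "semistable H =
     {x \<in> moment_zero H. \<exists>m>0. \<exists>f. poly_fun (dim_n H) f \<and>
        (\<forall>g\<in>K_torus H. \<forall>y\<in>moment_zero H.
           f (K_act H g y) = (\<Prod>j<dim_k H. g j powi theta_char H j) ^ m * f y) \<and>
        f x \<noteq> 0}"

definition stable :: "hypertoric \<Rightarrow> phase set" where
  "stable H =
     {x \<in> semistable H. closedin (top_of_set (semistable H)) (K_orbit H x) \<and>
        finite {g \<in> K_torus H. K_act H g x = x}}"

definition generic_theta :: "hypertoric \<Rightarrow> bool" where
  "generic_theta H \<longleftrightarrow> semistable H = stable H"

text \<open>
  Smoothness of the quotient \<open>\<mu>\<^sup>-\<^sup>1(0)\<^sup>s / K\<close> is freeness of the \<open>K\<close>-action on the stable locus.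
\<close>

definition smooth_hypertoric :: "hypertoric \<Rightarrow> bool" where
  "smooth_hypertoric H \<longleftrightarrow> exact_data H \<and> generic_theta H \<and>
     (\<forall>x\<in>stable H. \<forall>g\<in>K_torus H. K_act H g x = x \<longrightarrow> (\<forall>j<dim_k H. g j = 1))"

text \<open>Points of \<open>X\<close> are \<open>K\<close>-orbits in the stable locus; \<open>X\<close> has the quotient topology.\<close>

definition points :: "hypertoric \<Rightarrow> phase set set" where
  "points H = K_orbit H ` stable H"

definition quot_top :: "hypertoric \<Rightarrow> phase set topology" where
  "quot_top H =
     topology (\<lambda>U. U \<subseteq> points H \<and> openin (top_of_set (stable H)) (\<Union>U))"

definition cochar :: "hypertoric \<Rightarrow> complex \<Rightarrow> nat \<Rightarrow> complex" where
  "cochar H t i = t powi sigma_lift H i"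

definition generic_sigma :: "hypertoric \<Rightarrow> bool" where
  "generic_sigma H \<longleftrightarrow>
     {x \<in> points H. \<forall>t. t \<noteq> 0 \<longrightarrow> torus_act (cochar H t) 1 ` x = x}
     = {x \<in> points H. \<forall>a h. (\<forall>i<dim_n H. a i \<noteq> 0) \<and> h \<noteq> 0 \<longrightarrow> torus_act a h ` x = x}"


section \<open>Fixed points\<close>

definition hyperplane :: "hypertoric \<Rightarrow> nat \<Rightarrow> (nat \<Rightarrow> real) set" where
  "hyperplane H i =
     {x \<in> vec_space {..<dim_d H}. (\<Sum>l<dim_d H. x l * of_int (beta H l i)) = - of_int (theta_lift H i)}"

definition halfspace_plus :: "hypertoric \<Rightarrow> nat \<Rightarrow> (nat \<Rightarrow> real) set" where
  "halfspace_plus H i =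
     {x \<in> vec_space {..<dim_d H}. (\<Sum>l<dim_d H. x l * of_int (beta H l i)) \<ge> - of_int (theta_lift H i)}"

definition halfspace_minus :: "hypertoric \<Rightarrow> nat \<Rightarrow> (nat \<Rightarrow> real) set" where
  "halfspace_minus H i =
     {x \<in> vec_space {..<dim_d H}. (\<Sum>l<dim_d H. x l * of_int (beta H l i)) \<le> - of_int (theta_lift H i)}"

definition fixed_points :: "hypertoric \<Rightarrow> nat set set" where
  "fixed_points H =
     {p. p \<subseteq> {..<dim_n H} \<and> card p = dim_d H \<and>
         (\<exists>x\<in>vec_space {..<dim_d H}. \<forall>i\<in>p. x \<in> hyperplane H i)}"

definition vertex :: "hypertoric \<Rightarrow> nat set \<Rightarrow> nat \<Rightarrow> real" where
  "vertex H p = (THE x. x \<in> vec_space {..<dim_d H} \<and> (\<forall>i\<in>p. x \<in> hyperplane H i))"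

definition compl :: "hypertoric \<Rightarrow> nat set \<Rightarrow> nat set" where
  "compl H p = {..<dim_n H} - p"

definition A_plus :: "hypertoric \<Rightarrow> nat set \<Rightarrow> nat set" where
  "A_plus H p = {i \<in> compl H p. vertex H p \<in> halfspace_plus H i}"

definition A_minus :: "hypertoric \<Rightarrow> nat set \<Rightarrow> nat set" where
  "A_minus H p = {i \<in> compl H p. vertex H p \<in> halfspace_minus H i}"

text \<open>Only meaningful for \<open>i \<in> p\<close> and \<open>j \<in> compl H p\<close>.\<close>

definition circ :: "hypertoric \<Rightarrow> nat set \<Rightarrow> nat \<Rightarrow> nat \<Rightarrow> int" where
  "circ H p i j =
     (THE c. (\<forall>i. i \<notin> p \<longrightarrow> c i = 0) \<and>
             (\<forall>l<dim_d H. beta H l j = - (\<Sum>i\<in>p. c i * beta H l i))) i"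

definition p_plus :: "hypertoric \<Rightarrow> nat set \<Rightarrow> nat set" where
  "p_plus H p = {i \<in> p. sigma_lift H i - (\<Sum>j\<in>compl H p. circ H p i j * sigma_lift H j) > 0}"

definition p_minus :: "hypertoric \<Rightarrow> nat set \<Rightarrow> nat set" where
  "p_minus H p = {i \<in> p. sigma_lift H i - (\<Sum>j\<in>compl H p. circ H p i j * sigma_lift H j) < 0}"

text \<open>The \<open>\<T>\<close>-fixed point of \<open>X\<close> labelled by \<open>p\<close>, as a \<open>K\<close>-orbit.\<close>

definition fixed_orbit :: "hypertoric \<Rightarrow> nat set \<Rightarrow> phase set" where
  "fixed_orbit H p =
     {(z, w) \<in> stable H. \<forall>i<dim_n H. (z i \<noteq> 0 \<longleftrightarrow> i \<in> A_plus H p) \<and> (w i \<noteq> 0 \<longleftrightarrow> i \<in> A_minus H p)}"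

definition attr_set :: "hypertoric \<Rightarrow> phase set \<Rightarrow> phase set set" where
  "attr_set H y =
     {x \<in> points H. limitin (quot_top H) (\<lambda>t. torus_act (cochar H t) 1 ` x) y (at 0)}"

definition attr_full :: "hypertoric \<Rightarrow> nat set \<Rightarrow> phase set set" where
  "attr_full H p =
     \<Inter>{Y. closedin (quot_top H) Y \<and> fixed_orbit H p \<in> Y \<and> (\<forall>y\<in>Y. attr_set H y \<subseteq> Y)}"


section \<open>Elliptic cohomology\<close>

text \<open>
  All elliptic objects are pulled back to universal covers, i.e. written in logarithmic
  coordinates: a multiplicative coordinate \<open>x\<close> on \<open>E\<close> is \<open>exp u\<close>, and \<open>u\<close> is defined up
  to \<open>periods q\<close>. The coordinates are those of the Chern roots \<open>s\<^sub>j\<close>, of \<open>a\<^sub>i\<close>, of \<open>\<hbar>\<close>, and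
  of \<open>z\<^sub>i\<close>.
\<close>

datatype coord = Cs nat | Ca nat | Ch | Cz nat

definition periods :: "complex \<Rightarrow> complex set" where
  "periods q = {l. \<exists>m::int. exp l = q powi m}"

definition theta :: "complex \<Rightarrow> complex \<Rightarrow> complex" where
  "theta q u = (exp (u / 2) - exp (- u / 2)) *
     (\<Prod>m. (1 - q ^ Suc m * exp u) * (1 - q ^ Suc m * exp (- u)))"

text \<open>\<open>kcoords\<close> are the coordinates in which poles are allowed, \<open>params\<close> those of
  \<open>\<E>\<^sub>T \<times> \<E>\<^sub>T\<^sub>\<or>\<close>, \<open>coords\<close> those of \<open>S(X) \<times> \<E>\<^sub>T \<times> \<E>\<^sub>T\<^sub>\<or>\<close>.\<close>

definition kcoords :: "hypertoric \<Rightarrow> coord set" where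
  "kcoords H = insert Ch (Cz ` {..<dim_n H})"

definition params :: "hypertoric \<Rightarrow> coord set" where
  "params H = Ca ` {..<dim_n H} \<union> kcoords H"

definition coords :: "hypertoric \<Rightarrow> coord set" where
  "coords H = Cs ` {..<dim_k H} \<union> params H"

definition kproj :: "hypertoric \<Rightarrow> (coord \<Rightarrow> complex) \<Rightarrow> coord \<Rightarrow> complex" where
  "kproj H u = (\<lambda>c. if c \<in> kcoords H then u c else 0)"

definition chern_root :: "hypertoric \<Rightarrow> (coord \<Rightarrow> complex) \<Rightarrow> nat \<Rightarrow> complex" where
  "chern_root H u i = u (Ca i) + (\<Sum>j<dim_k H. of_int (iota H i j) * u (Cs j))"

definition chern_at :: "hypertoric \<Rightarrow> nat set \<Rightarrow> (coord \<Rightarrow> complex) \<Rightarrow> nat \<Rightarrow> complex" where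
  "chern_at H p u i =
     (if i \<in> A_plus H p then 0
      else if i \<in> A_minus H p then - u Ch
      else u (Ca i) - (\<Sum>j\<in>compl H p. of_int (circ H p i j) * u (Ca j))
             - (\<Sum>j\<in>A_minus H p. of_int (circ H p i j)) * u Ch)"

definition kahler_at :: "hypertoric \<Rightarrow> nat set \<Rightarrow> (coord \<Rightarrow> complex) \<Rightarrow> nat \<Rightarrow> complex" where
  "kahler_at H p u j = u (Cz j) + (\<Sum>i\<in>p. of_int (circ H p i j) * u (Cz i))"

definition ell_comp :: "complex \<Rightarrow> hypertoric \<Rightarrow> nat set \<Rightarrow> (coord \<Rightarrow> complex) set" where
  "ell_comp q H p =
     {u \<in> vec_space (coords H). \<forall>i<dim_n H. chern_root H u i - chern_at H p u i \<in> periods q}"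

definition ell :: "complex \<Rightarrow> hypertoric \<Rightarrow> (coord \<Rightarrow> complex) set" where
  "ell q H = (\<Union>p\<in>fixed_points H. ell_comp q H p)"

text \<open>
  The elliptic cohomology of a \<open>\<T>\<close>-orbit through \<open>x = [z, w]\<close>, i.e. of the stabilizer of \<open>x\<close>,
  as a subset of \<open>ell q H\<close>: the pairs \<open>(s, (a, \<hbar>)) \<in> K \<times> \<T>\<close> fixing \<open>(z, w)\<close> are cut out by the
  characters \<open>x\<^sub>i\<close> (when \<open>z\<^sub>i \<noteq> 0\<close>) and \<open>\<hbar> x\<^sub>i\<close> (when \<open>w\<^sub>i \<noteq> 0\<close>). For a fixed point this is
  \<open>ell_comp\<close>. The elliptic cohomology of an invariant open subset is the union of these subsets.
\<close>

definition ell_orbit :: "complex \<Rightarrow> hypertoric \<Rightarrow> phase set \<Rightarrow> (coord \<Rightarrow> complex) set" where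
  "ell_orbit q H x =
     {u \<in> vec_space (coords H). \<forall>(z, w)\<in>x. \<forall>i<dim_n H.
        (z i \<noteq> 0 \<longrightarrow> chern_root H u i \<in> periods q) \<and>
        (w i \<noteq> 0 \<longrightarrow> chern_root H u i + u Ch \<in> periods q)}"

text \<open>
  Restriction to the component of \<open>p\<close>, as a function of the parameters: among the lifts of the
  component, which differ by periods, the one with \<open>x\<^sub>i = x\<^sub>i|\<^sub>p\<close> exactly is used.
\<close>

definition ell_lift :: "hypertoric \<Rightarrow> nat set \<Rightarrow> (coord \<Rightarrow> complex) \<Rightarrow> coord \<Rightarrow> complex" where
  "ell_lift H p u =
     (THE v. v \<in> vec_space (coords H) \<and> (\<forall>c\<in>params H. v c = u c) \<and>
             (\<forall>i<dim_n H. chern_root H v i = chern_at H p v i))"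

definition restr ::
  "hypertoric \<Rightarrow> ((coord \<Rightarrow> complex) \<Rightarrow> complex) \<Rightarrow> nat set \<Rightarrow> (coord \<Rightarrow> complex) \<Rightarrow> complex" where
  "restr H F p u = F (ell_lift H p u)"


section \<open>Elliptic stable envelopes\<close>

text \<open>
  Holomorphic functions on the (reduced) analytic set \<open>ell\<close> over an open subset \<open>V\<close> of the
  \<open>(z, \<hbar>)\<close>-space: local restrictions of holomorphic functions of the ambient space.
\<close>

definition holo_on_ell ::
  "complex \<Rightarrow> hypertoric \<Rightarrow> (coord \<Rightarrow> complex) set \<Rightarrow> ((coord \<Rightarrow> complex) \<Rightarrow> complex) \<Rightarrow> bool" where
  "holo_on_ell q H V F \<longleftrightarrow>
     (\<forall>u\<in>ell q H. kproj H u \<in> V \<longrightarrow>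
        (\<exists>W G. u \<in> W \<and> holo_on (coords H) W G \<and> (\<forall>v\<in>W \<inter> ell q H. F v = G v)))"

definition regular_at ::
  "complex \<Rightarrow> hypertoric \<Rightarrow> ((coord \<Rightarrow> complex) \<Rightarrow> complex) \<Rightarrow> (coord \<Rightarrow> complex) \<Rightarrow> bool" where
  "regular_at q H F c \<longleftrightarrow>
     (\<exists>V. openin (top_of_set (vec_space (kcoords H))) V \<and> c \<in> V \<and> holo_on_ell q H V F)"

text \<open>
  Functions on \<open>ell\<close> that are holomorphic in the equivariant parameters and meromorphic in
  \<open>(z, \<hbar>)\<close>: locally over the \<open>(z, \<hbar>)\<close>-space, a denominator \<open>g(z, \<hbar>)\<close> clears the poles. Such a
  function is represented by a total function whose values over non-regular points, which form
  a nowhere dense set, carry no information; all conditions below are therefore imposed over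
  regular points only.
\<close>

definition mero_on_ell :: "complex \<Rightarrow> hypertoric \<Rightarrow> ((coord \<Rightarrow> complex) \<Rightarrow> complex) \<Rightarrow> bool" where
  "mero_on_ell q H F \<longleftrightarrow>
     (\<forall>c\<in>vec_space (kcoords H). \<exists>V g G.
        c \<in> V \<and> holo_on (kcoords H) V g \<and>
        (\<forall>V'. openin (top_of_set (vec_space (kcoords H))) V' \<and> V' \<subseteq> V \<and> V' \<noteq> {} \<longrightarrow>
              (\<exists>c'\<in>V'. g c' \<noteq> 0)) \<and>
        holo_on_ell q H V G \<and>
        (\<forall>u\<in>ell q H. kproj H u \<in> V \<and> g (kproj H u) \<noteq> 0 \<longrightarrow> g (kproj H u) * F u = G u))"

text \<open>The function whose quasi-periods define the line bundle \<open>\<T>(p)\<close>.\<close>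

definition bundle_fun :: "complex \<Rightarrow> hypertoric \<Rightarrow> nat set \<Rightarrow> (coord \<Rightarrow> complex) \<Rightarrow> complex" where
  "bundle_fun q H p u =
     (let x = chern_root H u;
          y = (\<lambda>j. kahler_at H p u j - (\<Sum>i\<in>p_plus H p. of_int (circ H p i j)) * u Ch)
      in (\<Prod>i\<in>p_plus H p. theta q (u Ch + x i)) * (\<Prod>i\<in>p_minus H p. theta q (x i)) *
         (\<Prod>j\<in>A_plus H p. theta q (x j + y j) / theta q (y j)) *
         (\<Prod>j\<in>A_minus H p. theta q (x j + y j) / theta q (- u Ch + y j)))"

text \<open>
  The multiplier \<open>e\<close> is determined by \<open>\<Phi>\<close>, which is nonzero on a dense set. At poles of \<open>\<Phi>\<close> the
  condition on \<open>\<Phi>\<close> reads \<open>0 = 0\<close> by the convention for division by zero.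
\<close>

definition same_quasi_periods ::
  "complex \<Rightarrow> hypertoric \<Rightarrow> ((coord \<Rightarrow> complex) \<Rightarrow> complex) \<Rightarrow> ((coord \<Rightarrow> complex) \<Rightarrow> complex) \<Rightarrow> bool" where
  "same_quasi_periods q H \<Phi> F \<longleftrightarrow>
     (\<forall>l\<in>vec_space (coords H). (\<forall>c\<in>coords H. l c \<in> periods q) \<longrightarrow>
        (\<exists>e. holo_on (coords H) (vec_space (coords H)) e \<and>
             (\<forall>u\<in>vec_space (coords H). e u \<noteq> 0 \<and> \<Phi> (\<lambda>c. u c + l c) = e u * \<Phi> u) \<and>
             (\<forall>u\<in>ell q H. regular_at q H F (kproj H u) \<longrightarrow> F (\<lambda>c. u c + l c) = e u * F u)))"

definition bundle_section ::
  "complex \<Rightarrow> hypertoric \<Rightarrow> nat set \<Rightarrow> ((coord \<Rightarrow> complex) \<Rightarrow> complex) \<Rightarrow> bool" where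
  "bundle_section q H p F \<longleftrightarrow>
     mero_on_ell q H F \<and> same_quasi_periods q H (bundle_fun q H p) F"

text \<open>
  A section is supported on a closed invariant \<open>Y\<close> if it vanishes on the elliptic cohomology of
  the complement of \<open>Y\<close>.
\<close>

definition supported_on ::
  "complex \<Rightarrow> hypertoric \<Rightarrow> ((coord \<Rightarrow> complex) \<Rightarrow> complex) \<Rightarrow> phase set set \<Rightarrow> bool" where
  "supported_on q H F Y \<longleftrightarrow>
     (\<forall>x\<in>points H - Y. \<forall>u\<in>ell_orbit q H x. regular_at q H F (kproj H u) \<longrightarrow> F u = 0)"

definition elliptic_stable_envelope ::
  "complex \<Rightarrow> hypertoric \<Rightarrow> nat set \<Rightarrow> ((coord \<Rightarrow> complex) \<Rightarrow> complex) \<Rightarrow> bool" where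
  "elliptic_stable_envelope q H p F \<longleftrightarrow>
     bundle_section q H p F \<and>
     supported_on q H F (attr_full H p) \<and>
     (\<forall>u\<in>vec_space (params H). regular_at q H F (kproj H u) \<longrightarrow>
        restr H F p u =
          (\<Prod>i\<in>p_plus H p. theta q (u Ch + chern_at H p u i)) *
          (\<Prod>i\<in>p_minus H p. theta q (chern_at H p u i)))"


section \<open>Comparison with the mirror\<close>

text \<open>The parameters \<open>(a', \<hbar>', z') = (z, \<hbar>\<^sup>-\<^sup>1, a)\<close> of the mirror.\<close>

definition mirror_params :: "(coord \<Rightarrow> complex) \<Rightarrow> coord \<Rightarrow> complex" where
  "mirror_params u = (\<lambda>c. case c of Cs j \<Rightarrow> 0 | Ca i \<Rightarrow> u (Cz i) | Ch \<Rightarrow> - u Ch | Cz i \<Rightarrow> u (Ca i))"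

text \<open>
  The parameters at which both ratios \<open>F|\<^sub>r / G|\<^sub>r\<close> (on \<open>X\<close>) and \<open>F'|\<^sub>r\<^sub>' / G'|\<^sub>r\<^sub>'\<close> (on the mirror) of
  meromorphic functions can be evaluated.
\<close>

definition ratio_domain ::
  "complex \<Rightarrow> hypertoric \<Rightarrow> nat set \<Rightarrow> ((coord \<Rightarrow> complex) \<Rightarrow> complex) \<Rightarrow> ((coord \<Rightarrow> complex) \<Rightarrow> complex) \<Rightarrow>
   nat set \<Rightarrow> ((coord \<Rightarrow> complex) \<Rightarrow> complex) \<Rightarrow> ((coord \<Rightarrow> complex) \<Rightarrow> complex) \<Rightarrow> (coord \<Rightarrow> complex) set" where
  "ratio_domain q H r F G r' F' G' =
     {u \<in> vec_space (params H).
        regular_at q H F (kproj H u) \<and> regular_at q H G (kproj H u) \<and>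
        regular_at q (mirror H) F' (kproj (mirror H) (mirror_params u)) \<and>
        regular_at q (mirror H) G' (kproj (mirror H) (mirror_params u)) \<and>
        restr H G r u \<noteq> 0 \<and> restr (mirror H) G' r' (mirror_params u) \<noteq> 0}"

end

theory Submission
  imports Defs "HOL-Complex_Analysis.Complex_Analysis"
begin

text \<open>
  The stable envelope of \<open>p\<close>, restricted to the fixed components, is the explicit function
  \<open>bundle_fun\<close> itself. On the component of \<open>r \<noteq> p\<close> choose \<open>i \<in> r - p\<close> and let only \<open>a\<^sub>i\<close> vary: both
  functions are theta functions of degree one in \<open>x\<^sub>i\<close> with the same generic multipliers, hence
  agree as soon as they agree at one point. Such a point is where the component of \<open>r\<close> meets the
  elliptic cohomology of the curve through the vertex \<open>r\<close> that descends with respect to \<open>\<sigma>\<close>. If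
  the corresponding edge ends in a lower vertex, induction applies; if it is unbounded, the curve
  lies outside the full attracting set of \<open>p\<close> and both functions vanish there.

  In the explicit formula the mirror exchanges \<open>x\<^sub>i|\<^sub>r\<close> (\<open>i \<in> r\<close>) with the argument of the theta
  function in the Kaehler parameter \<open>\<zeta>\<^sub>i\<close> of \<open>r'\<close>, \<open>p\<^sup>\<plusminus>\<close> with \<open>A\<^sup>\<mp>\<close> of \<open>p'\<close>, and \<open>C\<close> with
  \<open>- C\<^sup>T\<close>; the two ratios then agree factor by factor over \<open>i < n\<close>.
\<close>

section \<open>The theta function\<close>

text \<open>Two obstacles shape the details. Stable envelopes are total functions whose values carry
  information only over regular points, and \<open>bundle_fun\<close> has zeros and poles of its
  own. Multipliers and ratios are therefore compared along complex lines in generic directions,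
  where the exceptional parameters are countable, and the comparison is extended by continuity.
  Secondly, the induction on vertices has to run on \<open>X\<close> and on its mirror, while
  smoothness and genericity are given on one side only; they are turned into conditions on lattice
  bases, heights and slopes that survive transposition. Freeness of the \<open>K\<close>-action
  enters twice: on elements of infinite order it makes the normals at a vertex independent, on
  torsion elements it makes them a basis over the integers. On the curve used in the induction
  \<open>z_i\<close> or \<open>w_i\<close> is nonzero, so that \<open>x_i\<close> is 1 or
  \<open>1/hbar\<close>. The value there determines a section of degree one unless the shifted
  Kaehler parameter, or its quotient by \<open>hbar\<close>, is a power of \<open>q\<close>; this is
  the origin of \<open>generic_params\<close>.\<close>

definition qpoch :: "complex \<Rightarrow> complex \<Rightarrow> complex" where
  "qpoch q x = (\<Prod>m. 1 - q ^ m * x)"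

lemma qpoch_convergent:
  fixes q x :: complex
  assumes "norm q < 1"
  shows "convergent_prod (\<lambda>m. 1 - q ^ m * x)"
proof -
  have "summable (\<lambda>m. norm x * norm q ^ m)"
    using assms by (intro summable_mult summable_geometric) auto
  moreover have "(\<lambda>m. norm ((1 - q ^ m * x) - 1)) = (\<lambda>m. norm x * norm q ^ m)"
    by (auto simp: norm_mult norm_power mult.commute)
  ultimately have "summable (\<lambda>m. norm ((1 - q ^ m * x) - 1))"
    by simp
  then show ?thesis
    by (blast intro: abs_convergent_prod_imp_convergent_prod summable_imp_abs_convergent_prod)
qed

text \<open>The partial products are polynomials that converge uniformly on closed balls of radius
  1, by the M-test with majorant \<open>R * norm q ^ n\<close>.\<close>

lemma qpoch_holomorphic:
  assumes "norm q < 1"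
  shows "qpoch q holomorphic_on UNIV"
proof (rule holomorphic_uniform_sequence[where f = "\<lambda>N x. \<Prod>m<N. 1 - q ^ m * x"])
  fix x :: complex
  define R where "R = norm x + 1"
  have sub: "norm y \<le> R" if "y \<in> cball x 1" for y
    using that norm_triangle_ineq2[of y x] by (simp add: R_def dist_norm norm_minus_commute)
  have "uniformly_convergent_on (cball x 1) (\<lambda>N y. \<Prod>m<N. 1 - q ^ m * y)"
  proof (rule Infinite_Products.uniformly_convergent_on_prod')
    show "uniformly_convergent_on (cball x 1) (\<lambda>N y. \<Sum>m<N. norm (1 - q ^ m * y - 1))"
    proof (rule Weierstrass_m_test')
      show "norm (norm (1 - q ^ n * y - 1)) \<le> R * norm q ^ n" if "y \<in> cball x 1" for n y
        using sub[OF that] by (simp add: norm_mult norm_power mult.commute mult_right_mono)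
      show "summable (\<lambda>n. R * norm q ^ n)"
        using assms by (intro summable_mult summable_geometric) auto
    qed
  qed (auto intro!: continuous_intros)
  then obtain g where g: "uniform_limit (cball x 1) (\<lambda>N y. \<Prod>m<N. 1 - q ^ m * y) g sequentially"
    by (auto simp: uniformly_convergent_on_def)
  moreover have "g y = qpoch q y" if "y \<in> cball x 1" for y
  proof -
    have "(\<lambda>N. \<Prod>m<Suc N. 1 - q ^ m * y) \<longlonglongrightarrow> g y"
      using tendsto_uniform_limitI[OF g that] by (rule LIMSEQ_Suc)
    moreover have "(\<lambda>N. \<Prod>m<Suc N. 1 - q ^ m * y) \<longlonglongrightarrow> qpoch q y"
      unfolding lessThan_Suc_atMost qpoch_def
      by (rule convergent_prod_LIMSEQ[OF qpoch_convergent[OF assms]])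
    ultimately show ?thesis by (rule LIMSEQ_unique)
  qed
  ultimately have "uniform_limit (cball x 1) (\<lambda>N y. \<Prod>m<N. 1 - q ^ m * y) (qpoch q) sequentially"
    by (metis (no_types, lifting) uniform_limit_cong')
  then show "\<exists>d>0. cball x d \<subseteq> UNIV \<and>
      uniform_limit (cball x d) (\<lambda>N y. \<Prod>m<N. 1 - q ^ m * y) (qpoch q) sequentially"
    by (intro exI[of _ 1]) auto
qed (auto intro!: holomorphic_intros)

lemma qpoch_shift:
  assumes "norm q < 1"
  shows "qpoch q x = (1 - x) * qpoch q (q * x)"
proof -
  have "(\<lambda>m. 1 - q ^ m * x) has_prod ((\<Prod>k<1. 1 - q ^ k * x) * (\<Prod>k. 1 - q ^ (k + 1) * x))"
    by (rule has_prod_ignore_initial_segment'[OF qpoch_convergent[OF assms]])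
  then show ?thesis
    by (simp add: has_prod_iff qpoch_def mult.assoc mult.left_commute)
qed

text \<open>A convergent product without zero factors is nonzero. Conversely, the product vanishes
  at the argument 1 because of its factor of index 0, and \<open>qpoch_shift\<close> carries this
  zero from \<open>q ^ m * x\<close> back to \<open>x\<close>.\<close>

lemma qpoch_eq_0_iff:
  assumes "norm q < 1"
  shows "qpoch q x = 0 \<longleftrightarrow> (\<exists>m. q ^ m * x = 1)"
proof
  assume "qpoch q x = 0"
  then have "\<exists>m. 1 - q ^ m * x = 0"
    using prodinf_nonzero[OF qpoch_convergent[OF assms], of x] by (auto simp: qpoch_def)
  then show "\<exists>m. q ^ m * x = 1" by auto
next
  assume "\<exists>m. q ^ m * x = 1"
  then obtain m where m: "q ^ m * x = 1" by blast
  have "qpoch q (q ^ m * x) = 0"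
    by (subst qpoch_shift[OF assms]) (simp add: m)
  then have "qpoch q (q ^ (m - k) * x) = 0" if "k \<le> m" for k
    using that
  proof (induction k)
    case (Suc k)
    then have "q ^ (m - k) * x = q * (q ^ (m - Suc k) * x)"
      by (metis Suc_diff_Suc Suc_le_lessD mult.assoc power_Suc)
    with Suc show ?case
      by (subst qpoch_shift[OF assms]) simp
  qed simp
  from this[of m] show "qpoch q x = 0" by simp
qed

text \<open>Absorbing \<open>1 - exp (- u)\<close> into one of the products leaves two Pochhammer
  symbols, for which zeros and shifts can be read off factor by factor.\<close>

lemma theta_eq_qpoch:
  assumes "norm q < 1"
  shows "theta q u = exp (u / 2) * qpoch q (q * exp u) * qpoch q (exp (- u))"
proof -
  have "exp (u / 2) - exp (- u / 2) = exp (u / 2) * (1 - exp (- u))"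
    by (simp add: right_diff_distrib flip: exp_add)
  moreover have "(\<Prod>m. (1 - q ^ Suc m * exp u) * (1 - q ^ Suc m * exp (- u)))
      = qpoch q (q * exp u) * qpoch q (q * exp (- u))"
  proof -
    have "convergent_prod (\<lambda>m. 1 - q ^ m * (q * exp u))"
         "convergent_prod (\<lambda>m. 1 - q ^ m * (q * exp (- u)))"
      by (rule qpoch_convergent[OF assms])+
    from prodinf_mult[OF this] show ?thesis
      by (simp add: qpoch_def mult.assoc mult.left_commute)
  qed
  moreover have "qpoch q (exp (- u)) = (1 - exp (- u)) * qpoch q (q * exp (- u))"
    by (rule qpoch_shift[OF assms])
  ultimately show ?thesis
    by (simp add: theta_def)
qed

lemma theta_holomorphic:
  assumes "norm q < 1"
  shows "theta q holomorphic_on UNIV"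
proof -
  have *: "(\<lambda>u. qpoch q (f u)) holomorphic_on UNIV" if "f holomorphic_on UNIV" for f
    using holomorphic_on_compose_gen[OF that qpoch_holomorphic[OF assms]] by (simp add: o_def)
  have "(\<lambda>u. exp (u / 2) * qpoch q (q * exp u) * qpoch q (exp (- u))) holomorphic_on UNIV"
    by (intro holomorphic_intros *) auto
  then show ?thesis
    using theta_eq_qpoch[OF assms] by presburger
qed

lemma zero_in_periods [simp]: "0 \<in> periods q"
  by (auto simp: periods_def intro!: exI[of _ 0])

lemma periods_minus:
  assumes "a \<in> periods q"
  shows "- a \<in> periods q"
proof -
  obtain m :: int where "exp a = q powi m"
    using assms unfolding periods_def by blast
  then have "exp (- a) = q powi (- m)"
    by (simp add: exp_minus power_int_minus)
  then show ?thesis unfolding periods_def by blast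
qed

text \<open>The first Pochhammer symbol vanishes when \<open>exp u\<close> is a negative power of
  \<open>q\<close>, the second when it is a nonnegative one.\<close>

lemma theta_eq_0_iff:
  assumes "0 < norm q" "norm q < 1"
  shows "theta q u = 0 \<longleftrightarrow> u \<in> periods q"
proof -
  have [simp]: "q \<noteq> 0" using assms by auto
  have "theta q u = 0 \<longleftrightarrow> (\<exists>m. q ^ m * (q * exp u) = 1) \<or> (\<exists>m. q ^ m * exp (- u) = 1)"
    by (simp add: theta_eq_qpoch[OF assms(2)] qpoch_eq_0_iff[OF assms(2)])
  also have "\<dots> \<longleftrightarrow> u \<in> periods q"
  proof
    assume "(\<exists>m. q ^ m * (q * exp u) = 1) \<or> (\<exists>m. q ^ m * exp (- u) = 1)"
    then consider m where "q ^ m * (q * exp u) = 1" | m where "q ^ m * exp (- u) = 1" by blast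
    then show "u \<in> periods q"
    proof cases
      case 1
      then have "exp u = q powi (- int (Suc m))"
        by (simp add: power_int_minus field_simps del: of_nat_Suc)
      then show ?thesis unfolding periods_def by blast
    next
      case 2
      then have "exp u = q powi (int m)"
        by (simp add: exp_minus field_simps)
      then show ?thesis unfolding periods_def by blast
    qed
  next
    assume "u \<in> periods q"
    then obtain m :: int where m: "exp u = q powi m" unfolding periods_def by blast
    show "(\<exists>m. q ^ m * (q * exp u) = 1) \<or> (\<exists>m. q ^ m * exp (- u) = 1)"
    proof (cases "m \<ge> 0")
      case True
      then have "q ^ nat m * exp (- u) = 1"
        using m by (simp add: exp_minus power_int_def)
      then show ?thesis by blast
    next
      case False
      then have "nat (- m) = Suc (nat (- m) - 1)" by simp
      then have "q ^ (nat (- m) - 1) * (q * exp u) = q ^ nat (- m) * exp u"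
        by (metis mult.assoc power_Suc2)
      also have "\<dots> = 1" using m False by (simp add: power_int_def flip: power_mult_distrib)
      finally show ?thesis by blast
    qed
  qed
  finally show ?thesis .
qed

lemma theta_add_2pi:
  assumes "norm q < 1"
  shows "theta q (u + 2 * pi * \<i>) = - theta q u"
proof -
  have "exp ((u + 2 * pi * \<i>) / 2) = exp (u / 2 + pi * \<i>)" by (simp add: field_simps)
  also have "\<dots> = - exp (u / 2)" by (simp add: exp_add)
  finally have 1: "exp ((u + 2 * pi * \<i>) / 2) = - exp (u / 2)" .
  have 2: "exp (u + 2 * pi * \<i>) = exp u" by (simp add: exp_add)
  have 3: "exp (- (u + 2 * pi * \<i>)) = exp (- u)" unfolding exp_minus 2 ..
  show ?thesis
    unfolding theta_eq_qpoch[OF assms] 1 2 3 by simp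
qed

text \<open>The two Pochhammer symbols move one step in opposite directions; the displaced factors
  \<open>1 - q * exp u\<close> and \<open>1 - exp (- (u + \<tau>))\<close> agree up to an
  exponential and a sign.\<close>

lemma theta_add_tau:
  assumes "norm q < 1" "exp \<tau> = q"
  shows "theta q (u + \<tau>) = - exp (- u - \<tau> / 2) * theta q u"
proof -
  have q: "q \<noteq> 0" using assms(2) by auto
  have e1: "exp (u + \<tau>) = q * exp u" using assms by (simp add: exp_add)
  have e2: "q * exp (- (u + \<tau>)) = exp (- u)" using assms q unfolding exp_minus e1 by simp
  have "qpoch q (exp (- (u + \<tau>))) = (1 - exp (- (u + \<tau>))) * qpoch q (exp (- u))"
    using qpoch_shift[OF assms(1), of "exp (- (u + \<tau>))"] unfolding e2 .
  moreover have "qpoch q (q * exp u) = (1 - q * exp u) * qpoch q (q * (q * exp u))"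
    by (rule qpoch_shift[OF assms(1)])
  moreover have "exp ((u + \<tau>) / 2) * (1 - exp (- (u + \<tau>)))
      = - exp (- u - \<tau> / 2) * exp (u / 2) * (1 - q * exp u)"
  proof -
    have "exp (- u - \<tau> / 2) * exp (u / 2) * (q * exp u) = exp (- u - \<tau> / 2 + u / 2 + \<tau> + u)"
      unfolding assms(2)[symmetric] by (simp only: exp_add mult.assoc)
    also have "- u - \<tau> / 2 + u / 2 + \<tau> + u = (u + \<tau>) / 2" by (simp add: field_simps)
    finally have *: "exp (- u - \<tau> / 2) * exp (u / 2) * (q * exp u) = exp ((u + \<tau>) / 2)" .
    have "exp ((u + \<tau>) / 2) * exp (- (u + \<tau>)) = exp ((u + \<tau>) / 2 - (u + \<tau>))"
      by (simp only: exp_add[symmetric] diff_conv_add_uminus)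
    also have "(u + \<tau>) / 2 - (u + \<tau>) = - u - \<tau> / 2 + u / 2" by (simp add: field_simps)
    also have "exp \<dots> = exp (- u - \<tau> / 2) * exp (u / 2)" by (rule exp_add)
    finally have **: "exp ((u + \<tau>) / 2) * exp (- (u + \<tau>)) = exp (- u - \<tau> / 2) * exp (u / 2)" .
    show ?thesis
      unfolding right_diff_distrib mult_1_right mult_minus_left using * ** by simp
  qed
  ultimately show ?thesis
    unfolding theta_eq_qpoch[OF assms(1)] e1 by algebra
qed

section \<open>Countable exceptional sets and entire quotients\<close>

lemma open_not_subset_countable:
  fixes S :: "complex set"
  assumes "open S" "z \<in> S" "countable C"
  shows "\<exists>t\<in>S. t \<notin> C"
proof (rule ccontr)
  assume "\<not> ?thesis"
  then have "S \<subseteq> C" by blast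
  moreover obtain e where "e > 0" "ball z e \<subseteq> S" using assms open_contains_ball by blast
  ultimately show False
    using uncountable_ball[of e z] countable_subset assms(3) by (meson order_trans)
qed

text \<open>Two different values at \<open>z\<close> would stay different on a neighbourhood, which
  is uncountable. In this form zero loci need to be examined along complex lines only.\<close>

lemma isCont_eq_off_countable:
  fixes f g :: "complex \<Rightarrow> complex"
  assumes "isCont f z" "isCont g z" "countable C"
    and ev: "\<forall>\<^sub>F t in nhds z. t \<notin> C \<longrightarrow> f t = g t"
  shows "f z = g z"
proof (rule ccontr)
  assume ne: "f z \<noteq> g z"
  have "((\<lambda>t. f t - g t) \<longlongrightarrow> f z - g z) (nhds z)"
    using isCont_diff[OF assms(1,2)] tendsto_at_iff_tendsto_nhds[of "\<lambda>t. f t - g t" z]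
    unfolding continuous_at by blast
  then have "\<forall>\<^sub>F t in nhds z. f t - g t \<noteq> 0"
    using ne by (intro tendsto_imp_eventually_ne) auto
  with ev have "\<forall>\<^sub>F t in nhds z. t \<in> C" by eventually_elim auto
  then obtain S where "open S" "z \<in> S" "\<forall>t\<in>S. t \<in> C"
    unfolding eventually_nhds by blast
  with open_not_subset_countable[OF _ _ assms(3)] show False by blast
qed

lemma countable_periods: "countable (periods q)"
proof (rule countable_subset)
  show "periods q \<subseteq> (\<Union>m::int. {l. exp l = q powi m})"
    unfolding periods_def by blast
  have "countable {l. exp l = w}" for w :: complex
  proof (cases "w = 0")
    case False
    have "{l. exp l = w} \<subseteq> range (\<lambda>n::int. Ln w + 2 * of_int n * pi * \<i>)"
    proof
      fix l assume "l \<in> {l. exp l = w}"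
      then have "exp l = exp (Ln w)" using False by simp
      then show "l \<in> range (\<lambda>n::int. Ln w + 2 * of_int n * pi * \<i>)"
        unfolding exp_eq by auto
    qed
    then show ?thesis by (rule countable_subset) auto
  qed auto
  then show "countable (\<Union>m::int. {l. exp l = q powi m})" by blast
qed

lemma countable_affine_periods:
  assumes "b \<noteq> 0"
  shows "countable {t. a + t * b \<in> periods q}"
proof -
  have "{t. a + t * b \<in> periods q} \<subseteq> (\<lambda>l. (l - a) / b) ` periods q"
    using assms by (auto simp: image_iff field_simps intro!: bexI)
  then show ?thesis
    using countable_periods countable_image countable_subset by blast
qed

text \<open>The zeros of \<open>g\<close> are simple, so the quotient of derivatives fills the gaps.
  Near such a zero the result is the quotient of the difference quotients \<open>f1\<close> and
  \<open>g1\<close>, which are entire by removability.\<close>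

lemma entire_quotient:
  assumes f: "f holomorphic_on UNIV" and g: "g holomorphic_on UNIV"
    and z: "\<And>t. g t = 0 \<Longrightarrow> f t = 0 \<and> deriv g t \<noteq> 0"
  obtains h where "h holomorphic_on UNIV" "\<And>t. f t = g t * h t"
proof -
  define h where "h t = (if g t = 0 then deriv f t / deriv g t else f t / g t)" for t
  have "h field_differentiable at a" for a
  proof (cases "g a = 0")
    case False
    have "isCont g a"
      using g by (meson UNIV_I continuous_on_eq_continuous_at holomorphic_on_imp_continuous_on open_UNIV)
    then have "\<forall>\<^sub>F t in nhds a. g t \<noteq> 0"
      using False unfolding continuous_at tendsto_at_iff_tendsto_nhds
      by (rule tendsto_imp_eventually_ne)
    then have ev: "\<forall>\<^sub>F t in nhds a. f t / g t = h t"
      by eventually_elim (simp add: h_def)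
    have "(\<lambda>t. f t / g t) field_differentiable at a"
      using f g False by (intro field_differentiable_divide) (auto simp: holomorphic_on_def)
    then show ?thesis
      using ev by (metis DERIV_cong_ev field_differentiable_def)
  next
    case True
    define f1 where "f1 t = (if t = a then deriv f a else (f t - f a) / (t - a))" for t
    define g1 where "g1 t = (if t = a then deriv g a else (g t - g a) / (t - a))" for t
    have f1: "f1 holomorphic_on UNIV" and g1: "g1 holomorphic_on UNIV"
      unfolding f1_def g1_def using pole_lemma_open[OF f] pole_lemma_open[OF g] by auto
    have fa: "f a = 0" and ga: "deriv g a \<noteq> 0" using z[OF True] by auto
    have "isCont g1 a"
      using g1 by (meson UNIV_I continuous_on_eq_continuous_at holomorphic_on_imp_continuous_on open_UNIV)
    moreover have "g1 a \<noteq> 0" using ga by (simp add: g1_def)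
    ultimately have "\<forall>\<^sub>F t in nhds a. g1 t \<noteq> 0"
      unfolding continuous_at tendsto_at_iff_tendsto_nhds by (rule tendsto_imp_eventually_ne)
    then have ev: "\<forall>\<^sub>F t in nhds a. f1 t / g1 t = h t"
      by eventually_elim (auto simp: h_def f1_def g1_def True fa)
    have "(\<lambda>t. f1 t / g1 t) field_differentiable at a"
      using f1 g1 \<open>g1 a \<noteq> 0\<close> by (intro field_differentiable_divide) (auto simp: holomorphic_on_def)
    then show ?thesis
      using ev by (metis DERIV_cong_ev field_differentiable_def)
  qed
  then have "h holomorphic_on UNIV" by (simp add: holomorphic_on_def)
  moreover have "f t = g t * h t" for t
    using z[of t] by (auto simp: h_def)
  ultimately show ?thesis by (rule that)
qed

section \<open>Quasi-periodic functions for the lattice of periods\<close>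

text \<open>Shifts that produce a multiplier of the form \<open>K * exp (\<alpha> * t)\<close> form
  a group, and \<open>periods q\<close> is generated by \<tau> and 2 pi i. This carries zeros and
  their multiplicities to all translates by periods.\<close>

lemma quasi_period_lattice:
  assumes "exp \<tau> = q" and l: "l \<in> periods q"
    and f1: "\<And>t. f (t + 2 * pi * \<i>) = - f t"
    and f2: "\<And>t. f (t + \<tau>) = - exp (- (t + y) - \<tau> / 2) * f t"
  obtains K \<alpha> where "K \<noteq> 0" "\<And>t. f (t + l) = K * exp (\<alpha> * t) * f t"
proof -
  define P where "P = {l. \<exists>K \<alpha>. K \<noteq> 0 \<and> (\<forall>t. f (t + l) = K * exp (\<alpha> * t) * f t)}"
  have add: "a + b \<in> P" if "a \<in> P" "b \<in> P" for a b
  proof -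
    from that obtain K \<alpha> K' \<alpha>' where "K \<noteq> 0" "K' \<noteq> 0"
      and *: "\<And>t. f (t + a) = K * exp (\<alpha> * t) * f t" "\<And>t. f (t + b) = K' * exp (\<alpha>' * t) * f t"
      unfolding P_def by blast
    have "f (t + (a + b)) = (K * K' * exp (\<alpha>' * a)) * exp ((\<alpha> + \<alpha>') * t) * f t" for t
      using *(2)[of "t + a"] *(1)[of t] by (simp add: add.assoc algebra_simps exp_add)
    with \<open>K \<noteq> 0\<close> \<open>K' \<noteq> 0\<close> show ?thesis
      unfolding P_def mem_Collect_eq
      by (metis exp_not_eq_zero mult_eq_0_iff)
  qed
  have minus: "- a \<in> P" if "a \<in> P" for a
  proof -
    from that obtain K \<alpha> where "K \<noteq> 0" and *: "\<And>t. f (t + a) = K * exp (\<alpha> * t) * f t"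
      unfolding P_def by blast
    have "f (t + - a) = (inverse K * exp (\<alpha> * a)) * exp (- \<alpha> * t) * f t" for t
      using *[of "t - a"] \<open>K \<noteq> 0\<close>
      by (simp add: field_simps exp_diff exp_minus)
    with \<open>K \<noteq> 0\<close> show ?thesis
      unfolding P_def mem_Collect_eq
      by (metis exp_not_eq_zero mult_eq_0_iff inverse_nonzero_iff_nonzero)
  qed
  have zero: "0 \<in> P"
    unfolding P_def by (rule CollectI, rule exI[of _ 1], rule exI[of _ 0]) simp
  have nat: "of_nat n * a \<in> P" if "a \<in> P" for n a
    by (induction n) (use zero add[OF that] in \<open>auto simp: distrib_right\<close>)
  have int: "of_int m * a \<in> P" if "a \<in> P" for m a
  proof (cases m)
    case (nonneg n)
    then show ?thesis using nat[OF that] by simp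
  next
    case (neg n)
    then show ?thesis using minus[OF nat[OF that, of "Suc n"]] by (simp del: of_nat_Suc)
  qed
  have "2 * pi * \<i> \<in> P"
    unfolding P_def by (rule CollectI, rule exI[of _ "-1"], rule exI[of _ 0]) (use f1 in simp)
  moreover have "\<tau> \<in> P"
  proof -
    have "f (t + \<tau>) = (- exp (- y - \<tau> / 2)) * exp ((-1) * t) * f t" for t
    proof -
      have "exp (- (t + y) - \<tau> / 2) = exp (- y - \<tau> / 2) * exp ((-1) * t)"
        unfolding exp_add[symmetric] by (simp add: algebra_simps)
      then show ?thesis unfolding f2 by simp
    qed
    then show ?thesis
      unfolding P_def mem_Collect_eq
      by (metis exp_not_eq_zero neg_equal_0_iff_equal)
  qed
  moreover obtain m :: int where "exp l = q powi m"
    using l unfolding periods_def by blast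
  then have "exp l = exp (of_int m * \<tau>)"
    using assms(1) exp_power_int[of \<tau> m] by (simp add: mult.commute)
  then obtain n :: int where "l = of_int m * \<tau> + of_int (2 * n) * pi * \<i>"
    unfolding exp_eq by auto
  then have "l = of_int m * \<tau> + of_int n * (2 * pi * \<i>)" by simp
  ultimately have "l \<in> P" using add int by presburger
  then show ?thesis using that unfolding P_def by blast
qed

text \<open>A translation by multiples of \<tau> adjusts the real part, one by multiples of 2 pi i
  then adjusts the imaginary part; all values of the norm occur on a compact rectangle. It is
  symmetric in the real direction since the sign of \<open>Re \<tau>\<close> is left open.\<close>

lemma bounded_lattice_periodic_norm:
  fixes H :: "complex \<Rightarrow> complex"
  assumes cont: "continuous_on UNIV H" and \<tau>: "Re \<tau> \<noteq> 0"
    and H1: "\<And>t. norm (H (t + 2 * pi * \<i>)) = norm (H t)"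
    and H2: "\<And>t. norm (H (t + \<tau>)) = norm (H t)"
  shows "bounded (range H)"
proof -
  have nat: "norm (H (t + of_nat n * a)) = norm (H t)"
    if "\<And>t. norm (H (t + a)) = norm (H t)" for n a t
  proof (induction n)
    case (Suc n)
    then show ?case using that[of "t + of_nat n * a"] by (simp add: algebra_simps)
  qed simp
  have int: "norm (H (t + of_int m * a)) = norm (H t)"
    if "\<And>t. norm (H (t + a)) = norm (H t)" for m a t
  proof (cases m)
    case (nonneg n)
    then show ?thesis using nat[OF that] by simp
  next
    case (neg n)
    then have "of_int m = - (of_nat (Suc n) :: complex)" by simp
    then have "t + of_int m * a + of_nat (Suc n) * a = t" by (simp only:) (simp add: algebra_simps)
    then show ?thesis using nat[OF that, of "t + of_int m * a" "Suc n"] by (simp only:)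
  qed
  define B where "B = cbox (Complex (- \<bar>Re \<tau>\<bar>) 0) (Complex \<bar>Re \<tau>\<bar> (2 * pi))"
  have "compact (H ` B)"
    unfolding B_def by (intro compact_continuous_image continuous_on_subset[OF cont]) auto
  then obtain M where M: "\<And>t. t \<in> B \<Longrightarrow> norm (H t) \<le> M"
    using compact_imp_bounded[of "H ` B"] unfolding bounded_iff by (metis imageI)
  have "norm (H t) \<le> M" for t
  proof -
    define a where "a = \<lfloor>Re t / Re \<tau>\<rfloor>"
    define t1 where "t1 = t + of_int (- a) * \<tau>"
    define b where "b = \<lfloor>Im t1 / (2 * pi)\<rfloor>"
    define t2 where "t2 = t1 + of_int (- b) * (2 * pi * \<i>)"
    have "norm (H t2) = norm (H t)"
      unfolding t2_def t1_def using int[OF H1] int[OF H2] by presburger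
    moreover have "t2 \<in> B"
    proof -
      have "Re t2 = (Re t / Re \<tau> - of_int a) * Re \<tau>"
        using \<tau> by (simp add: t2_def t1_def field_simps)
      moreover have "\<bar>Re t / Re \<tau> - of_int a\<bar> \<le> 1" unfolding a_def by linarith
      ultimately have "\<bar>Re t2\<bar> \<le> \<bar>Re \<tau>\<bar>"
        by (simp add: abs_mult mult_left_le_one_le)
      moreover have "Im t2 = (Im t1 / (2 * pi) - of_int b) * (2 * pi)"
        by (simp add: t2_def field_simps)
      moreover have "0 \<le> Im t1 / (2 * pi) - of_int b" "Im t1 / (2 * pi) - of_int b \<le> 1"
        unfolding b_def by linarith+
      ultimately show ?thesis
        unfolding B_def by (auto simp: in_cbox_complex_iff abs_le_iff mult_left_le_one_le)
    qed
    ultimately show ?thesis using M by metis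
  qed
  then show ?thesis unfolding bounded_iff by blast
qed

text \<open>
  Dividing by \<open>theta q (t - t0)\<close> leaves an entire function with constant multipliers, which
  Liouville's theorem forces to be an exponential; the exponent would make \<open>t0 + y\<close> a period.
\<close>

lemma theta_section_eq_0:
  assumes q: "0 < norm q" "norm q < 1" and \<tau>: "exp \<tau> = q"
    and hol: "f holomorphic_on UNIV"
    and f1: "\<And>t. f (t + 2 * pi * \<i>) = - f t"
    and f2: "\<And>t. f (t + \<tau>) = - exp (- (t + y) - \<tau> / 2) * f t"
    and f0: "f t0 = 0" and np: "t0 + y \<notin> periods q"
  shows "f t = 0"
proof -
  define g where "g t = theta q (t - t0)" for t
  have theta_diff: "theta q field_differentiable at u" for u
    using theta_holomorphic[OF q(2)] by (simp add: holomorphic_on_def)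
  have g_hol: "g holomorphic_on UNIV"
    unfolding g_def
    using holomorphic_on_compose_gen[of "\<lambda>t. t - t0" UNIV "theta q" UNIV] theta_holomorphic[OF q(2)]
    by (simp add: o_def holomorphic_on_diff holomorphic_on_ident)
  have g1: "g (t + 2 * pi * \<i>) = - g t" for t
    using theta_add_2pi[OF q(2), of "t - t0"] by (simp add: g_def algebra_simps)
  have g2: "g (t + \<tau>) = - exp (- (t + - t0) - \<tau> / 2) * g t" for t
    using theta_add_tau[OF q(2) \<tau>, of "t - t0"] by (simp add: g_def algebra_simps)
  \<comment> \<open>Only the factor \<open>exp (u / 2) - exp (- u / 2)\<close> vanishes at 0, and
    its derivative there is 1, so the derivative of theta is the value of the remaining product
    \<open>P\<close>.\<close>
  have theta'0: "deriv (theta q) 0 \<noteq> 0"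
  proof -
    define P where "P u = qpoch q (q * exp u) * qpoch q (q * exp (- u))" for u
    have *: "(\<lambda>u. qpoch q (h u)) holomorphic_on UNIV" if "h holomorphic_on UNIV" for h
      using holomorphic_on_compose_gen[OF that qpoch_holomorphic[OF q(2)]] by (simp add: o_def)
    have "P holomorphic_on UNIV"
      unfolding P_def by (intro holomorphic_intros *)
    then have P': "(P has_field_derivative deriv P 0) (at 0)"
      by (simp add: holomorphic_derivI)
    have eq: "theta q = (\<lambda>u. (exp (u / 2) - exp (- u / 2)) * P u)"
    proof
      fix u :: complex
      have e: "exp (u / 2) - exp (- u / 2) = exp (u / 2) * (1 - exp (- u))"
        by (simp add: right_diff_distrib flip: exp_add)
      show "theta q u = (exp (u / 2) - exp (- u / 2)) * P u"
        unfolding theta_eq_qpoch[OF q(2)] e P_def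
        by (subst (2) qpoch_shift[OF q(2)]) simp
    qed
    have "(theta q has_field_derivative (P 0)) (at 0)"
      unfolding eq by (rule derivative_eq_intros P' refl | simp)+
    moreover have "P 0 \<noteq> 0"
    proof -
      have "q ^ m * q \<noteq> 1" for m
      proof
        assume "q ^ m * q = 1"
        then have "norm q ^ Suc m = 1" by (metis norm_one norm_power power_Suc2)
        then show False using q(2) power_less_one_iff[of "norm q" "Suc m"] by simp
      qed
      then show ?thesis by (simp add: P_def qpoch_eq_0_iff[OF q(2)])
    qed
    ultimately show ?thesis by (simp add: DERIV_imp_deriv)
  qed
  have g'0: "deriv g t0 \<noteq> 0"
  proof -
    have "(g has_field_derivative deriv (theta q) 0) (at t0)"
      using DERIV_shift[of g "deriv (theta q) 0" 0 t0] field_differentiable_derivI[OF theta_diff[of 0]]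
      by (simp add: g_def)
    then show ?thesis using theta'0 DERIV_imp_deriv by metis
  qed
  \<comment> \<open>Every zero of \<open>g\<close> is a translate of \<open>t0\<close> by a period;
    the multipliers of \<open>f\<close> and \<open>g\<close> transport the zero of \<open>f\<close>
    and the simplicity of the zero of \<open>g\<close>.\<close>
  have z: "f u = 0 \<and> deriv g u \<noteq> 0" if "g u = 0" for u
  proof -
    have l: "u - t0 \<in> periods q" using that theta_eq_0_iff[OF q] by (simp add: g_def)
    obtain K \<alpha> where "\<And>t. f (t + (u - t0)) = K * exp (\<alpha> * t) * f t"
      using quasi_period_lattice[OF \<tau> l f1 f2] by metis
    from this[of t0] have fu: "f u = 0" using f0 by simp
    obtain K \<alpha> where K: "K \<noteq> 0" "\<And>t. g (t + (u - t0)) = K * exp (\<alpha> * t) * g t"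
      using quasi_period_lattice[OF \<tau> l g1 g2] by metis
    have gd: "(g has_field_derivative deriv g v) (at v)" for v
      using g_hol by (simp add: holomorphic_derivI)
    have "((\<lambda>t. g (t + (u - t0))) has_field_derivative deriv g u) (at t0)"
      using DERIV_shift[of g "deriv g u" t0 "u - t0"] gd[of u] by simp
    moreover have "((\<lambda>t. K * exp (\<alpha> * t) * g t) has_field_derivative K * exp (\<alpha> * t0) * deriv g t0) (at t0)"
      by (rule derivative_eq_intros gd refl | simp add: g_def theta_def)+
    ultimately have "deriv g u = K * exp (\<alpha> * t0) * deriv g t0"
      unfolding K(2) by (rule DERIV_unique)
    then show ?thesis using fu K(1) g'0 by simp
  qed
  obtain h where h: "h holomorphic_on UNIV" "\<And>t. f t = g t * h t"
    using entire_quotient[OF hol g_hol z] by blast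
  have h_cont: "isCont h t" for t
    using h(1) by (meson UNIV_I continuous_on_eq_continuous_at holomorphic_on_imp_continuous_on open_UNIV)
  have "countable {t. (- t0) + t * 1 \<in> periods q}" by (rule countable_affine_periods) simp
  moreover have "{t. (- t0) + t * 1 \<in> periods q} = {t. g t = 0}"
    by (simp add: g_def theta_eq_0_iff[OF q])
  ultimately have C: "countable {t. g t = 0}" by simp
  have h1: "h (t + 2 * pi * \<i>) = h t" for t
  proof (rule isCont_eq_off_countable[where f = "\<lambda>t. h (t + 2 * pi * \<i>)" and z = t, OF _ h_cont C])
    show "isCont (\<lambda>t. h (t + 2 * pi * \<i>)) t"
      by (rule continuous_at_compose[where g = h and f = "\<lambda>t. t + 2 * pi * \<i>", unfolded o_def])
        (auto intro: h_cont)
    show "\<forall>\<^sub>F t in nhds t. t \<notin> {t. g t = 0} \<longrightarrow> h (t + 2 * pi * \<i>) = h t"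
    proof (intro always_eventually allI impI)
      fix t assume "t \<notin> {t. g t = 0}"
      then show "h (t + 2 * pi * \<i>) = h t"
        using f1[of t] unfolding h(2) g1 by simp
    qed
  qed
  have h2: "h (t + \<tau>) = exp (- (y + t0)) * h t" for t
  proof (rule isCont_eq_off_countable[where f = "\<lambda>t. h (t + \<tau>)" and z = t
        and g = "\<lambda>t. exp (- (y + t0)) * h t", OF _ _ C])
    show "isCont (\<lambda>t. h (t + \<tau>)) t"
      by (rule continuous_at_compose[where g = h and f = "\<lambda>t. t + \<tau>", unfolded o_def])
        (auto intro: h_cont)
    show "isCont (\<lambda>t. exp (- (y + t0)) * h t) t"
      by (intro continuous_intros h_cont)
    show "\<forall>\<^sub>F t in nhds t. t \<notin> {t. g t = 0} \<longrightarrow> h (t + \<tau>) = exp (- (y + t0)) * h t"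
    proof (intro always_eventually allI impI)
      fix t assume "t \<notin> {t. g t = 0}"
      moreover have "exp (- (t + y) - \<tau> / 2) = exp (- (t + - t0) - \<tau> / 2) * exp (- (y + t0))"
        unfolding exp_add[symmetric] by (rule arg_cong[where f = exp]) (simp add: algebra_simps)
      ultimately show "h (t + \<tau>) = exp (- (y + t0)) * h t"
        using f2[of t] unfolding h(2) g2 by simp
    qed
  qed
  have ln: "Re \<tau> < 0"
    using q \<tau> norm_exp_eq_Re[of \<tau>] by simp
  \<comment> \<open>The exponential with this real rate cancels the absolute value of the multiplier
    of \<open>h\<close> under \<tau>; because the rate is real, it does not affect the norm under 2
    pi i.\<close>
  define \<alpha> where "\<alpha> = Re (y + t0) / Re \<tau>"
  define H where "H t = h t * exp (of_real \<alpha> * t)" for t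
  have H_hol: "H holomorphic_on UNIV"
    unfolding H_def by (intro holomorphic_intros h)
  have "bounded (range H)"
  proof (rule bounded_lattice_periodic_norm)
    show "continuous_on UNIV H" using H_hol by (rule holomorphic_on_imp_continuous_on)
    show "Re \<tau> \<noteq> 0" using ln by simp
    show "norm (H (t + 2 * pi * \<i>)) = norm (H t)" for t
      unfolding H_def h1 by (simp add: norm_mult)
    show "norm (H (t + \<tau>)) = norm (H t)" for t
    proof -
      have "Re (y + t0) = \<alpha> * Re \<tau>" using ln by (simp add: \<alpha>_def)
      then have "exp (Re (- (y + t0))) * exp (\<alpha> * Re (t + \<tau>)) = exp (\<alpha> * Re t)"
        by (simp add: algebra_simps flip: exp_add)
      then show ?thesis
        unfolding H_def h2 by (simp add: norm_mult algebra_simps)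
    qed
  qed
  then have "H constant_on UNIV" by (rule Liouville_theorem[OF H_hol])
  then obtain K where K: "\<And>t. H t = K" unfolding constant_on_def by auto
  have hK: "h t = K * exp (- (of_real \<alpha> * t))" for t
    using K[of t] by (simp add: H_def exp_minus field_simps)
  \<comment> \<open>Invariance under 2 pi i forces \<alpha> to be an integer, and then the shift by
    \<tau> exhibits \<open>exp (- (t0 + y))\<close> as a power of \<open>q\<close>.\<close>
  have "K = 0"
  proof (rule ccontr)
    assume "K \<noteq> 0"
    then have "exp (- (of_real \<alpha> * (2 * pi * \<i>))) = 1"
      using h1[of 0] by (simp add: hK)
    then obtain n :: int where "- (\<alpha> * (2 * pi)) = of_int (2 * n) * pi"
      unfolding exp_eq_1 by auto
    then have "pi * (\<alpha> + of_int n) = 0" by (simp add: algebra_simps)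
    then have "\<alpha> = - of_int n" by simp
    then have "exp (of_int n * \<tau>) = exp (- (y + t0))"
      using h2[of 0] \<open>K \<noteq> 0\<close> by (simp add: hK)
    then have "exp (- (t0 + y)) = q powi n"
      using \<tau> exp_power_int[of \<tau> n] by (simp add: mult.commute add.commute)
    then have "- (t0 + y) \<in> periods q" unfolding periods_def by blast
    from periods_minus[OF this] show False using np by (simp add: add.commute)
  qed
  then show ?thesis by (simp add: h(2) hK)
qed

section \<open>Lattice bases and their duality\<close>

lemma finite_compl [simp]: "finite (compl H p)"
  by (simp add: compl_def)

lemma sum_split_compl:
  fixes f :: "nat \<Rightarrow> 'a::comm_monoid_add"
  assumes "p \<subseteq> {..<dim_n H}"
  shows "(\<Sum>i<dim_n H. f i) = (\<Sum>i\<in>p. f i) + (\<Sum>j\<in>compl H p. f j)"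
  using assms unfolding compl_def by (subst sum.subset_diff[of p]) (auto simp: add.commute)

lemma prod_split_compl:
  fixes f :: "nat \<Rightarrow> 'a::comm_monoid_mult"
  assumes "p \<subseteq> {..<dim_n H}"
  shows "(\<Prod>i<dim_n H. f i) = (\<Prod>i\<in>p. f i) * (\<Prod>j\<in>compl H p. f j)"
  using assms unfolding compl_def by (subst prod.subset_diff[of p]) (auto simp: mult.commute)

text \<open>
  \<open>S\<close> and \<open>R\<close> are the inverses of the blocks of \<open>iota\<close> with rows off \<open>p\<close> and of \<open>beta\<close> with
  columns in \<open>p\<close>. Transposition exchanges them, which makes the notion self-dual.
\<close>

definition basis_cert ::
  "hypertoric \<Rightarrow> nat set \<Rightarrow> (nat \<Rightarrow> nat \<Rightarrow> int) \<Rightarrow> (nat \<Rightarrow> nat \<Rightarrow> int) \<Rightarrow> (nat \<Rightarrow> nat \<Rightarrow> int) \<Rightarrow> bool" where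
  "basis_cert H p C S R \<longleftrightarrow>
     p \<subseteq> {..<dim_n H} \<and>
     (\<forall>i\<in>p. \<forall>l<dim_k H. iota H i l = (\<Sum>j\<in>compl H p. C i j * iota H j l)) \<and>
     (\<forall>j\<in>compl H p. \<forall>l<dim_d H. beta H l j = - (\<Sum>i\<in>p. C i j * beta H l i)) \<and>
     (\<forall>j\<in>compl H p. \<forall>j'\<in>compl H p. (\<Sum>l<dim_k H. iota H j l * S l j') = (if j = j' then 1 else 0)) \<and>
     (\<forall>l<dim_k H. \<forall>l'<dim_k H. (\<Sum>j\<in>compl H p. S l j * iota H j l') = (if l = l' then 1 else 0)) \<and>
     (\<forall>i\<in>p. \<forall>i'\<in>p. (\<Sum>l<dim_d H. R i l * beta H l i') = (if i = i' then 1 else 0)) \<and>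
     (\<forall>l<dim_d H. \<forall>l'<dim_d H. (\<Sum>i\<in>p. beta H l i * R i l') = (if l = l' then 1 else 0))"

definition is_basis :: "hypertoric \<Rightarrow> nat set \<Rightarrow> bool" where
  "is_basis H p \<longleftrightarrow> (\<exists>C S R. basis_cert H p C S R)"

lemma is_basis_subset: "is_basis H p \<Longrightarrow> p \<subseteq> {..<dim_n H}"
  by (auto simp: is_basis_def basis_cert_def)

lemma is_basis_finite: "is_basis H p \<Longrightarrow> finite p"
  using is_basis_subset finite_subset by blast

text \<open>Multiplying an expansion in the columns of \<open>p\<close> by \<open>R\<close> recovers
  its coefficients. They are therefore unique, and the definite description in \<open>circ\<close>
  denotes them.\<close>

lemma circ_eq_cert:
  assumes "basis_cert H p C S R" "i \<in> p" "j \<in> compl H p"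
  shows "circ H p i j = C i j"
proof -
  have fin: "finite p" using assms(1) finite_subset by (auto simp: basis_cert_def)
  have beta: "\<forall>l<dim_d H. beta H l j = - (\<Sum>i\<in>p. C i j * beta H l i)"
    and R: "\<forall>i\<in>p. \<forall>i'\<in>p. (\<Sum>l<dim_d H. R i l * beta H l i') = (if i = i' then 1 else 0)"
    using assms by (auto simp: basis_cert_def)
  have solve: "c i' = - (\<Sum>l<dim_d H. R i' l * beta H l j)"
    if "\<forall>l<dim_d H. beta H l j = - (\<Sum>i\<in>p. c i * beta H l i)" "i' \<in> p" for c :: "nat \<Rightarrow> int" and i'
  proof -
    have "- (\<Sum>l<dim_d H. R i' l * beta H l j) = (\<Sum>l<dim_d H. R i' l * (\<Sum>i\<in>p. c i * beta H l i))"
      using that by (simp add: sum_negf)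
    also have "\<dots> = (\<Sum>l<dim_d H. \<Sum>i\<in>p. c i * (R i' l * beta H l i))"
      by (simp add: sum_distrib_left mult.left_commute)
    also have "\<dots> = (\<Sum>i\<in>p. c i * (\<Sum>l<dim_d H. R i' l * beta H l i))"
      by (subst sum.swap) (simp add: sum_distrib_left)
    also have "\<dots> = (\<Sum>i\<in>p. if i = i' then c i else 0)"
      using R that(2) by (intro sum.cong) auto
    also have "\<dots> = c i'" using fin that(2) by simp
    finally show ?thesis ..
  qed
  have "(THE c. (\<forall>i. i \<notin> p \<longrightarrow> c i = 0) \<and> (\<forall>l<dim_d H. beta H l j = - (\<Sum>i\<in>p. c i * beta H l i)))
      = (\<lambda>i. if i \<in> p then C i j else 0)"
  proof (rule the_equality)
    show "(\<forall>i. i \<notin> p \<longrightarrow> (if i \<in> p then C i j else 0) = 0) \<and>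
        (\<forall>l<dim_d H. beta H l j = - (\<Sum>i\<in>p. (if i \<in> p then C i j else 0) * beta H l i))"
      using beta by auto
    fix c :: "nat \<Rightarrow> int"
    assume c: "(\<forall>i. i \<notin> p \<longrightarrow> c i = 0) \<and> (\<forall>l<dim_d H. beta H l j = - (\<Sum>i\<in>p. c i * beta H l i))"
    show "c = (\<lambda>i. if i \<in> p then C i j else 0)"
    proof
      fix i show "c i = (if i \<in> p then C i j else 0)"
        using c solve[of c i] solve[of "\<lambda>i. C i j" i] beta by auto
    qed
  qed
  then show ?thesis using assms(2) by (simp add: circ_def)
qed

lemma is_basis_cert:
  assumes "is_basis H p"
  shows "\<exists>S R. basis_cert H p (circ H p) S R"
proof -
  obtain C S R where cert: "basis_cert H p C S R" using assms by (auto simp: is_basis_def)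
  have "basis_cert H p (circ H p) S R"
    using cert circ_eq_cert[OF cert] unfolding basis_cert_def by (simp cong: sum.cong)
  then show ?thesis by blast
qed

lemma iota_basis:
  assumes "is_basis H p" "i \<in> p" "l < dim_k H"
  shows "iota H i l = (\<Sum>j\<in>compl H p. circ H p i j * iota H j l)"
  using is_basis_cert[OF assms(1)] assms(2,3) unfolding basis_cert_def by blast

lemma beta_basis:
  assumes "is_basis H p" "j \<in> compl H p" "l < dim_d H"
  shows "beta H l j = - (\<Sum>i\<in>p. circ H p i j * beta H l i)"
  using is_basis_cert[OF assms(1)] assms(2,3) unfolding basis_cert_def by blast

lemma basis_iota_inverse:
  assumes "is_basis H p"
  obtains S where
    "\<And>j j'. j \<in> compl H p \<Longrightarrow> j' \<in> compl H p \<Longrightarrow>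
      (\<Sum>l<dim_k H. iota H j l * S l j') = (if j = j' then 1 else 0)"
    "\<And>i j'. i \<in> p \<Longrightarrow> j' \<in> compl H p \<Longrightarrow> (\<Sum>l<dim_k H. iota H i l * S l j') = circ H p i j'"
    "\<And>l l'. l < dim_k H \<Longrightarrow> l' < dim_k H \<Longrightarrow>
      (\<Sum>j\<in>compl H p. S l j * iota H j l') = (if l = l' then 1 else 0)"
proof -
  obtain S R where cert: "basis_cert H p (circ H p) S R" using is_basis_cert[OF assms] by blast
  have 1: "(\<Sum>l<dim_k H. iota H j l * S l j') = (if j = j' then 1 else 0)"
    if "j \<in> compl H p" "j' \<in> compl H p" for j j'
    using cert that unfolding basis_cert_def by blast
  have "(\<Sum>l<dim_k H. iota H i l * S l j') = circ H p i j'" if "i \<in> p" "j' \<in> compl H p" for i j'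
  proof -
    have "(\<Sum>l<dim_k H. iota H i l * S l j')
        = (\<Sum>l<dim_k H. (\<Sum>j\<in>compl H p. circ H p i j * iota H j l) * S l j')"
      using iota_basis[OF assms that(1)] by simp
    also have "\<dots> = (\<Sum>l<dim_k H. \<Sum>j\<in>compl H p. circ H p i j * (iota H j l * S l j'))"
      by (simp add: sum_distrib_right mult.assoc)
    also have "\<dots> = (\<Sum>j\<in>compl H p. circ H p i j * (\<Sum>l<dim_k H. iota H j l * S l j'))"
      by (subst sum.swap) (simp add: sum_distrib_left)
    also have "\<dots> = (\<Sum>j\<in>compl H p. if j = j' then circ H p i j else 0)"
      using 1 that(2) by (intro sum.cong) auto
    also have "\<dots> = circ H p i j'" using that(2) by simp
    finally show ?thesis .
  qed
  moreover have "(\<Sum>j\<in>compl H p. S l j * iota H j l') = (if l = l' then 1 else 0)"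
    if "l < dim_k H" "l' < dim_k H" for l l'
    using cert that unfolding basis_cert_def by blast
  ultimately show ?thesis using 1 that by blast
qed

lemma basis_beta_inverse:
  assumes "is_basis H p"
  obtains R where
    "\<And>i i'. i \<in> p \<Longrightarrow> i' \<in> p \<Longrightarrow> (\<Sum>l<dim_d H. R i l * beta H l i') = (if i = i' then 1 else 0)"
    "\<And>l l'. l < dim_d H \<Longrightarrow> l' < dim_d H \<Longrightarrow>
      (\<Sum>i\<in>p. beta H l i * R i l') = (if l = l' then 1 else 0)"
proof -
  obtain S R where cert: "basis_cert H p (circ H p) S R" using is_basis_cert[OF assms] by blast
  then show ?thesis using that[of R] unfolding basis_cert_def by blast
qed

text \<open>Both numbers are traces, of \<open>R\<close> times the block of \<open>beta\<close> and
  of the product in the other order.\<close>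

lemma is_basis_card:
  assumes "is_basis H p"
  shows "card p = dim_d H"
proof -
  obtain R where R1: "\<And>i i'. i \<in> p \<Longrightarrow> i' \<in> p \<Longrightarrow>
      (\<Sum>l<dim_d H. R i l * beta H l i') = (if i = i' then 1 else 0)"
    and R2: "\<And>l l'. l < dim_d H \<Longrightarrow> l' < dim_d H \<Longrightarrow>
      (\<Sum>i\<in>p. beta H l i * R i l') = (if l = l' then 1 else 0)"
    using basis_beta_inverse[OF assms] by blast
  have "int (card p) = (\<Sum>i\<in>p. \<Sum>l<dim_d H. R i l * beta H l i)"
    using R1 by simp
  also have "\<dots> = (\<Sum>l<dim_d H. \<Sum>i\<in>p. beta H l i * R i l)"
    by (subst sum.swap) (simp add: mult.commute)
  also have "\<dots> = int (dim_d H)" using R2 by simp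
  finally show ?thesis by simp
qed

lemma compl_compl: "p \<subseteq> {..<dim_n H} \<Longrightarrow> compl H (compl H p) = p"
  by (auto simp: compl_def)

lemma mirror_simps [simp]:
  "dim_n (mirror H) = dim_n H" "dim_k (mirror H) = dim_d H" "dim_d (mirror H) = dim_k H"
  "iota (mirror H) i l = beta H l i" "beta (mirror H) l i = iota H i l"
  "theta_lift (mirror H) i = - sigma_lift H i" "sigma_lift (mirror H) i = - theta_lift H i"
  "compl (mirror H) p = compl H p"
  by (auto simp: mirror_def compl_def)

text \<open>\<open>C\<close> changes sign under transposition because the relations for
  \<open>iota\<close> and for \<open>beta\<close> carry it with opposite signs.\<close>

lemma basis_cert_mirror:
  assumes "basis_cert H p C S R"
  shows "basis_cert (mirror H) (compl H p) (\<lambda>j i. - C i j) (\<lambda>l i. R i l) (\<lambda>j l. S l j)"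
proof -
  have p: "p \<subseteq> {..<dim_n H}" using assms by (simp add: basis_cert_def)
  show ?thesis
    using assms unfolding basis_cert_def mirror_simps compl_compl[OF p]
    by (auto simp: compl_def mult.commute sum_negf)
qed

lemma is_basis_mirror:
  assumes "is_basis H p"
  shows "is_basis (mirror H) (compl H p)"
  using assms basis_cert_mirror unfolding is_basis_def by blast

lemma circ_mirror:
  assumes "is_basis H p" "i \<in> p" "j \<in> compl H p"
  shows "circ (mirror H) (compl H p) j i = - circ H p i j"
proof -
  obtain S R where "basis_cert H p (circ H p) S R" using is_basis_cert[OF assms(1)] by blast
  from circ_eq_cert[OF basis_cert_mirror[OF this]] assms show ?thesis
    using compl_compl[OF is_basis_subset[OF assms(1)]] by simp
qed

lemma mirror_mirror: "mirror (mirror H) = H"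
  by (simp add: mirror_def)

lemma is_basis_mirror_iff:
  assumes "p \<subseteq> {..<dim_n H}"
  shows "is_basis (mirror H) p \<longleftrightarrow> is_basis H (compl H p)"
  using is_basis_mirror[of "mirror H" p] is_basis_mirror[of H "compl H p"] compl_compl[OF assms]
  by (auto simp: mirror_mirror)

text \<open>
  \<open>height H p j\<close> is the value at the vertex of \<open>p\<close> of the affine function vanishing on the
  \<open>j\<close>-th hyperplane, and \<open>slope H p i\<close> the growth of \<open>\<sigma>\<close> along the \<open>i\<close>-th edge at that vertex.
\<close>

definition height :: "hypertoric \<Rightarrow> nat set \<Rightarrow> nat \<Rightarrow> int" where
  "height H p j = (if j \<in> p then 0 else theta_lift H j + (\<Sum>i\<in>p. circ H p i j * theta_lift H i))"

definition slope :: "hypertoric \<Rightarrow> nat set \<Rightarrow> nat \<Rightarrow> int" where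
  "slope H p i = sigma_lift H i - (\<Sum>j\<in>compl H p. circ H p i j * sigma_lift H j)"

text \<open>
  The combinatorial content of smoothness and genericity. Unlike the geometric conditions it is
  visibly self-dual, so that uniqueness of stable envelopes is available on the mirror as well.
\<close>

definition generic_data :: "hypertoric \<Rightarrow> bool" where
  "generic_data H \<longleftrightarrow>
     (\<forall>p. is_basis H p \<longrightarrow>
        (\<forall>j\<in>compl H p. height H p j \<noteq> 0) \<and>
        (\<forall>i\<in>p. slope H p i \<noteq> 0) \<and>
        (\<forall>i\<in>p. \<forall>j\<in>compl H p. circ H p i j \<noteq> 0 \<longrightarrow> is_basis H (insert j (p - {i}))))"

text \<open>The mirror takes minus \<open>sigma_lift\<close> as its \<open>theta_lift\<close>, and
  its circuit matrix is minus the transpose; together they leave a single sign.\<close>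

lemma height_mirror:
  assumes "is_basis H p" "i \<in> p"
  shows "height (mirror H) (compl H p) i = - slope H p i"
proof -
  have "i \<notin> compl H p" using assms by (simp add: compl_def)
  then show ?thesis
    using circ_mirror[OF assms] by (simp add: height_def slope_def sum_negf)
qed

lemma slope_mirror:
  assumes "is_basis H p" "j \<in> compl H p"
  shows "slope (mirror H) (compl H p) j = - height H p j"
proof -
  have "j \<notin> p" using assms by (simp add: compl_def)
  then show ?thesis
    using circ_mirror[OF assms(1) _ assms(2)] compl_compl[OF is_basis_subset[OF assms(1)]]
    by (simp add: height_def slope_def sum_negf)
qed

text \<open>Heights and slopes trade places, and exchanging \<open>i\<close> for \<open>j\<close> in
  a basis exchanges \<open>j\<close> for \<open>i\<close> in its complement.\<close>

lemma generic_data_mirror: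
  assumes "generic_data H"
  shows "generic_data (mirror H)"
  unfolding generic_data_def
proof (intro allI impI conjI ballI)
  fix p' assume p': "is_basis (mirror H) p'"
  then have sub: "p' \<subseteq> {..<dim_n H}" using is_basis_subset by fastforce
  define p where "p = compl H p'"
  have p: "is_basis H p" using p' is_basis_mirror_iff[OF sub] by (simp add: p_def)
  have p'_eq: "p' = compl H p" unfolding p_def using compl_compl[OF sub] by simp
  have p_eq: "compl (mirror H) p' = p" by (simp add: p_def)
  show "height (mirror H) p' j \<noteq> 0" if "j \<in> compl (mirror H) p'" for j
  proof -
    have "j \<in> p" using that p_eq by simp
    then show ?thesis
      using assms p height_mirror[OF p, of j] unfolding p'_eq generic_data_def by simp
  qed
  show "slope (mirror H) p' i \<noteq> 0" if "i \<in> p'" for i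
    using that assms p slope_mirror[OF p, of i] unfolding p'_eq generic_data_def by simp
  fix i j assume ij: "i \<in> p'" "j \<in> compl (mirror H) p'" "circ (mirror H) p' i j \<noteq> 0"
  then have ji: "j \<in> p" "i \<in> compl H p" using p_eq p'_eq by auto
  then have "circ H p j i \<noteq> 0"
    using circ_mirror[OF p, of j i] ij(3) unfolding p'_eq by auto
  then have "is_basis H (insert i (p - {j}))"
    using ji assms p unfolding generic_data_def by blast
  then have "is_basis (mirror H) (compl H (insert i (p - {j})))" by (rule is_basis_mirror)
  moreover have "compl H (insert i (p - {j})) = insert j (p' - {i})"
    using ij sub unfolding p_eq by (auto simp: p_def compl_def)
  ultimately show "is_basis (mirror H) (insert j (p' - {i}))" by simp
qed

section \<open>Vertices of the arrangement and the signs at them\<close>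

text \<open>\<open>R\<close> solves the equations of the hyperplanes in \<open>p\<close> and shows
  that the solution is unique, so that \<open>vertex\<close> denotes it. The values at the other
  hyperplanes follow by expanding \<open>beta\<close> in the basis.\<close>

lemma vertex_eq:
  assumes "is_basis H p"
  shows "vertex H p \<in> vec_space {..<dim_d H} \<and>
    (\<forall>j<dim_n H. (\<Sum>l<dim_d H. vertex H p l * of_int (beta H l j)) + of_int (theta_lift H j)
       = of_int (height H p j))" (is ?A)
    and "p \<in> fixed_points H" (is ?B)
proof -
  obtain R where R1: "\<And>i i'. i \<in> p \<Longrightarrow> i' \<in> p \<Longrightarrow>
      (\<Sum>l<dim_d H. R i l * beta H l i') = (if i = i' then 1 else 0)"
    and R2: "\<And>l l'. l < dim_d H \<Longrightarrow> l' < dim_d H \<Longrightarrow>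
      (\<Sum>i\<in>p. beta H l i * R i l') = (if l = l' then 1 else 0)"
    using basis_beta_inverse[OF assms] by blast
  have fin: "finite p" by (rule is_basis_finite[OF assms])
  define x :: "nat \<Rightarrow> real" where
    "x l = (if l < dim_d H then - (\<Sum>i\<in>p. of_int (theta_lift H i) * of_int (R i l)) else 0)" for l
  have x0: "x \<in> vec_space {..<dim_d H}" by (auto simp: vec_space_def x_def)
  have xp: "(\<Sum>l<dim_d H. x l * of_int (beta H l i)) = - of_int (theta_lift H i)" if "i \<in> p" for i
  proof -
    have "(\<Sum>l<dim_d H. x l * of_int (beta H l i))
        = - (\<Sum>l<dim_d H. \<Sum>i'\<in>p. of_int (theta_lift H i') * (of_int (R i' l) * of_int (beta H l i)))"
      by (simp add: x_def sum_distrib_right sum_negf mult.assoc)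
    also have "\<dots> = - (\<Sum>i'\<in>p. of_int (theta_lift H i') * of_int (\<Sum>l<dim_d H. R i' l * beta H l i))"
      by (subst sum.swap) (simp add: sum_distrib_left)
    also have "\<dots> = - (\<Sum>i'\<in>p. if i' = i then of_int (theta_lift H i') else 0)"
      using R1 that by (intro arg_cong[where f = uminus] sum.cong) auto
    also have "\<dots> = - of_int (theta_lift H i)" using fin that by simp
    finally show ?thesis .
  qed
  have uniq: "y = x" if y: "y \<in> vec_space {..<dim_d H}" "\<And>i. i \<in> p \<Longrightarrow> y \<in> hyperplane H i" for y
  proof
    fix l'
    show "y l' = x l'"
    proof (cases "l' < dim_d H")
      case False
      then show ?thesis using y(1) x0 by (simp add: vec_space_def)
    next
      case True
      have rec: "z l' = (\<Sum>i\<in>p. (\<Sum>l<dim_d H. z l * of_int (beta H l i)) * of_int (R i l'))" for z :: "nat \<Rightarrow> real"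
      proof -
        have "(\<Sum>i\<in>p. (\<Sum>l<dim_d H. z l * of_int (beta H l i)) * of_int (R i l'))
            = (\<Sum>i\<in>p. \<Sum>l<dim_d H. z l * (of_int (beta H l i) * of_int (R i l')))"
          by (simp add: sum_distrib_right mult.assoc)
        also have "\<dots> = (\<Sum>l<dim_d H. z l * of_int (\<Sum>i\<in>p. beta H l i * R i l'))"
          by (subst sum.swap) (simp add: sum_distrib_left)
        also have "\<dots> = (\<Sum>l<dim_d H. if l = l' then z l else 0)"
          using R2 True by (intro sum.cong) auto
        also have "\<dots> = z l'" using True by simp
        finally show ?thesis ..
      qed
      have "(\<Sum>l<dim_d H. y l * of_int (beta H l i)) = (\<Sum>l<dim_d H. x l * of_int (beta H l i))"
        if "i \<in> p" for i
        using y(2)[OF that] xp[OF that] by (simp add: hyperplane_def)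
      then show ?thesis using rec[of y] rec[of x] by simp
    qed
  qed
  have x_hyp: "x \<in> hyperplane H i" if "i \<in> p" for i
    using x0 xp[OF that] by (simp add: hyperplane_def)
  have v: "vertex H p = x"
    unfolding vertex_def by (rule the_equality) (use x0 x_hyp uniq in blast)+
  show ?B
    unfolding fixed_points_def using x0 x_hyp is_basis_subset[OF assms] is_basis_card[OF assms] by blast
  have "(\<Sum>l<dim_d H. x l * of_int (beta H l j)) + of_int (theta_lift H j) = of_int (height H p j)"
    if "j < dim_n H" for j
  proof (cases "j \<in> p")
    case True
    then show ?thesis using xp by (simp add: height_def)
  next
    case False
    then have j: "j \<in> compl H p" using that by (simp add: compl_def)
    have "(\<Sum>l<dim_d H. x l * of_int (beta H l j))
        = (\<Sum>l<dim_d H. \<Sum>i\<in>p. - (of_int (circ H p i j) * (x l * of_int (beta H l i))))"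
      by (intro sum.cong refl) (simp add: beta_basis[OF assms j] sum_distrib_left sum_negf algebra_simps)
    also have "\<dots> = (\<Sum>i\<in>p. - (of_int (circ H p i j) * (\<Sum>l<dim_d H. x l * of_int (beta H l i))))"
      by (subst sum.swap) (simp add: sum_distrib_left sum_negf)
    also have "\<dots> = (\<Sum>i\<in>p. of_int (circ H p i j) * of_int (theta_lift H i))"
      using xp by (intro sum.cong) auto
    finally show ?thesis using False by (simp add: height_def)
  qed
  then show ?A using v x0 by simp
qed

lemma A_plus_eq:
  assumes "is_basis H p"
  shows "A_plus H p = {j \<in> compl H p. height H p j \<ge> 0}"
proof -
  have *: "(\<Sum>l<dim_d H. vertex H p l * of_int (beta H l j)) = of_int (height H p j) - of_int (theta_lift H j)"
    if "j \<in> compl H p" for j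
    using vertex_eq(1)[OF assms] that by (fastforce simp: compl_def)
  show ?thesis
    using vertex_eq(1)[OF assms] by (auto simp: A_plus_def halfspace_plus_def *)
qed

lemma A_minus_eq:
  assumes "is_basis H p"
  shows "A_minus H p = {j \<in> compl H p. height H p j \<le> 0}"
proof -
  have *: "(\<Sum>l<dim_d H. vertex H p l * of_int (beta H l j)) = of_int (height H p j) - of_int (theta_lift H j)"
    if "j \<in> compl H p" for j
    using vertex_eq(1)[OF assms] that by (fastforce simp: compl_def)
  show ?thesis
    using vertex_eq(1)[OF assms] by (auto simp: A_minus_def halfspace_minus_def *)
qed

lemma A_plus_generic:
  assumes "generic_data H" "is_basis H p"
  shows "A_plus H p = {j \<in> compl H p. height H p j > 0}"
  using assms unfolding A_plus_eq[OF assms(2)] generic_data_def by force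

lemma A_minus_generic:
  assumes "generic_data H" "is_basis H p"
  shows "A_minus H p = {j \<in> compl H p. height H p j < 0}"
  using assms unfolding A_minus_eq[OF assms(2)] generic_data_def by force

lemma p_plus_eq: "p_plus H p = {i \<in> p. slope H p i > 0}"
  by (simp add: p_plus_def slope_def)

lemma p_minus_eq: "p_minus H p = {i \<in> p. slope H p i < 0}"
  by (simp add: p_minus_def slope_def)

section \<open>The row space of beta, edges and slopes\<close>

text \<open>The image of the dual of beta plays two roles: its elements record how the hyperplane
  values change when a point moves by an integral vector, and they are exponents of
  \<open>K\<close>-invariant monomials. Entries from \<open>dim_n H\<close> on are left
  free.\<close>

definition row_space :: "hypertoric \<Rightarrow> (nat \<Rightarrow> int) set" where
  "row_space H = {v. \<exists>x. \<forall>j<dim_n H. v j = (\<Sum>l<dim_d H. x l * beta H l j)}"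

lemma row_space_basis:
  assumes "is_basis H p" "v \<in> row_space H" "j \<in> compl H p"
  shows "v j = - (\<Sum>i\<in>p. circ H p i j * v i)"
proof -
  obtain x where x: "\<And>j. j < dim_n H \<Longrightarrow> v j = (\<Sum>l<dim_d H. x l * beta H l j)"
    using assms(2) by (auto simp: row_space_def)
  have "j < dim_n H" using assms(3) by (simp add: compl_def)
  then have "v j = (\<Sum>l<dim_d H. x l * - (\<Sum>i\<in>p. circ H p i j * beta H l i))"
    using x[of j] beta_basis[OF assms(1,3)] by simp
  also have "\<dots> = (\<Sum>l<dim_d H. \<Sum>i\<in>p. - (circ H p i j * (x l * beta H l i)))"
    by (simp add: sum_distrib_left sum_negf mult.left_commute)
  also have "\<dots> = (\<Sum>i\<in>p. - (circ H p i j * (\<Sum>l<dim_d H. x l * beta H l i)))"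
    by (subst sum.swap) (simp add: sum_distrib_left sum_negf)
  also have "\<dots> = (\<Sum>i\<in>p. - (circ H p i j * v i))"
    using x is_basis_subset[OF assms(1)] by (intro sum.cong) auto
  finally show ?thesis by (simp add: sum_negf)
qed

lemma row_space_add:
  assumes "u \<in> row_space H" "v \<in> row_space H"
  shows "(\<lambda>j. u j + c * v j) \<in> row_space H"
proof -
  obtain x y where "\<forall>j<dim_n H. u j = (\<Sum>l<dim_d H. x l * beta H l j)"
    "\<forall>j<dim_n H. v j = (\<Sum>l<dim_d H. y l * beta H l j)"
    using assms unfolding row_space_def by blast
  then have "\<forall>j<dim_n H. u j + c * v j = (\<Sum>l<dim_d H. (x l + c * y l) * beta H l j)"
    by (simp add: distrib_right sum.distrib sum_distrib_left mult.assoc)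
  then show ?thesis
    unfolding row_space_def by (intro CollectI exI[of _ "\<lambda>l. x l + c * y l"])
qed

text \<open>The edge direction at \<open>p\<close> along which only the hyperplane of \<open>i\<close> is left.\<close>

definition edge :: "hypertoric \<Rightarrow> nat set \<Rightarrow> nat \<Rightarrow> nat \<Rightarrow> int" where
  "edge H p i j = (if j \<in> p then (if j = i then 1 else 0) else - circ H p i j)"

lemma edge_in_row_space:
  assumes "is_basis H p" "i \<in> p"
  shows "edge H p i \<in> row_space H"
proof -
  obtain R where R1: "\<And>i i'. i \<in> p \<Longrightarrow> i' \<in> p \<Longrightarrow>
      (\<Sum>l<dim_d H. R i l * beta H l i') = (if i = i' then 1 else 0)"
    and "\<And>l l'. l < dim_d H \<Longrightarrow> l' < dim_d H \<Longrightarrow>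
      (\<Sum>i\<in>p. beta H l i * R i l') = (if l = l' then 1 else 0)"
    using basis_beta_inverse[OF assms(1)] by blast
  \<comment> \<open>Row \<open>i\<close> of the inverse has the prescribed entries on
    \<open>p\<close>; a vector of the row space is determined by these.\<close>
  define v where "v j = (\<Sum>l<dim_d H. R i l * beta H l j)" for j
  have v: "v \<in> row_space H" unfolding row_space_def v_def by blast
  have vp: "v j = (if j = i then 1 else 0)" if "j \<in> p" for j
    unfolding v_def using R1[OF assms(2) that] by auto
  have "edge H p i j = v j" if "j < dim_n H" for j
  proof (cases "j \<in> p")
    case True
    then show ?thesis using vp by (simp add: edge_def)
  next
    case False
    then have "v j = - (\<Sum>i'\<in>p. circ H p i' j * v i')"
      using that row_space_basis[OF assms(1) v, of j] by (simp add: compl_def)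
    also have "\<dots> = - (\<Sum>i'\<in>p. if i' = i then circ H p i' j else 0)"
      using vp by (intro arg_cong[where f = uminus] sum.cong) auto
    finally show ?thesis using False assms is_basis_finite[OF assms(1)] by (simp add: edge_def)
  qed
  then show ?thesis using v unfolding row_space_def by auto
qed

text \<open>The vertex of \<open>p\<close> is an integral point, and this is its pairing with the
  columns of \<open>beta\<close>.\<close>

lemma height_minus_theta_in_row_space:
  assumes "is_basis H p"
  shows "(\<lambda>j. height H p j - theta_lift H j) \<in> row_space H"
proof -
  obtain R where R1: "\<And>i i'. i \<in> p \<Longrightarrow> i' \<in> p \<Longrightarrow>
      (\<Sum>l<dim_d H. R i l * beta H l i') = (if i = i' then 1 else 0)"
    and "\<And>l l'. l < dim_d H \<Longrightarrow> l' < dim_d H \<Longrightarrow>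
      (\<Sum>i\<in>p. beta H l i * R i l') = (if l = l' then 1 else 0)"
    using basis_beta_inverse[OF assms(1)] by blast
  define x where "x l = - (\<Sum>i\<in>p. theta_lift H i * R i l)" for l
  define v where "v j = (\<Sum>l<dim_d H. x l * beta H l j)" for j
  have v: "v \<in> row_space H" unfolding row_space_def v_def by blast
  have vp: "v j = - theta_lift H j" if "j \<in> p" for j
  proof -
    have "v j = - (\<Sum>l<dim_d H. \<Sum>i\<in>p. theta_lift H i * (R i l * beta H l j))"
      by (simp add: v_def x_def sum_distrib_right sum_negf mult.assoc)
    also have "\<dots> = - (\<Sum>i\<in>p. theta_lift H i * (\<Sum>l<dim_d H. R i l * beta H l j))"
      by (subst sum.swap) (simp add: sum_distrib_left)
    also have "\<dots> = - (\<Sum>i\<in>p. if i = j then theta_lift H i else 0)"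
      using R1 that by (intro arg_cong[where f = uminus] sum.cong) auto
    finally show ?thesis using that is_basis_finite[OF assms] by simp
  qed
  have "height H p j - theta_lift H j = v j" if "j < dim_n H" for j
  proof (cases "j \<in> p")
    case True
    then show ?thesis using vp by (simp add: height_def)
  next
    case False
    then have "v j = - (\<Sum>i'\<in>p. circ H p i' j * v i')"
      using that row_space_basis[OF assms(1) v, of j] by (simp add: compl_def)
    also have "\<dots> = (\<Sum>i'\<in>p. circ H p i' j * theta_lift H i')"
      using vp by (simp add: sum_negf)
    finally show ?thesis using False by (simp add: height_def)
  qed
  then show ?thesis using v unfolding row_space_def by auto
qed

text \<open>A vector of hyperplane values is determined by its zeros on a basis. This identifies the
  heights at the far end of an edge.\<close>

lemma height_unique:
  assumes "is_basis H p" "(\<lambda>j. v j - theta_lift H j) \<in> row_space H"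
    and "\<And>i. i \<in> p \<Longrightarrow> v i = 0" and "j < dim_n H"
  shows "v j = height H p j"
proof (cases "j \<in> p")
  case True
  then show ?thesis using assms(3) by (simp add: height_def)
next
  case False
  then show ?thesis
    using row_space_basis[OF assms(1,2), of j] assms(3,4)
    by (simp add: compl_def height_def sum_negf)
qed

text \<open>Eliminating the entries off \<open>p\<close> turns the coefficients of the lift into
  slopes. One growth rate of \<sigma> can thus be expanded at any vertex, not only at the one where
  the edge starts.\<close>

lemma row_space_slope:
  assumes "is_basis H p" "v \<in> row_space H"
  shows "(\<Sum>j<dim_n H. sigma_lift H j * v j) = (\<Sum>i\<in>p. slope H p i * v i)"
proof -
  have "(\<Sum>j\<in>compl H p. sigma_lift H j * v j)
      = (\<Sum>j\<in>compl H p. \<Sum>i\<in>p. - (circ H p i j * sigma_lift H j * v i))"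
    using row_space_basis[OF assms]
    by (intro sum.cong refl) (simp add: sum_distrib_left sum_negf algebra_simps)
  also have "\<dots> = - (\<Sum>i\<in>p. (\<Sum>j\<in>compl H p. circ H p i j * sigma_lift H j) * v i)"
    by (subst sum.swap) (simp add: sum_distrib_right sum_negf)
  finally show ?thesis
    unfolding sum_split_compl[OF is_basis_subset[OF assms(1)]]
    by (simp add: slope_def left_diff_distrib sum_subtractf)
qed

lemma edge_slope:
  assumes "is_basis H p" "i \<in> p"
  shows "(\<Sum>j<dim_n H. sigma_lift H j * edge H p i j) = slope H p i"
proof -
  have "(\<Sum>j<dim_n H. sigma_lift H j * edge H p i j) = (\<Sum>i'\<in>p. slope H p i' * edge H p i i')"
    by (rule row_space_slope[OF assms(1) edge_in_row_space[OF assms]])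
  also have "\<dots> = (\<Sum>i'\<in>p. if i' = i then slope H p i' else 0)"
    by (intro sum.cong) (auto simp: edge_def)
  finally show ?thesis using assms is_basis_finite[OF assms(1)] by simp
qed

text \<open>Read off from a single basis rather than from exactness of the sequence, so that it is
  available on the mirror through \<open>generic_data\<close>.\<close>

lemma row_space_iota:
  assumes "is_basis H p" "v \<in> row_space H" "l < dim_k H"
  shows "(\<Sum>j<dim_n H. iota H j l * v j) = 0"
proof -
  have "(\<Sum>j\<in>compl H p. iota H j l * v j)
      = (\<Sum>j\<in>compl H p. \<Sum>i\<in>p. - (circ H p i j * iota H j l * v i))"
    using row_space_basis[OF assms(1,2)]
    by (intro sum.cong refl) (simp add: sum_distrib_left sum_negf algebra_simps)
  also have "\<dots> = - (\<Sum>i\<in>p. (\<Sum>j\<in>compl H p. circ H p i j * iota H j l) * v i)"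
    by (subst sum.swap) (simp add: sum_distrib_right sum_negf)
  also have "\<dots> = - (\<Sum>i\<in>p. iota H i l * v i)"
    using iota_basis[OF assms(1) _ assms(3)] by simp
  finally show ?thesis
    unfolding sum_split_compl[OF is_basis_subset[OF assms(1)]] by simp
qed

text \<open>Expanding the \<open>i\<close>-th edge direction at \<open>p\<close> in the neighbouring
  basis exhibits the entry as a divisor of 1. Steps along edges therefore have unit size on every
  hyperplane they meet.\<close>

lemma pivot_circ_unit:
  assumes "generic_data H" "is_basis H p" "i \<in> p" "j \<in> compl H p" "circ H p i j \<noteq> 0"
  shows "\<bar>circ H p i j\<bar> = 1"
proof -
  define p2 where "p2 = insert j (p - {i})"
  have p2: "is_basis H p2" using assms unfolding generic_data_def p2_def by blast
  have j: "j \<notin> p" "j < dim_n H" and i: "i < dim_n H"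
    using assms is_basis_subset by (auto simp: compl_def)
  then have i2: "i \<in> compl H p2" using assms by (auto simp: compl_def p2_def)
  have fin: "finite p2" by (rule is_basis_finite[OF p2])
  have "1 = edge H p i i" using assms(3) by (simp add: edge_def)
  also have "\<dots> = - (\<Sum>i'\<in>p2. circ H p2 i' i * edge H p i i')"
    by (rule row_space_basis[OF p2 edge_in_row_space[OF assms(2,3)] i2])
  also have "\<dots> = - (\<Sum>i'\<in>p2. if i' = j then circ H p2 i' i * edge H p i i' else 0)"
    using j(1) by (intro arg_cong[where f = uminus] sum.cong) (auto simp: p2_def edge_def)
  also have "\<dots> = circ H p2 j i * circ H p i j"
    using fin j(1) by (simp add: p2_def edge_def)
  finally show ?thesis
    by (metis abs_1 abs_mult zmult_eq_1_iff abs_minus_cancel)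
qed

section \<open>Torus orbits and rational points\<close>

lemma power_int_sum:
  fixes x :: complex
  assumes "x \<noteq> 0"
  shows "x powi (\<Sum>a\<in>A. f a) = (\<Prod>a\<in>A. x powi f a)"
  by (induction A rule: infinite_finite_induct) (auto simp: power_int_add assms)

lemma power_int_prod:
  fixes f :: "'a \<Rightarrow> complex"
  shows "(\<Prod>a\<in>A. f a) powi m = (\<Prod>a\<in>A. f a powi m)"
  by (induction A rule: infinite_finite_induct) (auto simp: power_int_mult_distrib)

lemma K_torus_nonzero: "g \<in> K_torus H \<Longrightarrow> l < dim_k H \<Longrightarrow> g l \<noteq> 0"
  by (simp add: K_torus_def)

lemma K_incl_nonzero:
  assumes "g \<in> K_torus H"
  shows "K_incl H g i \<noteq> 0"
  using assms by (simp add: K_incl_def K_torus_def)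

lemma K_act_eq:
  "K_act H g x = (\<lambda>i. K_incl H g i * fst x i, \<lambda>i. inverse (K_incl H g i) * snd x i)"
  by (simp add: K_act_def torus_act_def)

lemma K_torus_powi_sum:
  assumes "g \<in> K_torus H"
  shows "(\<Prod>i\<in>A. K_incl H g i powi m i) = (\<Prod>l<dim_k H. g l powi (\<Sum>i\<in>A. iota H i l * m i))"
proof -
  have "(\<Prod>l<dim_k H. g l powi (\<Sum>i\<in>A. iota H i l * m i))
      = (\<Prod>l<dim_k H. \<Prod>i\<in>A. (g l powi iota H i l) powi m i)"
    using K_torus_nonzero[OF assms] by (intro prod.cong refl) (simp add: power_int_sum power_int_mult)
  also have "\<dots> = (\<Prod>i\<in>A. K_incl H g i powi m i)"
    by (subst prod.swap) (simp add: K_incl_def power_int_prod)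
  finally show ?thesis ..
qed

text \<open>The characters with index off \<open>p\<close> are coordinates on \<open>K\<close>,
  because the corresponding block of \<open>iota\<close> has the integral inverse \<open>S\<close>.
  The same inverse solves for a group element with given characters in
  \<open>K_torus_extend\<close>.\<close>

lemma K_faithful:
  assumes "is_basis H p" "g \<in> K_torus H" "\<And>j. j \<in> compl H p \<Longrightarrow> K_incl H g j = 1" "l < dim_k H"
  shows "g l = 1"
proof -
  obtain S where S: "\<And>l l'. l < dim_k H \<Longrightarrow> l' < dim_k H \<Longrightarrow>
      (\<Sum>j\<in>compl H p. S l j * iota H j l') = (if l = l' then 1 else 0)"
    using basis_iota_inverse[OF assms(1)] by metis
  have "1 = (\<Prod>j\<in>compl H p. K_incl H g j powi S l j)"
    using assms(3) by simp
  also have "\<dots> = (\<Prod>l'<dim_k H. g l' powi (\<Sum>j\<in>compl H p. iota H j l' * S l j))"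
    by (rule K_torus_powi_sum[OF assms(2)])
  also have "\<dots> = (\<Prod>l'<dim_k H. if l' = l then g l' else 1)"
    using S[OF assms(4)] by (intro prod.cong) (auto simp: mult.commute)
  also have "\<dots> = g l" using assms(4) by simp
  finally show ?thesis ..
qed

lemma K_torus_basis:
  assumes "is_basis H p" "g \<in> K_torus H" "i \<in> p"
  shows "K_incl H g i = (\<Prod>j\<in>compl H p. K_incl H g j powi circ H p i j)"
  unfolding K_torus_powi_sum[OF assms(2)] K_incl_def[of H g i]
  using iota_basis[OF assms(1,3)] by (simp add: mult.commute)

lemma K_torus_extend:
  assumes "is_basis H p" "\<And>j. j \<in> compl H p \<Longrightarrow> \<gamma> j \<noteq> 0"
  obtains g where "g \<in> K_torus H" "\<And>j. j \<in> compl H p \<Longrightarrow> K_incl H g j = \<gamma> j"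
proof -
  obtain S where S: "\<And>j j'. j \<in> compl H p \<Longrightarrow> j' \<in> compl H p \<Longrightarrow>
      (\<Sum>l<dim_k H. iota H j l * S l j') = (if j = j' then 1 else 0)"
    using basis_iota_inverse[OF assms(1)] by metis
  define g where "g l = (if l < dim_k H then \<Prod>j\<in>compl H p. \<gamma> j powi S l j else 0)" for l
  have g: "g \<in> K_torus H"
    using assms(2) by (auto simp: K_torus_def vec_space_def g_def)
  have "K_incl H g j = \<gamma> j" if "j \<in> compl H p" for j
  proof -
    have "K_incl H g j = (\<Prod>l<dim_k H. \<Prod>j'\<in>compl H p. \<gamma> j' powi (iota H j l * S l j'))"
      unfolding K_incl_def by (intro prod.cong refl) (simp add: g_def power_int_prod power_int_mult mult.commute)
    also have "\<dots> = (\<Prod>j'\<in>compl H p. \<gamma> j' powi (\<Sum>l<dim_k H. iota H j l * S l j'))"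
      using assms(2) by (subst prod.swap) (simp add: power_int_sum)
    also have "\<dots> = (\<Prod>j'\<in>compl H p. if j' = j then \<gamma> j' else 1)"
      using S[OF that] by (intro prod.cong) auto
    also have "\<dots> = \<gamma> j" using that by simp
    finally show ?thesis .
  qed
  with g show ?thesis by (rule that)
qed

lemma K_incl_mult: "K_incl H (\<lambda>l. g l * g' l) i = K_incl H g i * K_incl H g' i"
  by (simp add: K_incl_def power_int_mult_distrib prod.distrib)

lemma K_incl_inverse: "K_incl H (\<lambda>l. inverse (g l)) i = inverse (K_incl H g i)"
  by (simp add: K_incl_def power_int_inverse prod_inversef[symmetric])

lemma K_torus_one: "(\<lambda>l. if l < dim_k H then 1 else 0) \<in> K_torus H"
  "K_incl H (\<lambda>l. if l < dim_k H then 1 else 0) i = 1"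
  by (auto simp: K_torus_def vec_space_def K_incl_def)

lemma K_orbit_self: "x \<in> K_orbit H x"
  unfolding K_orbit_def using K_torus_one by (intro image_eqI) (auto simp: K_act_eq)

lemma K_orbit_eqI:
  assumes "y \<in> K_orbit H x"
  shows "K_orbit H y = K_orbit H x"
proof -
  have sub: "K_orbit H b \<subseteq> K_orbit H a" if ba: "b \<in> K_orbit H a" for a b
  proof
    fix c assume "c \<in> K_orbit H b"
    then obtain g where g: "g \<in> K_torus H" "c = K_act H g b" unfolding K_orbit_def by blast
    obtain g' where g': "g' \<in> K_torus H" "b = K_act H g' a"
      using ba unfolding K_orbit_def by blast
    have "c = K_act H (\<lambda>l. g l * g' l) a"
      unfolding g g' by (simp add: K_act_eq K_incl_mult mult_ac)
    moreover have "(\<lambda>l. g l * g' l) \<in> K_torus H"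
      using g(1) g'(1) by (auto simp: K_torus_def vec_space_def)
    ultimately show "c \<in> K_orbit H a" by (auto simp: K_orbit_def)
  qed
  obtain g where g: "g \<in> K_torus H" "y = K_act H g x" using assms by (auto simp: K_orbit_def)
  have "x = K_act H (\<lambda>l. inverse (g l)) y"
    unfolding g using K_incl_nonzero[OF g(1)]
    by (simp add: K_act_eq K_incl_inverse mult.assoc[symmetric])
  moreover have "(\<lambda>l. inverse (g l)) \<in> K_torus H"
    using g(1) by (auto simp: K_torus_def vec_space_def)
  ultimately have "x \<in> K_orbit H y" by (auto simp: K_orbit_def)
  with sub assms show ?thesis by blast
qed

lemma torus_act_K_orbit:
  assumes "\<And>j. a j \<noteq> 0" "h \<noteq> 0"
  shows "torus_act a h ` K_orbit H x = K_orbit H (torus_act a h x)"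
proof -
  have "torus_act a h (K_act H g x) = K_act H g (torus_act a h x)" for g
    by (simp add: K_act_eq torus_act_def mult_ac)
  then show ?thesis by (simp add: K_orbit_def image_image)
qed

lemma points_K_orbit:
  assumes "x \<in> points H" "y \<in> x"
  shows "x = K_orbit H y"
  using assms K_orbit_eqI by (fastforce simp: points_def)

section \<open>Monomials as semi-invariants\<close>

text \<open>Negative exponents are realised by the cotangent coordinate, whose torus weight is
  inverse. Every integer vector is thus the weight of a polynomial.\<close>

definition monomial :: "hypertoric \<Rightarrow> (nat \<Rightarrow> int) \<Rightarrow> phase \<Rightarrow> complex" where
  "monomial H m x = (\<Prod>j<dim_n H. if m j \<ge> 0 then fst x j ^ nat (m j) else snd x j ^ nat (- m j))"

lemma poly_fun_power: "poly_fun n f \<Longrightarrow> poly_fun n (\<lambda>x. f x ^ m)"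
  by (induction m) (auto intro: poly_fun.intros)

lemma poly_fun_prod:
  "(\<And>a. a \<in> A \<Longrightarrow> poly_fun n (f a)) \<Longrightarrow> poly_fun n (\<lambda>x. \<Prod>a\<in>A. f a x)"
  by (induction A rule: infinite_finite_induct) (auto intro: poly_fun.intros)

lemma monomial_poly: "poly_fun (dim_n H) (monomial H m)"
proof -
  have "poly_fun (dim_n H) (\<lambda>x. if m j \<ge> 0 then fst x j ^ nat (m j) else snd x j ^ nat (- m j))"
    if "j < dim_n H" for j
    using that by (cases "m j \<ge> 0") (auto intro: poly_fun_power poly_fun.intros)
  then show ?thesis unfolding monomial_def[abs_def] by (intro poly_fun_prod) auto
qed

lemma monomial_torus:
  assumes "\<And>j. j < dim_n H \<Longrightarrow> a j \<noteq> 0"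
  shows "monomial H m (torus_act a 1 x) = (\<Prod>j<dim_n H. a j powi m j) * monomial H m x"
  unfolding monomial_def prod.distrib[symmetric]
  by (intro prod.cong refl) (auto simp: torus_act_def power_mult_distrib power_int_def)

lemma monomial_K:
  assumes "g \<in> K_torus H"
  shows "monomial H m (K_act H g x) =
    (\<Prod>l<dim_k H. g l powi (\<Sum>j<dim_n H. iota H j l * m j)) * monomial H m x"
  unfolding K_act_def using monomial_torus[of H "K_incl H g" m x] K_incl_nonzero[OF assms]
  by (simp add: K_torus_powi_sum[OF assms])

lemma monomial_eq_0_iff:
  "monomial H m x = 0 \<longleftrightarrow>
    (\<exists>j<dim_n H. (m j > 0 \<and> fst x j = 0) \<or> (m j < 0 \<and> snd x j = 0))"
proof -
  have "monomial H m x = 0 \<longleftrightarrow>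
      (\<exists>j\<in>{..<dim_n H}. (if m j \<ge> 0 then fst x j ^ nat (m j) else snd x j ^ nat (- m j)) = 0)"
    unfolding monomial_def by (rule prod_zero_iff) simp
  also have "\<dots> \<longleftrightarrow> (\<exists>j<dim_n H. (m j > 0 \<and> fst x j = 0) \<or> (m j < 0 \<and> snd x j = 0))"
  proof -
    have "(if m j \<ge> 0 then fst x j ^ nat (m j) else snd x j ^ nat (- m j)) = 0
        \<longleftrightarrow> (m j > 0 \<and> fst x j = 0) \<or> (m j < 0 \<and> snd x j = 0)" for j
      by auto
    then show ?thesis by (simp only: Bex_def lessThan_iff)
  qed
  finally show ?thesis .
qed

lemma semistable_monomial:
  assumes "x \<in> moment_zero H" "N > 0"
    and "\<And>l. l < dim_k H \<Longrightarrow> (\<Sum>j<dim_n H. iota H j l * m j) = int N * theta_char H l"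
    and "\<And>j. j < dim_n H \<Longrightarrow> m j > 0 \<Longrightarrow> fst x j \<noteq> 0"
    and "\<And>j. j < dim_n H \<Longrightarrow> m j < 0 \<Longrightarrow> snd x j \<noteq> 0"
  shows "x \<in> semistable H"
proof -
  have "monomial H m (K_act H g y) = (\<Prod>l<dim_k H. g l powi theta_char H l) ^ N * monomial H m y"
    if "g \<in> K_torus H" for g y
    unfolding monomial_K[OF that] using assms(3)
    by (simp add: power_int_mult prod_power_distrib mult.commute[of "int N"] power_int_of_nat)
  moreover have "monomial H m x \<noteq> 0" using assms(4,5) monomial_eq_0_iff by blast
  ultimately show ?thesis
    unfolding semistable_def using assms(1,2) monomial_poly[of H m]
    by (intro CollectI conjI exI[of _ N] exI[of _ "monomial H m"]) auto
qed

lemma moment_zeroI: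
  assumes "fst x \<in> vec_space {..<dim_n H}" "snd x \<in> vec_space {..<dim_n H}"
    and "\<And>j. fst x j * snd x j = 0"
  shows "x \<in> moment_zero H"
proof -
  have "(\<Sum>i<dim_n H. of_int (iota H i l) * (fst x i * snd x i)) = 0" for l
    using assms(3) by (intro sum.neutral ballI) (simp only: mult_zero_right)
  with assms(1,2) show ?thesis
    by (cases x) (simp add: moment_zero_def phase_space_def)
qed

section \<open>Integral relations and rational points\<close>

text \<open>Induction on the number of equations. The last one is eliminated by cross-multiplication
  with a pivot vector, which keeps all coefficients integral.\<close>

lemma integer_relation:
  fixes u :: "'i \<Rightarrow> nat \<Rightarrow> int"
  assumes "finite I" "card I > d"
  shows "\<exists>c. (\<exists>i\<in>I. c i \<noteq> 0) \<and> (\<forall>l<d. (\<Sum>i\<in>I. c i * u i l) = 0)"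
  using assms
proof (induction d arbitrary: I u)
  case 0
  then have "I \<noteq> {}" by auto
  then show ?case by (intro exI[of _ "\<lambda>_. 1"]) auto
next
  case (Suc d)
  show ?case
  proof (cases "\<forall>i\<in>I. u i d = 0")
    case True
    obtain c where "\<exists>i\<in>I. c i \<noteq> 0" "\<forall>l<d. (\<Sum>i\<in>I. c i * u i l) = 0"
      using Suc.IH[of I u] Suc.prems by auto
    then show ?thesis using True by (intro exI[of _ c]) (auto simp: less_Suc_eq)
  next
    case False
    then obtain i0 where i0: "i0 \<in> I" "u i0 d \<noteq> 0" by blast
    define I' where "I' = I - {i0}"
    have I': "finite I'" "card I' > d" "i0 \<notin> I'" "I = insert i0 I'"
      using Suc.prems i0 by (auto simp: I'_def)
    obtain c where c: "\<exists>i\<in>I'. c i \<noteq> 0"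
      "\<forall>l<d. (\<Sum>i\<in>I'. c i * (u i0 d * u i l - u i d * u i0 l)) = 0"
      using Suc.IH[OF I'(1,2), of "\<lambda>i l. u i0 d * u i l - u i d * u i0 l"] by blast
    \<comment> \<open>Lifts the relation between the eliminated vectors; the coefficient of the
      pivot makes the last equation hold.\<close>
    define c' where "c' i = (if i = i0 then - (\<Sum>i\<in>I'. c i * u i d) else c i * u i0 d)" for i
    have "(\<Sum>i\<in>I. c' i * u i l) = 0" if "l < Suc d" for l
    proof -
      have "(\<Sum>i\<in>I. c' i * u i l) = c' i0 * u i0 l + (\<Sum>i\<in>I'. c' i * u i l)"
        using I' by simp
      also have "(\<Sum>i\<in>I'. c' i * u i l) = (\<Sum>i\<in>I'. c i * u i0 d * u i l)"
        using I'(3) by (intro sum.cong) (auto simp: c'_def)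
      also have "c' i0 * u i0 l = - (\<Sum>i\<in>I'. c i * u i d * u i0 l)"
        by (simp add: c'_def sum_distrib_right)
      also have "- (\<Sum>i\<in>I'. c i * u i d * u i0 l) + (\<Sum>i\<in>I'. c i * u i0 d * u i l)
          = (\<Sum>i\<in>I'. c i * (u i0 d * u i l - u i d * u i0 l))"
        by (simp add: right_diff_distrib sum_subtractf mult.assoc)
      also have "\<dots> = 0"
        using c(2) that by (cases "l = d") (auto simp: less_Suc_eq)
      finally show ?thesis .
    qed
    moreover have "\<exists>i\<in>I. c' i \<noteq> 0"
      using c(1) i0 I'(3,4) by (auto simp: c'_def)
    ultimately show ?thesis by blast
  qed
qed

text \<open>By elimination of one variable at a time.\<close>

lemma rational_solution_near:
  fixes A :: "'e \<Rightarrow> nat \<Rightarrow> real"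
  assumes "\<And>e l. e \<in> E \<Longrightarrow> A e l \<in> \<rat>" "\<And>e. e \<in> E \<Longrightarrow> b e \<in> \<rat>" "\<epsilon> > 0"
    and "\<And>e. e \<in> E \<Longrightarrow> (\<Sum>l<d. x l * A e l) = b e"
  shows "\<exists>y. (\<forall>l<d. y l \<in> \<rat> \<and> \<bar>y l - x l\<bar> < \<epsilon>) \<and> (\<forall>e\<in>E. (\<Sum>l<d. y l * A e l) = b e)"
  using assms
proof (induction d arbitrary: A b \<epsilon>)
  case 0
  then show ?case by auto
next
  case (Suc d)
  show ?case
  proof (cases "\<exists>e\<in>E. A e d \<noteq> 0")
    case False
    then have "\<And>e. e \<in> E \<Longrightarrow> (\<Sum>l<d. x l * A e l) = b e" using Suc.prems(4) by simp
    then have "\<exists>y. (\<forall>l<d. y l \<in> \<rat> \<and> \<bar>y l - x l\<bar> < \<epsilon>) \<and> (\<forall>e\<in>E. (\<Sum>l<d. y l * A e l) = b e)"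
      using Suc.prems(1-3) by (intro Suc.IH) auto
    then obtain y where y: "\<forall>l<d. y l \<in> \<rat> \<and> \<bar>y l - x l\<bar> < \<epsilon>" "\<forall>e\<in>E. (\<Sum>l<d. y l * A e l) = b e"
      by blast
    obtain r where r: "r \<in> \<rat>" "x d - \<epsilon> < r" "r < x d + \<epsilon>"
      using Rats_dense_in_real[of "x d - \<epsilon>" "x d + \<epsilon>"] Suc.prems(3) by auto
    have "(\<Sum>l<Suc d. (y(d := r)) l * A e l) = b e" if "e \<in> E" for e
      using y(2) that False by simp
    moreover have "(y(d := r)) l \<in> \<rat> \<and> \<bar>(y(d := r)) l - x l\<bar> < \<epsilon>" if "l < Suc d" for l
      using y(1) that r by (auto simp: less_Suc_eq abs_less_iff)
    ultimately show ?thesis by blast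
  next
    case True
    then obtain e0 where e0: "e0 \<in> E" "A e0 d \<noteq> 0" by blast
    define r where "r e = A e d / A e0 d" for e
    have r: "r e \<in> \<rat>" "r e * A e0 d = A e d" if "e \<in> E" for e
      unfolding r_def using Suc.prems(1) e0 that by auto
    \<comment> \<open>The eliminated coordinate inherits an error of at most
      \<open>\<epsilon> / K * (K - 1)\<close>, so the tolerance \<epsilon> / \<open>K\<close> for
      the others leaves room for it.\<close>
    define K where "K = 1 + (\<Sum>l<d. \<bar>A e0 l\<bar>) / \<bar>A e0 d\<bar>"
    have K: "K \<ge> 1" by (simp add: K_def sum_nonneg)
    have "\<exists>y. (\<forall>l<d. y l \<in> \<rat> \<and> \<bar>y l - x l\<bar> < \<epsilon> / K)
        \<and> (\<forall>e\<in>E. (\<Sum>l<d. y l * (A e l - r e * A e0 l)) = b e - r e * b e0)"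
    proof (rule Suc.IH)
      fix e assume e: "e \<in> E"
      show "A e l - r e * A e0 l \<in> \<rat>" for l using Suc.prems(1) e e0 r by auto
      show "b e - r e * b e0 \<in> \<rat>" using Suc.prems(2) e e0 r by auto
      have 1: "(\<Sum>l<d. x l * A e l) + x d * A e d = b e"
        "(\<Sum>l<d. x l * A e0 l) + x d * A e0 d = b e0"
        using Suc.prems(4) e e0 by auto
      have 2: "(\<Sum>l<d. x l * (A e l - r e * A e0 l))
          = (\<Sum>l<d. x l * A e l) - r e * (\<Sum>l<d. x l * A e0 l)"
        by (simp add: right_diff_distrib sum_subtractf sum_distrib_left mult.left_commute)
      have 3: "P - c * Q = u - c * v" if "P + z * a = u" "Q + z * a' = v" "c * a' = a"
        for P Q z a a' u v c :: real
        using that by (auto simp: algebra_simps)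
      show "(\<Sum>l<d. x l * (A e l - r e * A e0 l)) = b e - r e * b e0"
        unfolding 2 by (rule 3[OF 1 r(2)[OF e]])
    qed (use Suc.prems(3) K in auto)
    then obtain y where y: "\<And>l. l < d \<Longrightarrow> y l \<in> \<rat>" "\<And>l. l < d \<Longrightarrow> \<bar>y l - x l\<bar> < \<epsilon> / K"
      "\<And>e. e \<in> E \<Longrightarrow> (\<Sum>l<d. y l * (A e l - r e * A e0 l)) = b e - r e * b e0"
      by blast
    define s where "s = (b e0 - (\<Sum>l<d. y l * A e0 l)) / A e0 d"
    have s: "s * A e0 d = b e0 - (\<Sum>l<d. y l * A e0 l)" using e0 by (simp add: s_def)
    have "(\<Sum>l<Suc d. (y(d := s)) l * A e l) = b e" if "e \<in> E" for e
    proof -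
      have "(\<Sum>l<d. y l * (A e l - r e * A e0 l))
          = (\<Sum>l<d. y l * A e l) - r e * (\<Sum>l<d. y l * A e0 l)"
        by (simp add: right_diff_distrib sum_subtractf sum_distrib_left mult.left_commute)
      moreover have "s * A e d = r e * (b e0 - (\<Sum>l<d. y l * A e0 l))"
        using r(2)[OF that] s by (metis mult.left_commute)
      ultimately show ?thesis using y(3)[OF that] by (simp add: right_diff_distrib[of "r e"])
    qed
    moreover have "(y(d := s)) l \<in> \<rat> \<and> \<bar>(y(d := s)) l - x l\<bar> < \<epsilon>" if "l < Suc d" for l
    proof (cases "l = d")
      case False
      then have "l < d" using that by simp
      moreover have "\<epsilon> / K \<le> \<epsilon>" using K Suc.prems(3) by (simp add: field_simps)
      ultimately show ?thesis using y(1,2)[of l] by simp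
    next
      case True
      have sQ: "s \<in> \<rat>"
        unfolding s_def using e0 Suc.prems(1,2) y(1) by (intro Rats_divide Rats_diff Rats_sum Rats_mult) auto
      have "(s - x d) * A e0 d = (\<Sum>l<d. (x l - y l) * A e0 l)"
        using s Suc.prems(4)[OF e0(1)] by (simp add: left_diff_distrib sum_subtractf)
      then have "\<bar>s - x d\<bar> * \<bar>A e0 d\<bar> = \<bar>\<Sum>l<d. (x l - y l) * A e0 l\<bar>"
        by (metis abs_mult)
      also have "\<dots> \<le> (\<Sum>l<d. \<epsilon> / K * \<bar>A e0 l\<bar>)"
      proof (rule order_trans[OF sum_abs sum_mono])
        fix l assume "l \<in> {..<d}"
        then have "\<bar>x l - y l\<bar> \<le> \<epsilon> / K" using y(2)[of l] by (simp add: abs_minus_commute)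
        then show "\<bar>(x l - y l) * A e0 l\<bar> \<le> \<epsilon> / K * \<bar>A e0 l\<bar>"
          unfolding abs_mult by (rule mult_right_mono) simp
      qed
      also have "\<dots> = \<epsilon> / K * ((K - 1) * \<bar>A e0 d\<bar>)"
        using e0 by (simp add: K_def sum_distrib_left)
      finally have "\<bar>s - x d\<bar> * \<bar>A e0 d\<bar> \<le> (\<epsilon> / K * (K - 1)) * \<bar>A e0 d\<bar>"
        by (simp only: mult.assoc)
      then have "\<bar>s - x d\<bar> \<le> \<epsilon> / K * (K - 1)"
        by (rule mult_right_le_imp_le) (use e0 in simp)
      also have "\<dots> < \<epsilon>" using K Suc.prems(3) by (simp add: field_simps)
      finally show ?thesis using True sQ by simp
    qed
    ultimately show ?thesis by blast
  qed
qed

lemma common_denominator: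
  assumes "\<And>l. l < d \<Longrightarrow> y l \<in> (\<rat> :: real set)"
  shows "\<exists>N>0::nat. \<exists>X::nat \<Rightarrow> int. \<forall>l<d. real N * y l = of_int (X l)"
  using assms
proof (induction d)
  case 0
  then show ?case by (intro exI[of _ 1]) auto
next
  case (Suc d)
  have "\<exists>N>0::nat. \<exists>X::nat \<Rightarrow> int. \<forall>l<d. real N * y l = of_int (X l)"
    using Suc.prems by (intro Suc.IH) auto
  then obtain N X where N: "N > 0" "\<forall>l<d. real N * y l = of_int (X l)" by blast
  obtain a :: int and b :: int where ab: "b > 0" "y d = of_int a / of_int b"
    using Suc.prems[of d] Rats_cases' by blast
  define N' where "N' = N * nat b"
  have "real N' * y l = of_int (if l = d then int N * a else b * X l)" if "l < Suc d" for l
  proof (cases "l = d")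
    case True
    then show ?thesis using ab by (simp add: N'_def)
  next
    case False
    then have "real N * y l = of_int (X l)" using N that by simp
    then show ?thesis using False ab by (simp add: N'_def mult_ac)
  qed
  moreover have "N' > 0" using N ab by (simp add: N'_def)
  ultimately show ?case
    by (intro exI[of _ N'] conjI exI[of _ "\<lambda>l. if l = d then int N * a else b * X l"]) auto
qed

section \<open>Combinatorics of smooth hypertoric varieties\<close>

definition hval :: "hypertoric \<Rightarrow> (nat \<Rightarrow> real) \<Rightarrow> nat \<Rightarrow> real" where
  "hval H x j = (\<Sum>l<dim_d H. x l * of_int (beta H l j)) + of_int (theta_lift H j)"

lemma exact_beta_iota:
  assumes "exact_data H" "l < dim_k H" "m < dim_d H"
  shows "(\<Sum>j<dim_n H. beta H m j * iota H j l) = 0"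
proof -
  define s where "s = (\<lambda>l'. if l' = l then 1 else 0 :: int)"
  have s: "s \<in> vec_space {..<dim_k H}" using assms(2) by (simp add: s_def vec_space_def)
  have "beta_map H (iota_map H s) = (\<lambda>_. 0)"
    using assms(1) s unfolding exact_data_def by blast
  moreover have "iota_map H s j = iota H j l" if "j < dim_n H" for j
    using that assms(2) by (simp add: iota_map_def s_def if_distrib[of "\<lambda>x. _ * x"] cong: if_cong)
  ultimately have "(\<Sum>j<dim_n H. beta H m j * iota H j l) = (\<lambda>_. 0) m"
    using assms(3) by (auto simp: beta_map_def dest!: fun_cong[of _ _ m])
  then show ?thesis by simp
qed

lemma exact_kernel:
  assumes "exact_data H" "v \<in> vec_space {..<dim_n H}"
    and "\<And>l. l < dim_d H \<Longrightarrow> (\<Sum>j<dim_n H. beta H l j * v j) = 0"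
  obtains s where "s \<in> vec_space {..<dim_k H}"
    "\<And>j. j < dim_n H \<Longrightarrow> v j = (\<Sum>l<dim_k H. iota H j l * s l)"
proof -
  have "beta_map H v = (\<lambda>_. 0)" using assms(3) by (auto simp: beta_map_def)
  then have "v \<in> iota_map H ` vec_space {..<dim_k H}"
    using assms(1,2) unfolding exact_data_def by simp
  then obtain s where s: "s \<in> vec_space {..<dim_k H}" "iota_map H s = v" by blast
  have "v j = (\<Sum>l<dim_k H. iota H j l * s l)" if "j < dim_n H" for j
    using s(2) that by (auto simp: iota_map_def)
  with s(1) show ?thesis by (rule that)
qed

text \<open>\<open>m\<close> is a multiple of the values at a rational point close to \<open>x\<close> in the same open face.\<close>

lemma integral_signs:
  assumes "exact_data H"
  obtains N m where "N > (0::nat)"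
    "\<And>l. l < dim_k H \<Longrightarrow> (\<Sum>j<dim_n H. iota H j l * m j) = int N * theta_char H l"
    "\<And>j. j < dim_n H \<Longrightarrow> sgn (of_int (m j)) = sgn (hval H x j)"
proof -
  define n where "n = dim_n H"
  define d where "d = dim_d H"
  \<comment> \<open>The element 1 covers the case that all values vanish. With \<open>M\<close>
    above every column sum of \<open>beta\<close>, moving each coordinate by less than \<epsilon>
    cannot bring a nonzero value to zero.\<close>
  define V where "V = insert 1 {\<bar>hval H x j\<bar> |j. j < n \<and> hval H x j \<noteq> 0}"
  define M where "M = 1 + (\<Sum>j<n. \<Sum>l<d. \<bar>of_int (beta H l j)\<bar> :: real)"
  define \<epsilon> where "\<epsilon> = Min V / M"
  have V: "finite V" "V \<noteq> {}" "\<And>v. v \<in> V \<Longrightarrow> v > 0" by (auto simp: V_def)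
  have M: "M \<ge> 1" by (simp add: M_def sum_nonneg)
  have "Min V > 0" using V by simp
  then have \<epsilon>: "\<epsilon> > 0" using M by (simp add: \<epsilon>_def)
  define E where "E = {j. j < n \<and> hval H x j = 0}"
  have "\<exists>y. (\<forall>l<d. y l \<in> \<rat> \<and> \<bar>y l - x l\<bar> < \<epsilon>) \<and>
      (\<forall>j\<in>E. (\<Sum>l<d. y l * of_int (beta H l j)) = - of_int (theta_lift H j))"
    by (rule rational_solution_near) (use \<epsilon> in \<open>auto simp: E_def hval_def d_def\<close>)
  then obtain y where y: "\<And>l. l < d \<Longrightarrow> y l \<in> \<rat>" "\<And>l. l < d \<Longrightarrow> \<bar>y l - x l\<bar> < \<epsilon>"
    "\<And>j. j \<in> E \<Longrightarrow> (\<Sum>l<d. y l * of_int (beta H l j)) = - of_int (theta_lift H j)"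
    by blast
  have sgn: "sgn (hval H y j) = sgn (hval H x j)" if "j < n" for j
  proof (cases "hval H x j = 0")
    case True
    then show ?thesis using y(3)[of j] that by (simp add: E_def hval_def d_def)
  next
    case False
    have "hval H y j - hval H x j = (\<Sum>l<d. (y l - x l) * of_int (beta H l j))"
      by (simp add: hval_def d_def left_diff_distrib sum_subtractf)
    then have "\<bar>hval H y j - hval H x j\<bar> \<le> (\<Sum>l<d. \<bar>(y l - x l) * of_int (beta H l j)\<bar>)"
      by (metis sum_abs)
    also have "\<dots> \<le> (\<Sum>l<d. \<epsilon> * \<bar>of_int (beta H l j)\<bar>)"
      unfolding abs_mult by (intro sum_mono mult_right_mono less_imp_le[OF y(2)]) auto
    also have "\<dots> = \<epsilon> * (\<Sum>l<d. \<bar>of_int (beta H l j)\<bar>)" by (simp add: sum_distrib_left)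
    also have "\<dots> \<le> \<epsilon> * (M - 1)"
      using \<epsilon> that unfolding M_def
      by (intro mult_left_mono) (auto intro!: member_le_sum[of j "{..<n}" "\<lambda>j. \<Sum>l<d. \<bar>of_int (beta H l j)\<bar>"] sum_nonneg)
    also have "\<dots> < \<epsilon> * M" using \<epsilon> by simp
    also have "\<dots> = Min V" using M by (simp add: \<epsilon>_def)
    also have "\<dots> \<le> \<bar>hval H x j\<bar>"
      using V(1) that False by (intro Min_le) (auto simp: V_def)
    finally show ?thesis by (auto simp: sgn_if split: if_splits)
  qed
  obtain N X where N: "N > 0" "\<And>l. l < d \<Longrightarrow> real N * y l = of_int (X l)"
    using common_denominator[of d y] y(1) by blast
  define m where "m j = (\<Sum>l<d. X l * beta H l j) + int N * theta_lift H j" for j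
  have m: "of_int (m j) = real N * hval H y j" for j
    using N(2) by (simp add: m_def hval_def d_def distrib_left sum_distrib_left mult.assoc[symmetric])
  have "sgn (of_int (m j)) = sgn (hval H x j)" if "j < dim_n H" for j
    unfolding m using sgn[of j] that N(1) by (simp add: sgn_mult n_def)
  moreover have "(\<Sum>j<dim_n H. iota H j l * m j) = int N * theta_char H l" if "l < dim_k H" for l
  proof -
    have "(\<Sum>j<dim_n H. iota H j l * (\<Sum>l'<d. X l' * beta H l' j))
        = (\<Sum>j<dim_n H. \<Sum>l'<d. X l' * (beta H l' j * iota H j l))"
      by (simp add: sum_distrib_left mult_ac)
    also have "\<dots> = (\<Sum>l'<d. X l' * (\<Sum>j<dim_n H. beta H l' j * iota H j l))"
      by (subst sum.swap) (simp add: sum_distrib_left)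
    also have "\<dots> = 0" using exact_beta_iota[OF assms that] by (simp add: d_def)
    finally show ?thesis
      by (simp add: m_def theta_char_def distrib_left sum.distrib sum_distrib_left mult.left_commute)
  qed
  ultimately show ?thesis using N(1) that by blast
qed

text \<open>A stable point lies over the face containing \<open>x\<close>, with \<open>z_j\<close>
  or \<open>w_j\<close> nonzero exactly off the hyperplanes through \<open>x\<close>. An element
  with trivial characters at those indices stabilises it, hence is 1 by freeness.\<close>

lemma smooth_free:
  assumes "smooth_hypertoric H" "g \<in> K_torus H" "l < dim_k H"
    and "\<And>j. j < dim_n H \<Longrightarrow> hval H x j \<noteq> 0 \<Longrightarrow> K_incl H g j = 1"
  shows "g l = 1"
proof -
  have ex: "exact_data H" using assms(1) by (simp add: smooth_hypertoric_def)
  obtain N m where N: "N > (0::nat)"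
    and Nm: "\<And>l. l < dim_k H \<Longrightarrow> (\<Sum>j<dim_n H. iota H j l * m j) = int N * theta_char H l"
    and sgn: "\<And>j. j < dim_n H \<Longrightarrow> sgn (of_int (m j)) = sgn (hval H x j)"
    using integral_signs[OF ex, of x] by blast
  define z :: "nat \<Rightarrow> complex" where "z j = (if j < dim_n H \<and> m j > 0 then 1 else 0)" for j
  define w :: "nat \<Rightarrow> complex" where "w j = (if j < dim_n H \<and> m j < 0 then 1 else 0)" for j
  have "(z, w) \<in> moment_zero H"
    by (intro moment_zeroI) (auto simp: z_def w_def vec_space_def)
  then have "(z, w) \<in> semistable H"
    by (rule semistable_monomial[OF _ N Nm]) (auto simp: z_def w_def)
  then have "(z, w) \<in> stable H"
    using assms(1) by (simp add: smooth_hypertoric_def generic_theta_def)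
  moreover have "K_act H g (z, w) = (z, w)"
  proof -
    have "K_incl H g j = 1" if "j < dim_n H" "m j \<noteq> 0" for j
      using assms(4)[OF that(1)] sgn[OF that(1)] that(2) by (auto simp: sgn_if split: if_splits)
    then show ?thesis by (auto simp: K_act_eq z_def w_def)
  qed
  ultimately show ?thesis using assms(1-3) by (auto simp: smooth_hypertoric_def)
qed

lemma two_powi_eq_1:
  assumes "(2 :: complex) powi m = 1"
  shows "m = 0"
proof -
  have "(2 :: real) powi m = 1"
    using arg_cong[OF assms, of norm] by (simp add: norm_power_int)
  then show ?thesis
    using power_int_strict_increasing[of 0 m "2::real"] power_int_strict_increasing[of m 0 "2::real"]
    by (cases m "0::int" rule: linorder_cases) auto
qed

text \<open>A relation between the normals of the hyperplanes through \<open>x\<close> comes from a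
  cocharacter of \<open>K\<close> that fixes the point over the face. Evaluated at 2, which is no
  root of unity, it can be trivial only if all exponents vanish.\<close>

lemma smooth_independent:
  assumes "smooth_hypertoric H"
    and v: "\<And>j. j < dim_n H \<Longrightarrow> hval H x j \<noteq> 0 \<Longrightarrow> v j = 0"
    and "\<And>l. l < dim_d H \<Longrightarrow> (\<Sum>j<dim_n H. beta H l j * v j) = 0"
    and "j < dim_n H"
  shows "v j = 0"
proof -
  have ex: "exact_data H" using assms(1) by (simp add: smooth_hypertoric_def)
  define v' where "v' j = (if j < dim_n H then v j else 0)" for j
  have "v' \<in> vec_space {..<dim_n H}" by (simp add: vec_space_def v'_def)
  moreover have "(\<Sum>j<dim_n H. beta H l j * v' j) = 0" if "l < dim_d H" for l
    using assms(3)[OF that] by (simp add: v'_def)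
  ultimately obtain s where "s \<in> vec_space {..<dim_k H}"
    and s: "\<And>j. j < dim_n H \<Longrightarrow> v' j = (\<Sum>l<dim_k H. iota H j l * s l)"
    using exact_kernel[OF ex, of v'] by blast
  define g :: "nat \<Rightarrow> complex" where "g l = (if l < dim_k H then 2 powi s l else 0)" for l
  have g: "g \<in> K_torus H" by (auto simp: K_torus_def vec_space_def g_def)
  have "K_incl H g j = 2 powi v' j" if "j < dim_n H" for j
    by (simp add: K_incl_def g_def s[OF that] power_int_sum power_int_mult[symmetric] mult.commute)
  then have "K_incl H g j = 1" if "j < dim_n H" "hval H x j \<noteq> 0" for j
    using v that by (simp add: v'_def)
  then have "g l = 1" if "l < dim_k H" for l
    using smooth_free[OF assms(1) g that] by blast
  then have "s l = 0" if "l < dim_k H" for l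
    using that by (intro two_powi_eq_1) (simp add: g_def)
  then show ?thesis using s[OF assms(4)] assms(4) by (simp add: v'_def)
qed

lemma sum_supported:
  fixes f c :: "nat \<Rightarrow> 'a::semiring_0"
  assumes "p \<subseteq> {..<n}"
  shows "(\<Sum>j<n. f j * (if j \<in> p then c j else 0)) = (\<Sum>j\<in>p. f j * c j)"
  using assms by (intro sum.mono_neutral_cong_right) auto

text \<open>Counting gives a relation with some multiple \<open>N\<close> of \<open>v\<close>. If
  \<open>N\<close> could not be divided out, a root of unity would provide a nontrivial torsion
  element in a stabiliser.\<close>

lemma smooth_span:
  assumes sm: "smooth_hypertoric H" and p: "p \<subseteq> {..<dim_n H}" "card p = dim_d H"
    and x: "\<And>i. i \<in> p \<Longrightarrow> hval H x i = 0"
  shows "\<exists>c. \<forall>l<dim_d H. v l = (\<Sum>i\<in>p. c i * beta H l i)"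
proof -
  have ex: "exact_data H" using sm by (simp add: smooth_hypertoric_def)
  have fin: "finite p" using p(1) finite_subset by blast
  \<comment> \<open>An index outside \<open>p\<close>, standing for the extra vector
    \<open>v\<close>.\<close>
  define n where "n = dim_n H"
  have n: "n \<notin> p" using p(1) by (auto simp: n_def)
  define u where "u i l = (if i = n then v l else beta H l i)" for i l
  obtain c where c: "\<exists>i\<in>insert n p. c i \<noteq> 0"
    "\<And>l. l < dim_d H \<Longrightarrow> (\<Sum>i\<in>insert n p. c i * u i l) = 0"
    using integer_relation[of "insert n p" "dim_d H" u] fin n p(2) by auto
  define N where "N = c n"
  have rel: "N * v l + (\<Sum>i\<in>p. c i * beta H l i) = 0" if "l < dim_d H" for l
  proof -
    have "(\<Sum>i\<in>p. c i * u i l) = (\<Sum>i\<in>p. c i * beta H l i)"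
      using n by (intro sum.cong) (auto simp: u_def)
    then show ?thesis using c(2)[OF that] fin n by (simp add: u_def N_def)
  qed
  have N: "N \<noteq> 0"
  proof
    assume "N = 0"
    have "(if j \<in> p then c j else 0) = 0" if "j < dim_n H" for j
    proof (rule smooth_independent[OF sm _ _ that, where x = x])
      show "(\<Sum>j<dim_n H. beta H l j * (if j \<in> p then c j else 0)) = 0" if "l < dim_d H" for l
        using rel[OF that] \<open>N = 0\<close> by (simp add: sum_supported[OF p(1)] mult.commute)
    qed (use x in auto)
    then have "c i = 0" if "i \<in> p" for i using that p(1) by (metis lessThan_iff subsetD)
    with c(1) \<open>N = 0\<close> show False by (auto simp: N_def)
  qed
  have "(\<lambda>l. if l < dim_d H then v l else 0) \<in> vec_space {..<dim_d H}"
    by (simp add: vec_space_def)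
  then have "(\<lambda>l. if l < dim_d H then v l else 0) \<in> beta_map H ` vec_space {..<dim_n H}"
    using ex unfolding exact_data_def by simp
  then obtain y where y: "y \<in> vec_space {..<dim_n H}"
    "beta_map H y = (\<lambda>l. if l < dim_d H then v l else 0)" by auto
  have y_eq: "(\<Sum>j<dim_n H. beta H l j * y j) = v l" if "l < dim_d H" for l
    using fun_cong[OF y(2), of l] that by (simp add: beta_map_def)
  \<comment> \<open>A kernel vector of beta, hence a cocharacter \<open>s\<close> of
    \<open>K\<close>, that is divisible by \<open>N\<close> off \<open>p\<close>. Therefore the
    \<open>N\<close>-th root of unity along \<open>s\<close> acts trivially on all coordinates that
    are nonzero over \<open>x\<close>.\<close>
  define t where "t j = N * y j + (if j \<in> p then c j else 0)" for j
  have "t \<in> vec_space {..<dim_n H}" using y(1) p(1) by (auto simp: vec_space_def t_def)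
  moreover have "(\<Sum>j<dim_n H. beta H l j * t j) = 0" if "l < dim_d H" for l
  proof -
    have "(\<Sum>j<dim_n H. beta H l j * t j)
        = N * (\<Sum>j<dim_n H. beta H l j * y j) + (\<Sum>j<dim_n H. beta H l j * (if j \<in> p then c j else 0))"
      unfolding t_def distrib_left sum.distrib by (simp add: sum_distrib_left mult.left_commute)
    then show ?thesis
      using rel[OF that] y_eq[OF that] by (simp add: sum_supported[OF p(1)] mult.commute)
  qed
  ultimately obtain s where "s \<in> vec_space {..<dim_k H}"
    and s: "\<And>j. j < dim_n H \<Longrightarrow> t j = (\<Sum>l<dim_k H. iota H j l * s l)"
    using exact_kernel[OF ex, of t] by blast
  define A where "A = 2 * pi * \<i> / of_int N"
  define g where "g l = (if l < dim_k H then exp (A * of_int (s l)) else 0)" for l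
  have g: "g \<in> K_torus H" by (auto simp: K_torus_def vec_space_def g_def)
  have K_incl_g: "K_incl H g j = exp (A * of_int (t j))" if "j < dim_n H" for j
    by (simp add: K_incl_def g_def s[OF that] exp_power_int sum_distrib_left mult_ac flip: exp_sum)
  have "K_incl H g j = 1" if "j < dim_n H" "hval H x j \<noteq> 0" for j
  proof -
    have "t j = N * y j" using that x by (auto simp: t_def)
    then have "A * of_int (t j) = of_int (2 * y j) * pi * \<i>" using N by (simp add: A_def)
    then show ?thesis unfolding K_incl_g[OF that(1)] exp_eq_1 by (auto intro!: exI[of _ "y j"])
  qed
  then have g1: "g l = 1" if "l < dim_k H" for l using smooth_free[OF sm g that] by blast
  \<comment> \<open>Triviality of this torsion element says that \<open>s\<close> is divisible by
    \<open>N\<close>, and so are the coefficients on \<open>p\<close>.\<close>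
  have "N dvd s l" if "l < dim_k H" for l
  proof -
    have "exp (A * of_int (s l)) = 1" using g1[OF that] that by (simp add: g_def)
    then obtain m :: int where "Im (A * of_int (s l)) = of_int (2 * m) * pi"
      unfolding exp_eq_1 by blast
    moreover have "A * of_int (s l) = of_real (2 * pi * of_int (s l) / of_int N) * \<i>"
      by (simp add: A_def)
    ultimately have "(2 * pi) * of_int (s l) / of_int N = (2 * pi) * (of_int m :: real)" by simp
    then have "(of_int (s l) :: real) = of_int (m * N)" using N by (simp add: divide_eq_eq)
    then have "s l = m * N" by linarith
    then show ?thesis by simp
  qed
  then obtain s' where s': "\<And>l. l < dim_k H \<Longrightarrow> s l = N * s' l"
    unfolding dvd_def by metis
  define c' where "c' i = (\<Sum>l<dim_k H. iota H i l * s' l) - y i" for i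
  have cN: "c i = N * c' i" if "i \<in> p" for i
  proof -
    have "t i = N * (\<Sum>l<dim_k H. iota H i l * s' l)"
      using s[of i] s' that p(1) by (auto simp: sum_distrib_left mult.left_commute)
    then show ?thesis using that by (simp add: t_def c'_def right_diff_distrib)
  qed
  have "v l = (\<Sum>i\<in>p. - c' i * beta H l i)" if "l < dim_d H" for l
  proof -
    have "N * (v l + (\<Sum>i\<in>p. c' i * beta H l i)) = N * v l + (\<Sum>i\<in>p. c i * beta H l i)"
      using cN by (simp add: distrib_left sum_distrib_left mult.assoc)
    then have "v l + (\<Sum>i\<in>p. c' i * beta H l i) = 0" using N rel[OF that] by simp
    then show ?thesis by (simp add: sum_negf eq_neg_iff_add_eq_0)
  qed
  then show ?thesis by (intro exI[of _ "\<lambda>i. - c' i"] allI impI)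
qed

text \<open>Independence and integral spanning make the normals of \<open>p\<close> a lattice basis;
  exactness supplies the inverse block of \<open>iota\<close>. One more hyperplane through
  \<open>x\<close> would create a relation between normals at \<open>x\<close>.\<close>

lemma smooth_is_basis:
  assumes sm: "smooth_hypertoric H" and p: "p \<subseteq> {..<dim_n H}" "card p = dim_d H"
    and x: "\<And>i. i \<in> p \<Longrightarrow> hval H x i = 0"
  shows "is_basis H p" and "\<forall>j\<in>compl H p. hval H x j \<noteq> 0"
proof -
  have ex: "exact_data H" using sm by (simp add: smooth_hypertoric_def)
  have fin: "finite p" using p(1) finite_subset by blast
  have indep: "c i = 0"
    if "\<And>l. l < dim_d H \<Longrightarrow> (\<Sum>i\<in>p. beta H l i * c i) = 0" "i \<in> p" for c i
  proof -
    have "(if i \<in> p then c i else 0) = 0"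
    proof (rule smooth_independent[OF sm, where x = x])
      show "(\<Sum>j<dim_n H. beta H l j * (if j \<in> p then c j else 0)) = 0" if "l < dim_d H" for l
        using \<open>\<And>l. l < dim_d H \<Longrightarrow> (\<Sum>i\<in>p. beta H l i * c i) = 0\<close>[OF that]
        by (simp add: sum_supported[OF p(1)])
    qed (use x that p in auto)
    then show ?thesis using that(2) by simp
  qed
  have "\<forall>l'. \<exists>c. \<forall>l<dim_d H. (if l = l' then 1 else 0) = (\<Sum>i\<in>p. c i * beta H l i)"
    by (rule allI, rule smooth_span[OF sm p x])
  from choice[OF this] obtain Rt where Rt: "\<And>l' l. l < dim_d H \<Longrightarrow>
      (if l = l' then 1 else 0) = (\<Sum>i\<in>p. Rt l' i * beta H l i)" by blast
  define R where "R i l = Rt l i" for i l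
  have R1: "(\<Sum>i\<in>p. beta H l i * R i l') = (if l = l' then 1 else 0)" if "l < dim_d H" for l l'
    using Rt[OF that, of l'] by (simp add: R_def mult.commute)
  have R2: "(\<Sum>l<dim_d H. R i l * beta H l i') = (if i = i' then 1 else 0)" if "i \<in> p" "i' \<in> p" for i i'
  proof -
    have "(\<Sum>i\<in>p. beta H l i * ((\<Sum>l<dim_d H. R i l * beta H l i') - (if i = i' then 1 else 0))) = 0"
      if l: "l < dim_d H" for l
    proof -
      have "(\<Sum>i\<in>p. beta H l i * (\<Sum>l'<dim_d H. R i l' * beta H l' i'))
          = (\<Sum>i\<in>p. \<Sum>l'<dim_d H. beta H l' i' * (beta H l i * R i l'))"
        by (simp add: sum_distrib_left mult_ac)
      also have "\<dots> = (\<Sum>l'<dim_d H. beta H l' i' * (\<Sum>i\<in>p. beta H l i * R i l'))"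
        by (subst sum.swap) (simp add: sum_distrib_left)
      also have "\<dots> = (\<Sum>l'<dim_d H. if l' = l then beta H l' i' else 0)"
        using R1[OF l] by (intro sum.cong) auto
      also have "\<dots> = beta H l i'" using l by simp
      moreover have "(\<Sum>i\<in>p. beta H l i * (if i = i' then 1 else 0)) = (\<Sum>i\<in>p. if i = i' then beta H l i else 0)"
        by (intro sum.cong) auto
      ultimately show ?thesis
        using fin \<open>i' \<in> p\<close> by (simp add: right_diff_distrib sum_subtractf)
    qed
    from indep[OF this that(1)] show ?thesis by simp
  qed
  have "\<forall>j. \<exists>c. \<forall>l<dim_d H. beta H l j = (\<Sum>i\<in>p. c i * beta H l i)"
    by (rule allI, rule smooth_span[OF sm p x])
  from choice[OF this] obtain Ct where
    Ct: "\<And>j l. l < dim_d H \<Longrightarrow> beta H l j = (\<Sum>i\<in>p. Ct j i * beta H l i)"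
    by blast
  define C where "C i j = - Ct j i" for i j
  have C: "beta H l j = - (\<Sum>i\<in>p. C i j * beta H l i)" if "l < dim_d H" for l j
    using Ct[OF that, of j] by (simp add: C_def sum_negf)
  \<comment> \<open>Expanding the columns off \<open>p\<close>, the image under beta depends only on
    the corrected entries on \<open>p\<close>; by independence a kernel vector is determined by its
    entries off \<open>p\<close>.\<close>
  have ker: "(\<Sum>i\<in>p. beta H l i * (v i - (\<Sum>j\<in>compl H p. C i j * v j))) = (\<Sum>j<dim_n H. beta H l j * v j)"
    if "l < dim_d H" for l and v :: "nat \<Rightarrow> int"
  proof -
    have "(\<Sum>j\<in>compl H p. beta H l j * v j) = (\<Sum>j\<in>compl H p. - (\<Sum>i\<in>p. C i j * beta H l i) * v j)"
      by (intro sum.cong refl arg_cong2[where f = "(*)"] C[OF that])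
    also have "\<dots> = - (\<Sum>j\<in>compl H p. \<Sum>i\<in>p. beta H l i * (C i j * v j))"
      by (simp add: sum_distrib_left sum_distrib_right sum_negf mult_ac)
    also have "\<dots> = - (\<Sum>i\<in>p. beta H l i * (\<Sum>j\<in>compl H p. C i j * v j))"
      by (subst sum.swap) (simp add: sum_distrib_left)
    finally show ?thesis
      unfolding sum_split_compl[OF p(1)] by (simp add: right_diff_distrib sum_subtractf)
  qed
  have iota_rel: "iota H i l = (\<Sum>j\<in>compl H p. C i j * iota H j l)" if "i \<in> p" "l < dim_k H" for i l
    using indep[of "\<lambda>i. iota H i l - (\<Sum>j\<in>compl H p. C i j * iota H j l)" i]
      ker[of _ "\<lambda>j. iota H j l"] exact_beta_iota[OF ex that(2)] that(1) by simp
  \<comment> \<open>The columns of \<open>S\<close> come from kernel vectors with a single entry 1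
    off \<open>p\<close>; exactness lifts them to the lattice of \<open>K\<close>.\<close>
  have "\<exists>s. \<forall>j'\<in>compl H p. (\<Sum>l<dim_k H. iota H j' l * s l) = (if j' = j then 1 else 0)"
    if j: "j \<in> compl H p" for j
  proof -
    define v where "v i = (if i \<in> p then C i j else if i = j then 1 else 0)" for i
    have jp: "j \<notin> p" "j < dim_n H" using j by (auto simp: compl_def)
    have v: "v \<in> vec_space {..<dim_n H}" using jp p(1) by (auto simp: vec_space_def v_def)
    have "(\<Sum>j'\<in>compl H p. C i j' * v j') = (\<Sum>j'\<in>compl H p. if j' = j then C i j' else 0)" for i
      using jp by (intro sum.cong) (auto simp: v_def compl_def)
    then have "v i - (\<Sum>j\<in>compl H p. C i j * v j) = 0" if "i \<in> p" for i
      using that j by (simp add: v_def)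
    then have "(\<Sum>j<dim_n H. beta H l j * v j) = 0" if "l < dim_d H" for l
      unfolding ker[OF that, symmetric] by simp
    then obtain s where s0: "s \<in> vec_space {..<dim_k H}"
      and s: "\<And>j. j < dim_n H \<Longrightarrow> v j = (\<Sum>l<dim_k H. iota H j l * s l)"
      using exact_kernel[OF ex v] by blast
    have "(\<Sum>l<dim_k H. iota H j' l * s l) = (if j' = j then 1 else 0)" if "j' \<in> compl H p" for j'
      using s[of j'] that by (simp add: compl_def v_def)
    then show ?thesis by blast
  qed
  then have "\<forall>j\<in>compl H p. \<exists>s. \<forall>j'\<in>compl H p.
      (\<Sum>l<dim_k H. iota H j' l * s l) = (if j' = j then 1 else 0)" by (rule ballI)
  from bchoice[OF this] obtain St where St: "\<And>j j'. j \<in> compl H p \<Longrightarrow> j' \<in> compl H p \<Longrightarrow>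
      (\<Sum>l<dim_k H. iota H j' l * St j l) = (if j' = j then 1 else 0)"
    by blast
  define S where "S l j = St j l" for l j
  have S1: "(\<Sum>l<dim_k H. iota H j l * S l j') = (if j = j' then 1 else 0)"
    if "j \<in> compl H p" "j' \<in> compl H p" for j j'
    using St[OF that(2,1)] by (simp add: S_def)
  \<comment> \<open>So far \<open>S\<close> is a one-sided inverse; injectivity of iota makes it
    two-sided.\<close>
  have S2: "(\<Sum>j\<in>compl H p. S l j * iota H j l') = (if l = l' then 1 else 0)"
    if l: "l < dim_k H" "l' < dim_k H" for l l'
  proof -
    define s where "s l = (if l < dim_k H then \<Sum>j\<in>compl H p. S l j * iota H j l' else 0)" for l
    define t where "t l = (if l = l' then 1 else 0 :: int)" for l
    have st: "s \<in> vec_space {..<dim_k H}" "t \<in> vec_space {..<dim_k H}"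
      using l by (auto simp: vec_space_def s_def t_def)
    have t: "(\<Sum>l<dim_k H. iota H j l * t l) = iota H j l'" for j
      using l by (simp add: t_def if_distrib[of "\<lambda>x. _ * x"] cong: if_cong)
    have s_compl: "(\<Sum>l<dim_k H. iota H j l * s l) = iota H j l'" if "j \<in> compl H p" for j
    proof -
      have "(\<Sum>l<dim_k H. iota H j l * s l)
          = (\<Sum>l<dim_k H. \<Sum>j'\<in>compl H p. iota H j' l' * (iota H j l * S l j'))"
        by (intro sum.cong refl) (simp add: s_def sum_distrib_left mult_ac)
      also have "\<dots> = (\<Sum>j'\<in>compl H p. iota H j' l' * (\<Sum>l<dim_k H. iota H j l * S l j'))"
        by (subst sum.swap) (simp add: sum_distrib_left)
      also have "\<dots> = (\<Sum>j'\<in>compl H p. if j' = j then iota H j' l' else 0)"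
        using S1[OF that] by (intro sum.cong) auto
      also have "\<dots> = iota H j l'" using that by simp
      finally show ?thesis .
    qed
    have s_p: "(\<Sum>l<dim_k H. iota H i l * s l) = iota H i l'" if "i \<in> p" for i
    proof -
      have "(\<Sum>l<dim_k H. iota H i l * s l)
          = (\<Sum>l<dim_k H. \<Sum>j\<in>compl H p. C i j * (iota H j l * s l))"
        using iota_rel[OF that] by (intro sum.cong refl) (simp add: sum_distrib_right mult.assoc)
      also have "\<dots> = (\<Sum>j\<in>compl H p. C i j * (\<Sum>l<dim_k H. iota H j l * s l))"
        by (subst sum.swap) (simp add: sum_distrib_left)
      also have "\<dots> = (\<Sum>j\<in>compl H p. C i j * iota H j l')"
        using s_compl by (intro sum.cong) auto
      finally show ?thesis using iota_rel[OF that l(2)] by simp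
    qed
    have "iota_map H s = iota_map H t"
      using s_compl s_p t by (auto simp: iota_map_def compl_def fun_eq_iff)
    then have "s = t" using ex st unfolding exact_data_def inj_on_def by blast
    then have "s l = t l" by simp
    then show ?thesis using l by (simp add: s_def t_def)
  qed
  have "basis_cert H p C S R"
    unfolding basis_cert_def
    by (intro conjI ballI allI impI p(1) iota_rel C S1 S2 R1 R2) auto
  then show "is_basis H p" unfolding is_basis_def by blast
  show "\<forall>j\<in>compl H p. hval H x j \<noteq> 0"
  proof (intro ballI notI)
    fix j assume j: "j \<in> compl H p" "hval H x j = 0"
    then have jp: "j \<notin> p" "j < dim_n H" by (auto simp: compl_def)
    define v where "v i = (if i \<in> p then C i j else if i = j then 1 else 0)" for i
    have "(\<Sum>j'\<in>compl H p. C i j' * v j') = (\<Sum>j'\<in>compl H p. if j' = j then C i j' else 0)" for i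
      using jp by (intro sum.cong) (auto simp: v_def compl_def)
    then have v_rel: "v i - (\<Sum>j\<in>compl H p. C i j * v j) = 0" if "i \<in> p" for i
      using that j by (simp add: v_def)
    have "v j = 0"
    proof (rule smooth_independent[OF sm, where x = x])
      show "(\<Sum>j<dim_n H. beta H l j * v j) = 0" if "l < dim_d H" for l
        unfolding ker[OF that, symmetric] using v_rel by simp
    qed (use jp j x in \<open>auto simp: v_def\<close>)
    then show False using jp by (simp add: v_def)
  qed
qed

lemma hval_vertex:
  assumes "is_basis H p" "j < dim_n H"
  shows "hval H (vertex H p) j = of_int (height H p j)"
  using vertex_eq(1)[OF assms(1)] assms(2) by (simp add: hval_def)

lemma smooth_fixed_point_basis:
  assumes "smooth_hypertoric H" "p \<in> fixed_points H"
  shows "is_basis H p"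
proof -
  obtain x where "\<forall>i\<in>p. x \<in> hyperplane H i" and p: "p \<subseteq> {..<dim_n H}" "card p = dim_d H"
    using assms(2) by (auto simp: fixed_points_def)
  then have "hval H x i = 0" if "i \<in> p" for i
    using that by (auto simp: hval_def hyperplane_def)
  then show ?thesis by (rule smooth_is_basis(1)[OF assms(1) p])
qed

lemma smooth_height_nonzero:
  assumes "smooth_hypertoric H" "is_basis H p" "j \<in> compl H p"
  shows "height H p j \<noteq> 0"
proof -
  have "hval H (vertex H p) i = 0" if "i \<in> p" for i
    using hval_vertex[OF assms(2), of i] that is_basis_subset[OF assms(2)] by (auto simp: height_def)
  then have "\<forall>j\<in>compl H p. hval H (vertex H p) j \<noteq> 0"
    by (rule smooth_is_basis(2)[OF assms(1) is_basis_subset[OF assms(2)] is_basis_card[OF assms(2)]])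
  then show ?thesis
    using hval_vertex[OF assms(2), of j] assms(3) by (auto simp: compl_def)
qed

text \<open>Moving from the vertex along edge \<open>i\<close>, in either direction, until
  hyperplane \<open>j\<close> is reached gives a common point of the hyperplanes of the new
  set.\<close>

lemma smooth_pivot:
  assumes "smooth_hypertoric H" "is_basis H p" "i \<in> p" "j \<in> compl H p" "circ H p i j \<noteq> 0"
  shows "is_basis H (insert j (p - {i}))"
proof -
  have j: "j \<notin> p" "j < dim_n H" using assms(4) by (auto simp: compl_def)
  have p: "p \<subseteq> {..<dim_n H}" "finite p"
    using is_basis_subset[OF assms(2)] is_basis_finite[OF assms(2)] by auto
  obtain x where x: "\<And>m. m < dim_n H \<Longrightarrow> edge H p i m = (\<Sum>l<dim_d H. x l * beta H l m)"
    using edge_in_row_space[OF assms(2,3)] by (auto simp: row_space_def)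
  \<comment> \<open>The value at \<open>j\<close> changes by minus the circuit entry per unit step,
    so it vanishes after this step.\<close>
  define s :: real where "s = of_int (height H p j) / of_int (circ H p i j)"
  define y where "y l = vertex H p l + s * of_int (x l)" for l
  have y: "hval H y m = of_int (height H p m) + s * of_int (edge H p i m)" if "m < dim_n H" for m
  proof -
    have "hval H y m = hval H (vertex H p) m + s * of_int (\<Sum>l<dim_d H. x l * beta H l m)"
      by (simp add: hval_def y_def distrib_right sum.distrib sum_distrib_left mult.assoc)
    then show ?thesis using hval_vertex[OF assms(2) that] x[OF that] by simp
  qed
  show ?thesis
  proof (rule smooth_is_basis(1)[OF assms(1), where x = y])
    show "insert j (p - {i}) \<subseteq> {..<dim_n H}" using p j by auto
    have "card p > 0" using p(2) assms(3) card_gt_0_iff by blast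
    then show "card (insert j (p - {i})) = dim_d H"
      using p(2) j assms(3) is_basis_card[OF assms(2)] by (simp add: card_insert_if)
    fix m assume m: "m \<in> insert j (p - {i})"
    then show "hval H y m = 0"
      using y[of m] j p(1) assms(5) by (auto simp: height_def edge_def s_def)
  qed
qed

text \<open>The monomial with exponents \<open>height H p\<close> thus has weight \<theta>; it
  certifies semistability of points over the vertex.\<close>

lemma height_theta_char:
  assumes "is_basis H p" "l < dim_k H"
  shows "(\<Sum>j<dim_n H. iota H j l * height H p j) = theta_char H l"
  using row_space_iota[OF assms(1) height_minus_theta_in_row_space[OF assms(1)] assms(2)]
  by (simp add: theta_char_def right_diff_distrib sum_subtractf)

text \<open>If the slope vanished, the fixed point enlarged by the coordinate \<open>z_i\<close>
  would be fixed by \<sigma> up to \<open>K\<close>, without being fixed by the whole torus.\<close>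

lemma generic_slope_nonzero:
  assumes sm: "smooth_hypertoric H" and gs: "generic_sigma H" and p: "is_basis H p" and i: "i \<in> p"
  shows "slope H p i \<noteq> 0"
proof
  assume slope: "slope H p i = 0"
  have i_n: "i < dim_n H" using is_basis_subset[OF p] i by auto
  define z :: "nat \<Rightarrow> complex" where
    "z j = (if j < dim_n H \<and> (height H p j > 0 \<or> j = i) then 1 else 0)" for j
  define w :: "nat \<Rightarrow> complex" where "w j = (if j < dim_n H \<and> height H p j < 0 then 1 else 0)" for j
  have hp: "height H p j = 0" if "j \<in> p" for j using that by (simp add: height_def)
  have "(z, w) \<in> moment_zero H"
    using hp[OF i] by (intro moment_zeroI) (auto simp: z_def w_def vec_space_def)
  then have "(z, w) \<in> semistable H"
    by (rule semistable_monomial[where N = 1 and m = "height H p"])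
      (use height_theta_char[OF p] in \<open>auto simp: z_def w_def\<close>)
  then have "(z, w) \<in> stable H"
    using sm by (simp add: smooth_hypertoric_def generic_theta_def)
  then have pt: "K_orbit H (z, w) \<in> points H" by (simp add: points_def)
  have "torus_act (cochar H t) 1 ` K_orbit H (z, w) = K_orbit H (z, w)" if t: "t \<noteq> 0" for t
  proof -
    obtain g where g: "g \<in> K_torus H" "\<And>j. j \<in> compl H p \<Longrightarrow> K_incl H g j = cochar H t j"
      by (rule K_torus_extend[OF p, of "cochar H t"]) (use t in \<open>auto simp: cochar_def\<close>)
    have "K_incl H g i = (\<Prod>j\<in>compl H p. t powi (circ H p i j * sigma_lift H j))"
      unfolding K_torus_basis[OF p g(1) i] using g(2)
      by (intro prod.cong) (auto simp: cochar_def power_int_mult[symmetric] mult.commute)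
    also have "\<dots> = t powi sigma_lift H i"
      using slope t by (simp add: power_int_sum[symmetric] slope_def)
    finally have gi: "K_incl H g i = cochar H t i" by (simp add: cochar_def)
    have "torus_act (cochar H t) 1 (z, w) = K_act H g (z, w)"
      using g(2) gi hp by (fastforce simp: torus_act_def K_act_eq z_def w_def compl_def fun_eq_iff)
    then have "torus_act (cochar H t) 1 (z, w) \<in> K_orbit H (z, w)"
      using g(1) by (auto simp: K_orbit_def)
    then show ?thesis
      using torus_act_K_orbit[of "cochar H t" 1] t K_orbit_eqI by (simp add: cochar_def)
  qed
  with pt have "K_orbit H (z, w) \<in> {x \<in> points H. \<forall>t. t \<noteq> 0 \<longrightarrow> torus_act (cochar H t) 1 ` x = x}"
    by blast
  then have "\<forall>a h. (\<forall>i<dim_n H. a i \<noteq> 0) \<and> h \<noteq> 0 \<longrightarrow> torus_act a h ` K_orbit H (z, w) = K_orbit H (z, w)"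
    using gs unfolding generic_sigma_def by blast
  \<comment> \<open>Test element: scaling by 2 in coordinate \<open>i\<close> alone. A compensating
    element of \<open>K\<close> has trivial characters off \<open>p\<close>, hence is
    trivial.\<close>
  then have "torus_act (\<lambda>j. if j = i then 2 else 1) 1 ` K_orbit H (z, w) = K_orbit H (z, w)"
    by simp
  then have "torus_act (\<lambda>j. if j = i then 2 else 1) 1 (z, w) \<in> K_orbit H (z, w)"
    using K_orbit_self by blast
  then obtain g where g: "g \<in> K_torus H"
    "torus_act (\<lambda>j. if j = i then 2 else 1) 1 (z, w) = K_act H g (z, w)"
    by (auto simp: K_orbit_def)
  have zj: "(if j = i then 2 else 1) * z j = K_incl H g j * z j"
    and wj: "inverse (if j = i then 2 else 1) * w j = inverse (K_incl H g j) * w j" for j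
    using g(2) by (auto simp: torus_act_def K_act_eq fun_eq_iff)
  have "K_incl H g j = 1" if "j \<in> compl H p" for j
  proof -
    have j: "j < dim_n H" "j \<noteq> i" using that i by (auto simp: compl_def)
    have "height H p j \<noteq> 0" by (rule smooth_height_nonzero[OF sm p that])
    then show ?thesis
      using zj[of j] wj[of j] j by (cases "height H p j > 0") (auto simp: z_def w_def)
  qed
  then have "g l = 1" if "l < dim_k H" for l using K_faithful[OF p g(1) _ that] by blast
  then have "K_incl H g i = 1" by (simp add: K_incl_def)
  then show False using zj[of i] i_n by (simp add: z_def)
qed

theorem smooth_generic_data:
  assumes "smooth_hypertoric H" "generic_sigma H"
  shows "generic_data H"
  unfolding generic_data_def
  using smooth_height_nonzero[OF assms(1)] generic_slope_nonzero[OF assms] smooth_pivot[OF assms(1)]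
  by blast

section \<open>Stability and attracting sets\<close>

lemma poly_fun_bounded:
  assumes "poly_fun n f"
  shows "\<exists>M. \<forall>x. (\<forall>i<n. norm (fst x i) \<le> B \<and> norm (snd x i) \<le> B) \<longrightarrow> norm (f x) \<le> M"
  using assms
proof (induction rule: poly_fun.induct)
  case (4 f g)
  then obtain M M' where
    "\<forall>x. (\<forall>i<n. norm (fst x i) \<le> B \<and> norm (snd x i) \<le> B) \<longrightarrow> norm (f x) \<le> M"
    "\<forall>x. (\<forall>i<n. norm (fst x i) \<le> B \<and> norm (snd x i) \<le> B) \<longrightarrow> norm (g x) \<le> M'" by blast
  then show ?case
    by (intro exI[of _ "M + M'"]) (metis norm_triangle_le add_mono)
next
  case (5 f g)
  then obtain M M' where M:
    "\<forall>x. (\<forall>i<n. norm (fst x i) \<le> B \<and> norm (snd x i) \<le> B) \<longrightarrow> norm (f x) \<le> M"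
    "\<forall>x. (\<forall>i<n. norm (fst x i) \<le> B \<and> norm (snd x i) \<le> B) \<longrightarrow> norm (g x) \<le> M'" by blast
  show ?case
  proof (intro exI[of _ "M * M'"] allI impI)
    fix x :: phase assume "\<forall>i<n. norm (fst x i) \<le> B \<and> norm (snd x i) \<le> B"
    then have "norm (f x) \<le> M" "norm (g x) \<le> M'" using M by blast+
    then show "norm (f x * g x) \<le> M * M'"
      unfolding norm_mult by (intro mult_mono) (auto intro: order_trans[OF norm_ge_zero])
  qed
qed auto

text \<open>
  The easy half of the Hilbert-Mumford criterion: along a one-parameter subgroup of \<open>K\<close> that keeps
  \<open>y\<close> bounded, a semi-invariant polynomial with \<open>f y \<noteq> 0\<close> would blow up.
\<close>

lemma not_semistable_one_parameter:
  assumes fst: "\<And>i. i < dim_n H \<Longrightarrow> fst y i \<noteq> 0 \<Longrightarrow> (\<Sum>l<dim_k H. iota H i l * s l) \<ge> 0"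
    and snd: "\<And>i. i < dim_n H \<Longrightarrow> snd y i \<noteq> 0 \<Longrightarrow> (\<Sum>l<dim_k H. iota H i l * s l) \<le> 0"
    and neg: "(\<Sum>l<dim_k H. theta_char H l * s l) < 0"
  shows "y \<notin> semistable H"
proof
  assume "y \<in> semistable H"
  then obtain m f where y: "y \<in> moment_zero H" and m: "m > (0::nat)" and f: "poly_fun (dim_n H) f"
    and inv: "\<And>g y. g \<in> K_torus H \<Longrightarrow> y \<in> moment_zero H \<Longrightarrow>
      f (K_act H g y) = (\<Prod>l<dim_k H. g l powi theta_char H l) ^ m * f y"
    and fy: "f y \<noteq> 0"
    unfolding semistable_def by blast
  define a where "a = - (\<Sum>l<dim_k H. theta_char H l * s l)"
  have a: "a \<ge> 1" using neg by (simp add: a_def)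
  define B where "B = (\<Sum>i<dim_n H. norm (fst y i) + norm (snd y i))"
  have B: "norm (fst y i) \<le> B \<and> norm (snd y i) \<le> B" if "i < dim_n H" for i
  proof -
    have "norm (fst y i) + norm (snd y i) \<le> B"
      unfolding B_def using that by (intro member_le_sum) auto
    then show ?thesis using norm_ge_zero[of "fst y i"] norm_ge_zero[of "snd y i"] by linarith
  qed
  obtain M where M: "\<And>x. (\<forall>i<dim_n H. norm (fst x i) \<le> B \<and> norm (snd x i) \<le> B) \<Longrightarrow> norm (f x) \<le> M"
    using poly_fun_bounded[OF f, of B] by blast
  have "real r * norm (f y) \<le> M" for r
  proof -
    \<comment> \<open>Small parameters tending to 0 with \<open>r\<close>: nonnegative weights keep
      the point within the bound \<open>B\<close>, while the semi-invariant is scaled by at least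
      \<open>r\<close>.\<close>
    define t :: complex where "t = inverse (2 ^ r)"
    have t: "t \<noteq> 0" "norm t = inverse (2 ^ r)" "norm t \<le> 1" "norm t > 0"
      by (auto simp: t_def norm_inverse norm_power inverse_le_1_iff one_le_power)
    define g where "g l = (if l < dim_k H then t powi s l else 0)" for l
    have g: "g \<in> K_torus H" using t by (auto simp: K_torus_def vec_space_def g_def)
    have K: "K_incl H g i = t powi (\<Sum>l<dim_k H. iota H i l * s l)" for i
      using t by (simp add: K_incl_def g_def power_int_sum power_int_mult[symmetric] mult.commute)
    have small: "norm (t powi e) \<le> 1" if "e \<ge> 0" for e
      using that t(3) by (simp add: power_int_def norm_power power_le_one)
    have "norm (f (K_act H g y)) \<le> M"
    proof (rule M, intro allI impI)
      fix i assume i: "i < dim_n H"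
      define e where "e = (\<Sum>l<dim_k H. iota H i l * s l)"
      have "norm (K_incl H g i * fst y i) \<le> norm (fst y i)"
        using fst[OF i] small[of e] by (cases "fst y i = 0") (auto simp: norm_mult K e_def mult_left_le_one_le)
      moreover have "norm (inverse (K_incl H g i) * snd y i) \<le> norm (snd y i)"
        using snd[OF i] small[of "- e"]
        by (cases "snd y i = 0") (auto simp: norm_mult K e_def power_int_minus mult_left_le_one_le)
      ultimately show "norm (fst (K_act H g y) i) \<le> B \<and> norm (snd (K_act H g y) i) \<le> B"
        using B[OF i] by (simp add: K_act_eq)
    qed
    moreover have "f (K_act H g y) = (t powi (- a)) ^ m * f y"
    proof -
      have "(\<Prod>l<dim_k H. g l powi theta_char H l) = t powi (\<Sum>l<dim_k H. theta_char H l * s l)"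
        using t by (simp add: g_def power_int_sum power_int_mult[symmetric] mult.commute)
      then show ?thesis unfolding inv[OF g y] by (simp add: a_def)
    qed
    moreover have "real r \<le> norm ((t powi (- a)) ^ m)"
    proof -
      have "real r \<le> 2 ^ r" using of_nat_less_two_power[of r] less_imp_le by blast
      also have "\<dots> \<le> 2 ^ (r * (nat a * m))"
        using a m by (intro power_increasing) auto
      also have "\<dots> = norm ((t powi (- a)) ^ m)"
        using a by (simp add: norm_power norm_inverse t(2) power_int_def power_mult power_inverse)
      finally show ?thesis .
    qed
    ultimately show ?thesis
      by (metis norm_mult mult_right_mono norm_ge_zero order_trans)
  qed
  moreover obtain r :: nat where "real r * norm (f y) > M"
    using fy ex_less_of_nat_mult[of "norm (f y)" M] by auto
  ultimately show False by (meson not_le)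
qed

text \<open>Representatives of the vertex \<open>q\<close> and of the torus-invariant curves over its unbounded edges.\<close>

definition edge_point :: "hypertoric \<Rightarrow> nat set \<Rightarrow> phase \<Rightarrow> bool" where
  "edge_point H q y \<longleftrightarrow>
     fst y \<in> vec_space {..<dim_n H} \<and> snd y \<in> vec_space {..<dim_n H} \<and>
     (\<forall>j\<in>compl H q. (fst y j \<noteq> 0 \<longleftrightarrow> height H q j > 0) \<and> (snd y j \<noteq> 0 \<longleftrightarrow> height H q j < 0)) \<and>
     (\<forall>i\<in>q. fst y i = 0 \<or> snd y i = 0) \<and>
     (\<forall>i\<in>q. \<forall>j\<in>compl H q. (fst y i \<noteq> 0 \<longrightarrow> height H q j * edge H q i j \<ge> 0) \<and>
                          (snd y i \<noteq> 0 \<longrightarrow> height H q j * edge H q i j \<le> 0))"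

lemma edge_point_semistable:
  assumes q: "is_basis H q" and y: "edge_point H q y"
  shows "y \<in> semistable H"
proof (rule semistable_monomial[where N = 1 and m = "height H q"])
  have zero: "fst y j * snd y j = 0" for j
  proof -
    consider "j \<in> q" | "j \<in> compl H q" | "j \<ge> dim_n H" by (force simp: compl_def)
    then show ?thesis
    proof cases
      case 1
      then show ?thesis using y by (auto simp: edge_point_def)
    next
      case 2
      then show ?thesis using y unfolding edge_point_def by (metis less_asym mult_eq_0_iff)
    next
      case 3
      then show ?thesis using y by (simp add: edge_point_def vec_space_def)
    qed
  qed
  show "y \<in> moment_zero H"
    using y zero by (intro moment_zeroI) (auto simp: edge_point_def)
  show "(\<Sum>j<dim_n H. iota H j l * height H q j) = int 1 * theta_char H l" if "l < dim_k H" for l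
    using height_theta_char[OF q that] by simp
  show "fst y j \<noteq> 0" if "j < dim_n H" "height H q j > 0" for j
    using y that by (cases "j \<in> q") (auto simp: edge_point_def height_def compl_def)
  show "snd y j \<noteq> 0" if "j < dim_n H" "height H q j < 0" for j
    using y that by (cases "j \<in> q") (auto simp: edge_point_def height_def compl_def)
qed simp

text \<open>If \<open>u\<close> lost the coordinate with index \<open>j\<close>, column
  \<open>j\<close> of \<open>S\<close> would be a destabilising one-parameter subgroup. On the
  coordinates in \<open>q\<close>, the inequalities in \<open>edge_point\<close> give its weights
  the required signs.\<close>

lemma semistable_in_edge_closure:
  assumes q: "is_basis H q" and y: "edge_point H q y" and u: "u \<in> semistable H"
    and supp: "\<And>i. fst y i = 0 \<Longrightarrow> fst u i = 0" "\<And>i. snd y i = 0 \<Longrightarrow> snd u i = 0"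
    and j: "j \<in> compl H q" and hj: "height H q j \<noteq> 0"
  shows "if height H q j > 0 then fst u j \<noteq> 0 else snd u j \<noteq> 0"
proof (rule ccontr)
  assume contr: "\<not> ?thesis"
  obtain S where S1: "\<And>j j'. j \<in> compl H q \<Longrightarrow> j' \<in> compl H q \<Longrightarrow>
      (\<Sum>l<dim_k H. iota H j l * S l j') = (if j = j' then 1 else 0)"
    and S2: "\<And>i j'. i \<in> q \<Longrightarrow> j' \<in> compl H q \<Longrightarrow> (\<Sum>l<dim_k H. iota H i l * S l j') = circ H q i j'"
    and "\<And>l l'. l < dim_k H \<Longrightarrow> l' < dim_k H \<Longrightarrow>
      (\<Sum>j\<in>compl H q. S l j * iota H j l') = (if l = l' then 1 else 0)"
    using basis_iota_inverse[OF q] by blast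
  \<comment> \<open>With this sign the pairing with \<theta> is minus the absolute value of the
    height.\<close>
  define \<eta> where "\<eta> = - sgn (height H q j)"
  define s where "s l = \<eta> * S l j" for l
  have e: "(\<Sum>l<dim_k H. iota H i l * s l) = \<eta> * (\<Sum>l<dim_k H. iota H i l * S l j)" for i
    by (simp add: s_def sum_distrib_left mult.left_commute)
  have e_compl: "(\<Sum>l<dim_k H. iota H i l * s l) = (if i = j then \<eta> else 0)" if "i \<in> compl H q" for i
    using S1[OF that j] by (simp add: e)
  have e_q: "(\<Sum>l<dim_k H. iota H i l * s l) = sgn (height H q j) * edge H q i j" if "i \<in> q" for i
    using S2[OF that j] j by (simp add: e \<eta>_def edge_def compl_def)
  have sgn_pos: "sgn (height H q j) * c \<ge> 0" if "height H q j * c \<ge> 0" for c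
    using that by (auto simp: sgn_if zero_le_mult_iff split: if_splits)
  have sgn_neg: "sgn (height H q j) * c \<le> 0" if "height H q j * c \<le> 0" for c
    using that by (auto simp: sgn_if mult_le_0_iff split: if_splits)
  have "u \<notin> semistable H"
  proof (rule not_semistable_one_parameter[where s = s])
    fix i assume i: "i < dim_n H"
    show "(\<Sum>l<dim_k H. iota H i l * s l) \<ge> 0" if "fst u i \<noteq> 0"
    proof (cases "i \<in> q")
      case True
      have "height H q j * edge H q i j \<ge> 0"
        using y supp(1)[of i] that True j by (auto simp: edge_point_def)
      then show ?thesis unfolding e_q[OF True] by (rule sgn_pos)
    next
      case False
      then have ic: "i \<in> compl H q" using i by (simp add: compl_def)
      have "\<eta> \<ge> 0" if "i = j"
        using contr \<open>fst u i \<noteq> 0\<close> that hj by (auto simp: \<eta>_def sgn_if split: if_splits)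
      then show ?thesis unfolding e_compl[OF ic] by simp
    qed
    show "(\<Sum>l<dim_k H. iota H i l * s l) \<le> 0" if "snd u i \<noteq> 0"
    proof (cases "i \<in> q")
      case True
      have "height H q j * edge H q i j \<le> 0"
        using y supp(2)[of i] that True j by (auto simp: edge_point_def)
      then show ?thesis unfolding e_q[OF True] by (rule sgn_neg)
    next
      case False
      then have ic: "i \<in> compl H q" using i by (simp add: compl_def)
      have "\<eta> \<le> 0" if "i = j"
        using contr \<open>snd u i \<noteq> 0\<close> that hj by (auto simp: \<eta>_def sgn_if split: if_splits)
      then show ?thesis unfolding e_compl[OF ic] by simp
    qed
  next
    have "(\<Sum>l<dim_k H. theta_char H l * s l)
        = (\<Sum>l<dim_k H. \<Sum>i<dim_n H. height H q i * (iota H i l * s l))"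
      by (intro sum.cong refl) (simp add: height_theta_char[OF q, symmetric] sum_distrib_left mult_ac)
    also have "\<dots> = (\<Sum>i<dim_n H. height H q i * (\<Sum>l<dim_k H. iota H i l * s l))"
      by (subst sum.swap) (simp add: sum_distrib_left)
    also have "\<dots> = (\<Sum>i\<in>compl H q. height H q i * (\<Sum>l<dim_k H. iota H i l * s l))"
      unfolding sum_split_compl[OF is_basis_subset[OF q]] by (simp add: height_def)
    also have "\<dots> = (\<Sum>i\<in>compl H q. if i = j then height H q i * \<eta> else 0)"
      using e_compl by (intro sum.cong) auto
    also have "\<dots> = height H q j * \<eta>" using j by simp
    also have "\<dots> < 0" using hj by (auto simp: \<eta>_def sgn_if)
    finally show "(\<Sum>l<dim_k H. theta_char H l * s l) < 0" .
  qed
  with u show False by simp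
qed

lemma edge_point_K_act:
  assumes "edge_point H q y" "g \<in> K_torus H"
  shows "edge_point H q (K_act H g y)"
  using assms(1) K_incl_nonzero[OF assms(2)] by (auto simp: edge_point_def K_act_eq vec_space_def)

lemma continuous_on_phase_coordinates [continuous_intros]:
  "continuous_on S (\<lambda>x::phase. fst x i)" "continuous_on S (\<lambda>x::phase. snd x i)"
  by (rule continuous_on_product_then_coordinatewise, intro continuous_intros)+

text \<open>On the closed stratum \<open>Q\<close>, where the zeros of \<open>y\<close> persist,
  semistability keeps the coordinates off \<open>q\<close> nonzero. They determine a group element
  continuously, and the orbit is cut out of \<open>Q\<close> by comparing the other
  coordinates.\<close>

lemma edge_point_stable:
  assumes gen: "generic_data H" and q: "is_basis H q" and y: "edge_point H q y"
  shows "y \<in> stable H"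
proof -
  have hj: "height H q j \<noteq> 0" if "j \<in> compl H q" for j
    using gen q that unfolding generic_data_def by blast
  define Q where "Q = {u \<in> semistable H. \<forall>i. (fst y i = 0 \<longrightarrow> fst u i = 0) \<and> (snd y i = 0 \<longrightarrow> snd u i = 0)}"
  have Q_nz: "if height H q j > 0 then fst u j \<noteq> 0 else snd u j \<noteq> 0" if "u \<in> Q" "j \<in> compl H q" for u j
    using that by (intro semistable_in_edge_closure[OF q y _ _ _ _ hj]) (auto simp: Q_def)
  have y_nz: "if height H q j > 0 then fst y j \<noteq> 0 \<and> snd y j = 0 else snd y j \<noteq> 0 \<and> fst y j = 0"
    if "j \<in> compl H q" for j
    using y that hj[OF that] by (auto simp: edge_point_def)
  \<comment> \<open>The value which the character \<open>j\<close> must take on an element carrying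
    \<open>y\<close> to \<open>u\<close>; cotangent coordinates scale inversely.\<close>
  define \<gamma> where "\<gamma> j u = (if height H q j > 0 then fst u j / fst y j else snd y j / snd u j)" for j u
  have \<gamma>_nz: "\<gamma> j u \<noteq> 0" if "u \<in> Q" "j \<in> compl H q" for u j
    using Q_nz[OF that] y_nz[OF that(2)] by (auto simp: \<gamma>_def split: if_splits)
  define G where "G i u = (\<Prod>j\<in>compl H q. \<gamma> j u powi circ H q i j)" for i u
  have \<gamma>_cont: "continuous_on Q (\<gamma> j)" if "j \<in> compl H q" for j
  proof (cases "height H q j > 0")
    case True
    then show ?thesis
      using y_nz[OF that] unfolding \<gamma>_def[abs_def] by (auto intro!: continuous_intros)
  next
    case False
    then have "\<forall>u\<in>Q. snd u j \<noteq> 0" using Q_nz[OF _ that] by simp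
    with False show ?thesis
      unfolding \<gamma>_def[abs_def] by (auto intro!: continuous_intros)
  qed
  have G_cont: "continuous_on Q (G i)" for i
    unfolding G_def[abs_def] using \<gamma>_cont \<gamma>_nz by (intro continuous_intros) auto
  have G_nz: "G i u \<noteq> 0" if "u \<in> Q" for i u
    unfolding G_def using \<gamma>_nz[OF that] by simp
  \<comment> \<open>Off \<open>q\<close> the coordinates agree by the choice of \<gamma>; only those
    in \<open>q\<close>, moved by the dependent characters \<open>G\<close>, remain to be
    compared.\<close>
  define \<Phi> where "\<Phi> u = (\<lambda>i. if i \<in> q then (fst u i - G i u * fst y i, snd u i - inverse (G i u) * snd y i) else (0, 0))" for u
  have orbit: "K_orbit H y = {u \<in> Q. \<Phi> u = (\<lambda>_. (0, 0))}"
  proof (intro equalityI subsetI)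
    fix u assume "u \<in> K_orbit H y"
    then obtain g where g: "g \<in> K_torus H" "u = K_act H g y" by (auto simp: K_orbit_def)
    have uQ: "u \<in> Q"
      unfolding Q_def using edge_point_semistable[OF q edge_point_K_act[OF y g(1)]] K_incl_nonzero[OF g(1)]
      by (simp add: g(2) K_act_eq)
    have "\<gamma> j u = K_incl H g j" if "j \<in> compl H q" for j
      using y_nz[OF that] K_incl_nonzero[OF g(1)]
      by (auto simp: \<gamma>_def g(2) K_act_eq divide_inverse split: if_splits)
    then have "G i u = K_incl H g i" if "i \<in> q" for i
      unfolding G_def K_torus_basis[OF q g(1) that] by (intro prod.cong) auto
    then have "\<Phi> u = (\<lambda>_. (0, 0))" by (auto simp: \<Phi>_def g(2) K_act_eq)
    with uQ show "u \<in> {u \<in> Q. \<Phi> u = (\<lambda>_. (0, 0))}" by simp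
  next
    fix u assume "u \<in> {u \<in> Q. \<Phi> u = (\<lambda>_. (0, 0))}"
    then have uQ: "u \<in> Q" and \<Phi>0: "\<Phi> u = (\<lambda>_. (0, 0))" by auto
    obtain g where g: "g \<in> K_torus H" "\<And>j. j \<in> compl H q \<Longrightarrow> K_incl H g j = \<gamma> j u"
      by (rule K_torus_extend[OF q, of "\<lambda>j. \<gamma> j u"]) (use \<gamma>_nz[OF uQ] in auto)
    have gi: "K_incl H g i = G i u" if "i \<in> q" for i
      unfolding G_def K_torus_basis[OF q g(1) that] using g(2) by (intro prod.cong) auto
    have "fst u i = K_incl H g i * fst y i \<and> snd u i = inverse (K_incl H g i) * snd y i" for i
    proof -
      consider "i \<in> q" | "i \<in> compl H q" | "i \<ge> dim_n H" by (force simp: compl_def)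
      then show ?thesis
      proof cases
        case 1
        then show ?thesis using fun_cong[OF \<Phi>0, of i] gi by (simp add: \<Phi>_def)
      next
        case 2
        then show ?thesis
          using y_nz[OF 2] Q_nz[OF uQ 2] uQ g(2)[OF 2] by (auto simp: \<gamma>_def Q_def split: if_splits)
      next
        case 3
        then have "fst y i = 0" "snd y i = 0" using y by (auto simp: edge_point_def vec_space_def)
        then show ?thesis using uQ by (auto simp: Q_def)
      qed
    qed
    then have "u = K_act H g y" by (auto simp: K_act_eq prod_eq_iff)
    with g(1) show "u \<in> K_orbit H y" by (auto simp: K_orbit_def)
  qed
  have "closedin (top_of_set Q) (K_orbit H y)"
    unfolding orbit
  proof (rule continuous_closedin_preimage_constant)
    show "continuous_on Q \<Phi>"
      unfolding \<Phi>_def[abs_def]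
    proof (rule continuous_on_coordinatewise_then_product)
      fix i
      show "continuous_on Q (\<lambda>u. if i \<in> q then (fst u i - G i u * fst y i, snd u i - inverse (G i u) * snd y i) else (0, 0))"
        using G_cont[of i] G_nz by (cases "i \<in> q") (auto intro!: continuous_intros)
    qed
  qed
  moreover have "closedin (top_of_set (semistable H)) Q"
  proof -
    have "closed {u :: phase. \<forall>i. (fst y i = 0 \<longrightarrow> fst u i = 0) \<and> (snd y i = 0 \<longrightarrow> snd u i = 0)}"
      by (intro closed_Collect_all closed_Collect_conj closed_Collect_imp closed_Collect_eq
          open_Collect_const continuous_intros)
    moreover have "Q = semistable H \<inter> {u. \<forall>i. (fst y i = 0 \<longrightarrow> fst u i = 0) \<and> (snd y i = 0 \<longrightarrow> snd u i = 0)}"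
      unfolding Q_def by blast
    ultimately show ?thesis by (simp only: closedin_closed_Int)
  qed
  ultimately have "closedin (top_of_set (semistable H)) (K_orbit H y)" by (rule closedin_trans)
  moreover have "finite {g \<in> K_torus H. K_act H g y = y}"
  proof (rule finite_subset)
    show "{g \<in> K_torus H. K_act H g y = y} \<subseteq> {\<lambda>l. if l < dim_k H then 1 else 0}"
    proof
      fix g assume "g \<in> {g \<in> K_torus H. K_act H g y = y}"
      then have g: "g \<in> K_torus H" "K_act H g y = y" by auto
      have "K_incl H g i * fst y i = fst y i" "inverse (K_incl H g i) * snd y i = snd y i" for i
        using g(2) by (auto simp: K_act_eq prod_eq_iff fun_eq_iff)
      then have "K_incl H g j = 1" if "j \<in> compl H q" for j
        using y_nz[OF that] by (metis inverse_1 inverse_inverse_eq mult_cancel_right1)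
      then have "g l = 1" if "l < dim_k H" for l using K_faithful[OF q g(1) _ that] by blast
      then show "g \<in> {\<lambda>l. if l < dim_k H then 1 else 0}"
        using g(1) by (auto simp: K_torus_def vec_space_def fun_eq_iff)
    qed
  qed simp
  ultimately show ?thesis
    using edge_point_semistable[OF q y] by (simp add: stable_def)
qed

text \<open>\<open>K\<close> is transitive on points with this support since its characters off
  \<open>p\<close> can be prescribed freely. In particular \<open>fixed_orbit\<close> is a single
  point of the quotient.\<close>

lemma fixed_orbit_K_orbit:
  assumes gen: "generic_data H" and p: "is_basis H p"
  obtains y where "edge_point H p y" "\<And>i. i \<in> p \<Longrightarrow> fst y i = 0 \<and> snd y i = 0"
    "fixed_orbit H p = K_orbit H y"
proof -
  have pn: "p \<subseteq> {..<dim_n H}" by (rule is_basis_subset[OF p])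
  have hj: "height H p j \<noteq> 0" if "j \<in> compl H p" for j
    using gen p that unfolding generic_data_def by blast
  define z :: "nat \<Rightarrow> complex" where "z j = (if j < dim_n H \<and> height H p j > 0 then 1 else 0)" for j
  define w :: "nat \<Rightarrow> complex" where "w j = (if j < dim_n H \<and> height H p j < 0 then 1 else 0)" for j
  have zero: "fst (z, w) i = 0 \<and> snd (z, w) i = 0" if "i \<in> p" for i
    using that by (auto simp: z_def w_def height_def)
  have y: "edge_point H p (z, w)"
    using zero by (auto simp: edge_point_def vec_space_def z_def w_def compl_def)
  have "fixed_orbit H p = K_orbit H (z, w)"
  proof (intro equalityI subsetI)
    fix u assume "u \<in> K_orbit H (z, w)"
    then obtain g where g: "g \<in> K_torus H" "u = K_act H g (z, w)" by (auto simp: K_orbit_def)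
    have "u \<in> stable H"
      unfolding g(2) by (rule edge_point_stable[OF gen p edge_point_K_act[OF y g(1)]])
    moreover have "(z i \<noteq> 0 \<longleftrightarrow> i \<in> A_plus H p) \<and> (w i \<noteq> 0 \<longleftrightarrow> i \<in> A_minus H p)" if "i < dim_n H" for i
      using that unfolding A_plus_generic[OF gen p] A_minus_generic[OF gen p]
      by (cases "i \<in> p") (auto simp: z_def w_def compl_def height_def)
    ultimately show "u \<in> fixed_orbit H p"
      using K_incl_nonzero[OF g(1)] unfolding fixed_orbit_def g(2) by (simp add: K_act_eq)
  next
    fix u assume u: "u \<in> fixed_orbit H p"
    then have st: "u \<in> stable H" and fst: "\<And>i. i < dim_n H \<Longrightarrow> fst u i \<noteq> 0 \<longleftrightarrow> i \<in> A_plus H p"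
      and snd: "\<And>i. i < dim_n H \<Longrightarrow> snd u i \<noteq> 0 \<longleftrightarrow> i \<in> A_minus H p"
      by (auto simp: fixed_orbit_def)
    then have vs: "fst u \<in> vec_space {..<dim_n H}" "snd u \<in> vec_space {..<dim_n H}"
      by (auto simp: stable_def semistable_def moment_zero_def phase_space_def)
    define \<gamma> where "\<gamma> j = (if height H p j > 0 then fst u j else inverse (snd u j))" for j
    have u_compl: "fst u j \<noteq> 0 \<longleftrightarrow> height H p j > 0" "snd u j \<noteq> 0 \<longleftrightarrow> height H p j < 0"
      if "j \<in> compl H p" for j
      using fst[of j] snd[of j] that unfolding A_plus_generic[OF gen p] A_minus_generic[OF gen p]
      by (auto simp: compl_def)
    have u_p: "fst u i = 0" "snd u i = 0" if "i \<in> p" for i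
      using fst[of i] snd[of i] that pn unfolding A_plus_generic[OF gen p] A_minus_generic[OF gen p]
      by (auto simp: compl_def)
    have "\<gamma> j \<noteq> 0" if "j \<in> compl H p" for j
      using u_compl[OF that] hj[OF that] by (auto simp: \<gamma>_def)
    then obtain g where g: "g \<in> K_torus H" "\<And>j. j \<in> compl H p \<Longrightarrow> K_incl H g j = \<gamma> j"
      by (rule K_torus_extend[OF p]) auto
    have "fst u i = K_incl H g i * z i \<and> snd u i = inverse (K_incl H g i) * w i" for i
    proof -
      consider "i \<in> p" | "i \<in> compl H p" | "i \<ge> dim_n H" by (force simp: compl_def)
      then show ?thesis
      proof cases
        case 1
        then show ?thesis using u_p[OF 1] zero[OF 1] by simp
      next
        case 2
        then have "i < dim_n H" by (simp add: compl_def)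
        then show ?thesis
          using u_compl[OF 2] hj[OF 2] g(2)[OF 2] by (auto simp: \<gamma>_def z_def w_def)
      next
        case 3
        then show ?thesis using vs by (auto simp: z_def w_def vec_space_def)
      qed
    qed
    then have "u = K_act H g (z, w)" by (auto simp: K_act_eq prod_eq_iff)
    with g(1) show "u \<in> K_orbit H (z, w)" by (auto simp: K_orbit_def)
  qed
  with y zero show ?thesis by (rule that)
qed

lemma stable_K_act:
  assumes "x \<in> stable H" "g \<in> K_torus H"
  shows "K_act H g x \<in> stable H"
proof -
  have nz: "K_incl H g i \<noteq> 0" for i by (rule K_incl_nonzero[OF assms(2)])
  have ss: "x \<in> semistable H" and mz: "x \<in> moment_zero H"
    using assms(1) by (auto simp: stable_def semistable_def)
  have prod_eq: "fst (K_act H g x) i * snd (K_act H g x) i = fst x i * snd x i" for i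
    using nz[of i] by (simp add: K_act_eq)
  have "K_act H g x \<in> moment_zero H"
  proof -
    have "fst (K_act H g x) \<in> vec_space {..<dim_n H}" "snd (K_act H g x) \<in> vec_space {..<dim_n H}"
      using mz by (auto simp: moment_zero_def phase_space_def vec_space_def K_act_eq)
    then show ?thesis
      using mz prod_eq by (auto simp: moment_zero_def phase_space_def case_prod_unfold mem_Times_iff)
  qed
  moreover obtain m f where m: "m > (0::nat)" "poly_fun (dim_n H) f"
    and inv: "\<forall>g\<in>K_torus H. \<forall>y\<in>moment_zero H.
      f (K_act H g y) = (\<Prod>l<dim_k H. g l powi theta_char H l) ^ m * f y" and "f x \<noteq> 0"
    using ss unfolding semistable_def by blast
  moreover have "f (K_act H g x) \<noteq> 0"
    using inv assms(2) mz \<open>f x \<noteq> 0\<close> K_torus_nonzero[OF assms(2)] by simp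
  ultimately have ss': "K_act H g x \<in> semistable H"
    unfolding semistable_def by blast
  have orb: "K_orbit H (K_act H g x) = K_orbit H x"
    using assms(2) by (intro K_orbit_eqI) (auto simp: K_orbit_def)
  have "K_act H h (K_act H g x) = K_act H g x \<longleftrightarrow> K_act H h x = x" for h
    using nz by (auto simp: K_act_eq prod_eq_iff fun_eq_iff)
  then show ?thesis
    using assms(1) ss' orb by (simp add: stable_def)
qed

lemma points_subset_stable:
  assumes "x \<in> points H"
  shows "x \<subseteq> stable H"
  using assms stable_K_act by (auto simp: points_def K_orbit_def)

lemma K_orbit_in_points: "u \<in> stable H \<Longrightarrow> K_orbit H u \<in> points H"
  by (simp add: points_def)

section \<open>The quotient topology\<close>

text \<open>Distinct points are disjoint orbits, so taking unions commutes with intersections; this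
  makes the defining family a topology.\<close>

lemma openin_quot_top:
  "openin (quot_top H) U \<longleftrightarrow> U \<subseteq> points H \<and> openin (top_of_set (stable H)) (\<Union>U)"
proof -
  have "istopology (\<lambda>U. U \<subseteq> points H \<and> openin (top_of_set (stable H)) (\<Union>U))"
    unfolding istopology_def
  proof (intro conjI allI impI)
    fix U V assume UV: "U \<subseteq> points H \<and> openin (top_of_set (stable H)) (\<Union>U)"
      "V \<subseteq> points H \<and> openin (top_of_set (stable H)) (\<Union>V)"
    have "a = b" if "a \<in> U" "b \<in> V" "x \<in> a" "x \<in> b" for a b x
      using points_K_orbit[of a H x] points_K_orbit[of b H x] that UV by blast
    then have "\<Union>(U \<inter> V) = \<Union>U \<inter> \<Union>V" by blast
    then show "openin (top_of_set (stable H)) (\<Union>(U \<inter> V))"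
      using UV openin_Int[of "top_of_set (stable H)" "\<Union>U" "\<Union>V"] by simp
  next
    fix \<U> assume "\<forall>U\<in>\<U>. U \<subseteq> points H \<and> openin (top_of_set (stable H)) (\<Union>U)"
    then have "openin (top_of_set (stable H)) (\<Union>((\<lambda>U. \<Union>U) ` \<U>))"
      by (intro openin_Union) auto
    moreover have "\<Union>((\<lambda>U. \<Union>U) ` \<U>) = \<Union>(\<Union>\<U>)" by blast
    ultimately show "openin (top_of_set (stable H)) (\<Union>(\<Union>\<U>))" by simp
  qed auto
  then show ?thesis unfolding quot_top_def by (simp add: topology_inverse')
qed

lemma openin_quot_top_invariant:
  assumes "openin (top_of_set (stable H)) W" "\<And>u g. u \<in> W \<Longrightarrow> g \<in> K_torus H \<Longrightarrow> K_act H g u \<in> W"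
  shows "openin (quot_top H) {x \<in> points H. x \<subseteq> W}"
proof -
  have "\<Union>{x \<in> points H. x \<subseteq> W} = W"
  proof (intro equalityI subsetI)
    fix u assume u: "u \<in> W"
    then have "u \<in> stable H" using openin_subset[OF assms(1)] by auto
    moreover have "K_orbit H u \<subseteq> W" using assms(2)[OF u] unfolding K_orbit_def by blast
    ultimately show "u \<in> \<Union>{x \<in> points H. x \<subseteq> W}"
      using K_orbit_self K_orbit_in_points by blast
  qed auto
  with assms(1) show ?thesis unfolding openin_quot_top by auto
qed

lemma topspace_quot_top: "topspace (quot_top H) = points H"
proof -
  have "openin (quot_top H) {x \<in> points H. x \<subseteq> stable H}"
    by (rule openin_quot_top_invariant) (auto intro: stable_K_act)
  then have "openin (quot_top H) (points H)"
    using points_subset_stable by (metis (no_types, lifting) Collect_cong Collect_mem_eq)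
  moreover have "topspace (quot_top H) \<subseteq> points H"
    using openin_quot_top[of H "topspace (quot_top H)"] by auto
  ultimately show ?thesis using openin_subset by blast
qed

lemma monomial_continuous: "continuous_on S (monomial H m)"
proof -
  have "continuous_on S (\<lambda>x. if m j \<ge> 0 then fst x j ^ nat (m j) else snd x j ^ nat (- m j))" for j
    by (cases "m j \<ge> 0") (auto intro!: continuous_intros)
  then show ?thesis unfolding monomial_def[abs_def] by (intro continuous_on_prod)
qed

text \<open>
  A \<open>K\<close>-invariant monomial of negative \<open>\<sigma>\<close>-weight vanishes on every attracting set, hence on
  full attracting sets.
\<close>

lemma not_in_attr_full:
  assumes gen: "generic_data H" and p: "is_basis H p"
    and m: "m \<in> row_space H" and neg: "(\<Sum>j<dim_n H. sigma_lift H j * m j) < 0"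
    and y: "y \<in> stable H" "monomial H m y \<noteq> 0"
  shows "K_orbit H y \<notin> attr_full H p"
proof
  assume attr: "K_orbit H y \<in> attr_full H p"
  have inv: "monomial H m (K_act H g u) = monomial H m u" if "g \<in> K_torus H" for g u
    unfolding monomial_K[OF that] using row_space_iota[OF p m] by simp
  \<comment> \<open>The zero locus of the monomial in the quotient contains the fixed point, is
    closed, and absorbs attracting sets; hence it contains the full attracting set.\<close>
  define Y where "Y = {x \<in> points H. \<forall>u\<in>x. monomial H m u = 0}"
  have const: "monomial H m v = monomial H m u" if "x \<in> points H" "u \<in> x" "v \<in> x" for x u v
  proof -
    have "v \<in> K_orbit H u" using points_K_orbit[OF that(1,2)] that(3) by simp
    then obtain g where "g \<in> K_torus H" "v = K_act H g u" unfolding K_orbit_def by blast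
    then show ?thesis by (simp only: inv)
  qed
  have "closedin (quot_top H) Y"
    unfolding closedin_def topspace_quot_top
  proof
    define W where "W = {u \<in> stable H. monomial H m u \<in> - {0}}"
    have "openin (top_of_set (stable H)) W"
      unfolding W_def
      using continuous_openin_preimage_gen[OF monomial_continuous, of "- {0}" "stable H"]
      by (simp add: vimage_def Int_def open_Compl)
    moreover have "K_act H g u \<in> W" if "u \<in> W" "g \<in> K_torus H" for u g
      using that inv stable_K_act by (auto simp: W_def)
    ultimately have "openin (quot_top H) {x \<in> points H. x \<subseteq> W}"
      by (rule openin_quot_top_invariant)
    moreover have "{x \<in> points H. x \<subseteq> W} = points H - Y"
    proof -
      have "x \<subseteq> W \<longleftrightarrow> \<not> (\<forall>u\<in>x. monomial H m u = 0)" if x: "x \<in> points H" for x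
      proof -
        obtain u where "u \<in> x" using x K_orbit_self unfolding points_def by blast
        have "monomial H m v = monomial H m u" if "v \<in> x" for v
          by (rule const[OF x \<open>u \<in> x\<close> that])
        moreover have "v \<in> stable H" if "v \<in> x" for v
          using points_subset_stable[OF x] that by blast
        ultimately have "x \<subseteq> W" if "monomial H m u \<noteq> 0"
          unfolding W_def using that by (intro subsetI CollectI conjI) simp_all
        moreover have "\<forall>v\<in>x. monomial H m v = 0" if "monomial H m u = 0"
          using \<open>\<And>v. v \<in> x \<Longrightarrow> monomial H m v = monomial H m u\<close> that by simp
        ultimately show ?thesis using \<open>u \<in> x\<close> unfolding W_def by blast
      qed
      then show ?thesis by (auto simp: Y_def)
    qed
    ultimately show "openin (quot_top H) (points H - Y)" by simp
  qed (auto simp: Y_def)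
  moreover have "fixed_orbit H p \<in> Y"
  proof -
    obtain u where u: "edge_point H p u" "\<And>i. i \<in> p \<Longrightarrow> fst u i = 0 \<and> snd u i = 0"
      "fixed_orbit H p = K_orbit H u"
      using fixed_orbit_K_orbit[OF gen p] by blast
    \<comment> \<open>All coordinates in \<open>p\<close> vanish at the fixed point. A nonzero value
      would force \<open>m\<close> to vanish on \<open>p\<close>, hence everywhere, against its
      negative weight.\<close>
    have "monomial H m u = 0"
    proof (rule ccontr)
      assume nz: "monomial H m u \<noteq> 0"
      have mp: "m i = 0" if "i \<in> p" for i
      proof -
        have "i < dim_n H" using is_basis_subset[OF p] that by auto
        then show ?thesis
          using nz u(2)[OF that] unfolding monomial_eq_0_iff by (metis linorder_neqE)
      qed
      then have "m j = 0" if "j \<in> compl H p" for j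
        using row_space_basis[OF p m that] by simp
      with mp have "(\<Sum>j<dim_n H. sigma_lift H j * m j) = 0"
        unfolding sum_split_compl[OF is_basis_subset[OF p]] by simp
      with neg show False by simp
    qed
    then have "monomial H m v = 0" if v: "v \<in> K_orbit H u" for v
    proof -
      obtain g where "g \<in> K_torus H" "v = K_act H g u" using v unfolding K_orbit_def by blast
      then show ?thesis using \<open>monomial H m u = 0\<close> by (simp only: inv)
    qed
    then show ?thesis
      unfolding Y_def u(3) using edge_point_stable[OF gen p u(1)] by (simp add: K_orbit_in_points)
  qed
  moreover have "attr_set H y' \<subseteq> Y" if y': "y' \<in> Y" for y'
  proof
    fix x assume x: "x \<in> attr_set H y'"
    then have xp: "x \<in> points H"
      and lim: "limitin (quot_top H) (\<lambda>t. torus_act (cochar H t) 1 ` x) y' (at 0)"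
      by (auto simp: attr_set_def)
    show "x \<in> Y"
    proof (rule ccontr)
      assume "x \<notin> Y"
      then obtain u where u: "u \<in> x" "monomial H m u \<noteq> 0" using xp by (auto simp: Y_def)
      \<comment> \<open>Near the limit point the monomial is smaller than its value at
        \<open>u\<close>, whereas for \<open>norm t < 1\<close> the flow can only enlarge
        it.\<close>
      define c where "c = norm (monomial H m u)"
      define W where "W = {v \<in> stable H. monomial H m v \<in> ball 0 c}"
      have "openin (top_of_set (stable H)) W"
        unfolding W_def
        using continuous_openin_preimage_gen[OF monomial_continuous, of "ball 0 c" "stable H"]
        by (simp add: vimage_def Int_def)
      moreover have "K_act H g v \<in> W" if "v \<in> W" "g \<in> K_torus H" for v g
        using that inv stable_K_act by (auto simp: W_def)
      ultimately have "openin (quot_top H) {x \<in> points H. x \<subseteq> W}"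
        by (rule openin_quot_top_invariant)
      moreover have "y' \<in> {x \<in> points H. x \<subseteq> W}"
        using y' u(2) points_subset_stable[of y' H] by (auto simp: Y_def W_def c_def)
      ultimately have "\<forall>\<^sub>F t in at 0. torus_act (cochar H t) 1 ` x \<in> {x \<in> points H. x \<subseteq> W}"
        using lim unfolding limitin_def by blast
      moreover have "\<forall>\<^sub>F t::complex in at 0. t \<noteq> 0 \<and> norm t < 1"
        unfolding eventually_at by (intro exI[of _ 1]) auto
      ultimately have "\<forall>\<^sub>F t::complex in at 0. False"
      proof eventually_elim
        case (elim t)
        then have "torus_act (cochar H t) 1 u \<in> W" using u(1) by blast
        then have "norm (monomial H m (torus_act (cochar H t) 1 u)) < c" by (simp add: W_def)
        moreover have "monomial H m (torus_act (cochar H t) 1 u)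
            = t powi (\<Sum>j<dim_n H. sigma_lift H j * m j) * monomial H m u"
          using elim by (subst monomial_torus)
            (auto simp: cochar_def power_int_sum power_int_mult)
        moreover have "norm (t powi (\<Sum>j<dim_n H. sigma_lift H j * m j)) \<ge> 1"
          using elim neg
          by (auto simp: power_int_def norm_power norm_inverse one_le_inverse_iff intro!: one_le_power)
        ultimately show False
          using mult_right_mono[OF _ norm_ge_zero[of "monomial H m u"], of 1] by (fastforce simp: norm_mult c_def)
      qed
      then show False by simp
    qed
  qed
  ultimately have "K_orbit H y \<in> Y"
    using attr unfolding attr_full_def by blast
  then show False using y(2) K_orbit_self by (auto simp: Y_def)
qed

section \<open>Fixed components and quasi-periods\<close>

text \<open>The Kaehler argument of \<open>bundle_fun\<close>, including its power of
  \<open>hbar\<close>. With this shift it is exactly a restricted Chern root of the mirror.\<close>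

definition kahler_shift :: "hypertoric \<Rightarrow> nat set \<Rightarrow> (coord \<Rightarrow> complex) \<Rightarrow> nat \<Rightarrow> complex" where
  "kahler_shift H p u j = kahler_at H p u j - (\<Sum>i\<in>p_plus H p. of_int (circ H p i j)) * u Ch"

lemma bundle_fun_eq:
  "bundle_fun q H p u =
     (\<Prod>i\<in>p_plus H p. theta q (u Ch + chern_root H u i)) * (\<Prod>i\<in>p_minus H p. theta q (chern_root H u i)) *
     (\<Prod>j\<in>A_plus H p. theta q (chern_root H u j + kahler_shift H p u j) / theta q (kahler_shift H p u j)) *
     (\<Prod>j\<in>A_minus H p. theta q (chern_root H u j + kahler_shift H p u j) /
                        theta q (- u Ch + kahler_shift H p u j))"
  unfolding bundle_fun_def kahler_shift_def Let_def by (rule refl)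

lemma chern_root_affine:
  "chern_root H (\<lambda>c. u c + t * d c) i = chern_root H u i + t * chern_root H d i"
  by (simp add: chern_root_def distrib_left sum.distrib sum_distrib_left mult_ac)

lemma chern_at_affine:
  "chern_at H p (\<lambda>c. u c + t * d c) i = chern_at H p u i + t * chern_at H p d i"
  by (simp add: chern_at_def distrib_left sum.distrib sum_distrib_left sum_distrib_right mult_ac
      right_diff_distrib)

lemma kahler_shift_affine:
  "kahler_shift H p (\<lambda>c. u c + t * d c) j = kahler_shift H p u j + t * kahler_shift H p d j"
  by (simp add: kahler_shift_def kahler_at_def distrib_left sum.distrib sum_distrib_left
      sum_distrib_right mult_ac right_diff_distrib)

lemma chern_at_cong:
  assumes "\<And>c. c \<in> params H \<Longrightarrow> u c = v c" "i < dim_n H"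
  shows "chern_at H p u i = chern_at H p v i"
proof -
  have "u (Ca j) = v (Ca j)" if "j < dim_n H" for j using that assms(1) by (simp add: params_def)
  then have "(\<Sum>j\<in>compl H p. of_int (circ H p i j) * u (Ca j)) = (\<Sum>j\<in>compl H p. of_int (circ H p i j) * v (Ca j))"
    "u (Ca i) = v (Ca i)"
    using assms(2) by (auto simp: compl_def intro!: sum.cong)
  moreover have "u Ch = v Ch" using assms(1) by (simp add: params_def kcoords_def)
  ultimately show ?thesis by (simp add: chern_at_def)
qed

lemma kahler_shift_cong:
  assumes "\<And>c. c \<in> params H \<Longrightarrow> u c = v c" "j < dim_n H" "p \<subseteq> {..<dim_n H}"
  shows "kahler_shift H p u j = kahler_shift H p v j"
proof -
  have "u (Cz j) = v (Cz j)" if "j < dim_n H" for j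
    using that assms(1) by (simp add: params_def kcoords_def)
  moreover have "u Ch = v Ch" using assms(1) by (simp add: params_def kcoords_def)
  moreover have "i < dim_n H" if "i \<in> p" for i using that assms(3) by auto
  ultimately show ?thesis
    using assms(2) by (simp add: kahler_shift_def kahler_at_def cong: sum.cong)
qed

lemma chern_root_basis:
  assumes "is_basis H p" "i \<in> p"
  shows "chern_root H v i = v (Ca i) +
    (\<Sum>j\<in>compl H p. of_int (circ H p i j) * (chern_root H v j - v (Ca j)))"
proof -
  have "(\<Sum>l<dim_k H. of_int (iota H i l) * v (Cs l))
      = (\<Sum>l<dim_k H. \<Sum>j\<in>compl H p. of_int (circ H p i j) * (of_int (iota H j l) * v (Cs l)))"
    using iota_basis[OF assms] by (intro sum.cong refl) (simp add: sum_distrib_right mult.assoc)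
  also have "\<dots> = (\<Sum>j\<in>compl H p. of_int (circ H p i j) * (\<Sum>l<dim_k H. of_int (iota H j l) * v (Cs l)))"
    by (subst sum.swap) (simp add: sum_distrib_left)
  finally show ?thesis by (simp add: chern_root_def)
qed

lemma generic_height:
  "generic_data H \<Longrightarrow> is_basis H p \<Longrightarrow> j \<in> compl H p \<Longrightarrow> height H p j \<noteq> 0"
  unfolding generic_data_def by blast

lemma chern_at_compl:
  assumes "generic_data H" "is_basis H p" "j \<in> compl H p"
  shows "chern_at H p u j = (if height H p j > 0 then 0 else - u Ch)"
  using generic_height[OF assms] assms(3)
  by (auto simp: chern_at_def A_plus_generic[OF assms(1,2)] A_minus_generic[OF assms(1,2)])

text \<open>The restricted roots obey the linear relation of \<open>chern_root_basis\<close>, so a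
  point lies on the component as soon as the roots off \<open>p\<close> are correct.\<close>

lemma chern_at_basis:
  assumes "generic_data H" "is_basis H p" "i \<in> p"
  shows "chern_at H p u i = u (Ca i) + (\<Sum>j\<in>compl H p. of_int (circ H p i j) * (chern_at H p u j - u (Ca j)))"
proof -
  have "A_minus H p \<subseteq> compl H p" by (auto simp: A_minus_def)
  have "(\<Sum>j\<in>compl H p. of_int (circ H p i j) * chern_at H p u j)
      = (\<Sum>j\<in>compl H p. if j \<in> A_minus H p then - of_int (circ H p i j) * u Ch else 0)"
    using chern_at_compl[OF assms(1,2)] generic_height[OF assms(1,2)]
    by (intro sum.cong refl) (fastforce simp: A_minus_generic[OF assms(1,2)])
  also have "\<dots> = (\<Sum>j\<in>A_minus H p. - of_int (circ H p i j) * u Ch)"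
    using \<open>A_minus H p \<subseteq> compl H p\<close> by (intro sum.mono_neutral_cong_right) auto
  finally have "(\<Sum>j\<in>compl H p. of_int (circ H p i j) * chern_at H p u j)
      = - (\<Sum>j\<in>A_minus H p. of_int (circ H p i j)) * u Ch"
    by (simp add: sum_distrib_right sum_negf)
  moreover have "i \<notin> A_plus H p" "i \<notin> A_minus H p"
    using assms(3) by (auto simp: A_plus_def A_minus_def compl_def)
  ultimately show ?thesis
    by (simp add: chern_at_def right_diff_distrib sum_subtractf)
qed

lemma chern_root_eq_chern_at:
  assumes "generic_data H" "is_basis H p" "i < dim_n H"
    and "\<And>j. j \<in> compl H p \<Longrightarrow> chern_root H v j = chern_at H p v j"
  shows "chern_root H v i = chern_at H p v i"
proof (cases "i \<in> p")
  case True
  then show ?thesis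
    using chern_root_basis[OF assms(2) True, of v] chern_at_basis[OF assms(1,2) True, of v] assms(4)
    by (simp cong: sum.cong)
next
  case False
  then show ?thesis using assms(3,4) by (simp add: compl_def)
qed

text \<open>The inverse \<open>S\<close> recovers the coordinates \<open>Cs\<close> from the roots
  off \<open>p\<close>. This is the uniqueness behind \<open>ell_lift\<close>.\<close>

lemma chern_root_determines:
  assumes "is_basis H p" "v \<in> vec_space (coords H)" "v' \<in> vec_space (coords H)"
    and "\<And>c. c \<in> params H \<Longrightarrow> v c = v' c"
    and "\<And>j. j \<in> compl H p \<Longrightarrow> chern_root H v j = chern_root H v' j"
  shows "v = v'"
proof
  fix c
  show "v c = v' c"
  proof (cases "c \<in> Cs ` {..<dim_k H}")
    case False
    then show ?thesis using assms(2-4) by (cases "c \<in> params H") (auto simp: vec_space_def coords_def)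
  next
    case True
    then obtain l where l: "l < dim_k H" "c = Cs l" by auto
    obtain S where
      "\<And>j j'. j \<in> compl H p \<Longrightarrow> j' \<in> compl H p \<Longrightarrow>
        (\<Sum>l<dim_k H. iota H j l * S l j') = (if j = j' then 1 else 0)"
      "\<And>i j'. i \<in> p \<Longrightarrow> j' \<in> compl H p \<Longrightarrow> (\<Sum>l<dim_k H. iota H i l * S l j') = circ H p i j'"
      and S: "\<And>l l'. l < dim_k H \<Longrightarrow> l' < dim_k H \<Longrightarrow>
        (\<Sum>j\<in>compl H p. S l j * iota H j l') = (if l = l' then 1 else 0)"
      using basis_iota_inverse[OF assms(1)] by blast
    have rec: "w (Cs l) = (\<Sum>j\<in>compl H p. of_int (S l j) * (chern_root H w j - w (Ca j)))" for w
    proof -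
      have "(\<Sum>j\<in>compl H p. of_int (S l j) * (chern_root H w j - w (Ca j)))
          = (\<Sum>j\<in>compl H p. \<Sum>l'<dim_k H. of_int (S l j * iota H j l') * w (Cs l'))"
        by (simp add: chern_root_def sum_distrib_left mult.assoc)
      also have "\<dots> = (\<Sum>l'<dim_k H. of_int (\<Sum>j\<in>compl H p. S l j * iota H j l') * w (Cs l'))"
        by (subst sum.swap) (simp add: sum_distrib_right)
      also have "\<dots> = (\<Sum>l'<dim_k H. if l' = l then w (Cs l') else 0)"
        using S[OF l(1)] by (intro sum.cong) auto
      also have "\<dots> = w (Cs l)" using l(1) by simp
      finally show ?thesis ..
    qed
    have "v (Ca j) = v' (Ca j)" if "j \<in> compl H p" for j
      using that by (intro assms(4)) (auto simp: params_def compl_def)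
    then show ?thesis using rec[of v] rec[of v'] assms(5) l(2) by (simp cong: sum.cong)
  qed
qed

lemma ell_lift_exists:
  assumes "generic_data H" "is_basis H p"
  shows "\<exists>v. v \<in> vec_space (coords H) \<and> (\<forall>c\<in>params H. v c = u c) \<and>
    (\<forall>j\<in>compl H p. chern_root H v j = chern_at H p v j)"
proof -
  obtain S where S: "\<And>j j'. j \<in> compl H p \<Longrightarrow> j' \<in> compl H p \<Longrightarrow>
        (\<Sum>l<dim_k H. iota H j l * S l j') = (if j = j' then 1 else 0)"
    and "\<And>i j'. i \<in> p \<Longrightarrow> j' \<in> compl H p \<Longrightarrow> (\<Sum>l<dim_k H. iota H i l * S l j') = circ H p i j'"
    and "\<And>l l'. l < dim_k H \<Longrightarrow> l' < dim_k H \<Longrightarrow>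
      (\<Sum>j\<in>compl H p. S l j * iota H j l') = (if l = l' then 1 else 0)"
    using basis_iota_inverse[OF assms(2)] by blast
  define s where "s l = (\<Sum>j\<in>compl H p. of_int (S l j) * (chern_at H p u j - u (Ca j)))" for l
  define v where "v c = (if c \<in> params H then u c else
    (case c of Cs l \<Rightarrow> if l < dim_k H then s l else 0 | _ \<Rightarrow> 0))" for c
  have vs: "v (Cs l) = s l" if "l < dim_k H" for l
    using that by (simp add: v_def params_def kcoords_def image_iff)
  have vp: "v c = u c" if "c \<in> params H" for c using that by (simp add: v_def)
  have "v \<in> vec_space (coords H)"
    by (auto simp: vec_space_def v_def coords_def split: coord.split)
  moreover have "chern_root H v j = chern_at H p v j" if j: "j \<in> compl H p" for j
  proof -
    have jn: "j < dim_n H" using j by (simp add: compl_def)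
    have "(\<Sum>l<dim_k H. of_int (iota H j l) * v (Cs l))
        = (\<Sum>l<dim_k H. \<Sum>j'\<in>compl H p. of_int (iota H j l * S l j') * (chern_at H p u j' - u (Ca j')))"
      by (intro sum.cong refl) (simp add: vs s_def sum_distrib_left mult.assoc)
    also have "\<dots> = (\<Sum>j'\<in>compl H p. of_int (\<Sum>l<dim_k H. iota H j l * S l j') * (chern_at H p u j' - u (Ca j')))"
      by (subst sum.swap) (simp add: sum_distrib_right)
    also have "\<dots> = (\<Sum>j'\<in>compl H p. if j' = j then chern_at H p u j' - u (Ca j') else 0)"
      using S[OF j] by (intro sum.cong) auto
    also have "\<dots> = chern_at H p u j - u (Ca j)" using j by simp
    finally have "chern_root H v j = chern_at H p u j"
      using jn vp[of "Ca j"] by (simp add: chern_root_def params_def)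
    also have "\<dots> = chern_at H p v j" using vp jn by (intro chern_at_cong) auto
    finally show ?thesis .
  qed
  ultimately show ?thesis using vp by blast
qed

lemma ell_lift_eqI:
  assumes "generic_data H" "is_basis H p" "v \<in> vec_space (coords H)"
    and "\<And>c. c \<in> params H \<Longrightarrow> v c = u c"
    and "\<And>j. j \<in> compl H p \<Longrightarrow> chern_root H v j = chern_at H p v j"
  shows "ell_lift H p u = v"
  unfolding ell_lift_def
proof (rule the_equality)
  show "v \<in> vec_space (coords H) \<and> (\<forall>c\<in>params H. v c = u c) \<and>
      (\<forall>i<dim_n H. chern_root H v i = chern_at H p v i)"
    using assms(3,4) chern_root_eq_chern_at[OF assms(1,2) _ assms(5)] by blast
next
  fix v'
  assume v': "v' \<in> vec_space (coords H) \<and> (\<forall>c\<in>params H. v' c = u c) \<and>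
      (\<forall>i<dim_n H. chern_root H v' i = chern_at H p v' i)"
  show "v' = v"
  proof (rule chern_root_determines[OF assms(2) _ assms(3)])
    fix j assume j: "j \<in> compl H p"
    then have jn: "j < dim_n H" by (simp add: compl_def)
    have "chern_at H p v' j = chern_at H p v j"
      using v' assms(4) jn by (intro chern_at_cong) auto
    then show "chern_root H v' j = chern_root H v j" using v' assms(5)[OF j] jn by simp
  qed (use v' assms(4) in auto)
qed

lemma ell_lift_props:
  assumes "generic_data H" "is_basis H p"
  shows "ell_lift H p u \<in> vec_space (coords H)"
    and "c \<in> params H \<Longrightarrow> ell_lift H p u c = u c"
    and "i < dim_n H \<Longrightarrow> chern_root H (ell_lift H p u) i = chern_at H p u i"
proof -
  obtain v where v: "v \<in> vec_space (coords H)" "\<And>c. c \<in> params H \<Longrightarrow> v c = u c"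
    "\<And>j. j \<in> compl H p \<Longrightarrow> chern_root H v j = chern_at H p v j"
    using ell_lift_exists[OF assms, of u] by blast
  have eq: "ell_lift H p u = v" by (rule ell_lift_eqI[OF assms v])
  show "ell_lift H p u \<in> vec_space (coords H)" using v(1) eq by simp
  show "c \<in> params H \<Longrightarrow> ell_lift H p u c = u c" using v(2) eq by simp
  show "chern_root H (ell_lift H p u) i = chern_at H p u i" if "i < dim_n H"
  proof -
    have "chern_root H v i = chern_at H p v i" by (rule chern_root_eq_chern_at[OF assms that v(3)])
    also have "\<dots> = chern_at H p u i" using v(2) that by (intro chern_at_cong) auto
    finally show ?thesis unfolding eq .
  qed
qed

lemma ell_lift_Ch: "generic_data H \<Longrightarrow> is_basis H p \<Longrightarrow> ell_lift H p u Ch = u Ch"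
  by (rule ell_lift_props(2)) (auto simp: params_def kcoords_def)

lemma ell_lift_in_ell:
  assumes "generic_data H" "is_basis H p"
  shows "ell_lift H p u \<in> ell q H"
proof -
  have "chern_root H (ell_lift H p u) i - chern_at H p (ell_lift H p u) i = 0" if "i < dim_n H" for i
    using ell_lift_props(3)[OF assms that, of u] chern_at_cong[OF ell_lift_props(2)[OF assms] that]
    by simp
  then have "ell_lift H p u \<in> ell_comp q H p"
    using ell_lift_props(1)[OF assms] by (simp add: ell_comp_def)
  then show ?thesis using vertex_eq(2)[OF assms(2)] by (auto simp: ell_def)
qed

lemma kproj_cong: "(\<And>c. c \<in> kcoords H \<Longrightarrow> u c = v c) \<Longrightarrow> kproj H u = kproj H v"
  by (auto simp: kproj_def)

lemma kproj_ell_lift: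
  assumes "generic_data H" "is_basis H p"
  shows "kproj H (ell_lift H p u) = kproj H u"
  using ell_lift_props(2)[OF assms] by (intro kproj_cong) (auto simp: params_def)

section \<open>Varying a single equivariant parameter\<close>

lemma chern_root_upd:
  "chern_root H (v(Ca i := t)) j = (if j = i then chern_root H v i - v (Ca i) + t else chern_root H v j)"
  by (simp add: chern_root_def)

lemma kahler_shift_upd: "kahler_shift H p (v(Ca i := t)) j = kahler_shift H p v j"
  by (simp add: kahler_shift_def kahler_at_def)

lemma kproj_upd: "kproj H (v(Ca i := t)) = kproj H v"
  by (intro kproj_cong) (auto simp: kcoords_def)

text \<open>The roots off \<open>p\<close> do not involve \<open>a_i\<close>, so changing it leaves
  the coordinates \<open>Cs\<close> alone. The line in direction \<open>a_i\<close> therefore stays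
  on one lift of the component, as the one-variable argument requires.\<close>

lemma ell_lift_upd:
  assumes "generic_data H" "is_basis H p" "i \<in> p"
  shows "ell_lift H p (u(Ca i := t)) = (ell_lift H p u)(Ca i := t)"
proof (rule ell_lift_eqI[OF assms(1,2)])
  have i: "i < dim_n H" using is_basis_subset[OF assms(2)] assms(3) by auto
  show "(ell_lift H p u)(Ca i := t) \<in> vec_space (coords H)"
    using ell_lift_props(1)[OF assms(1,2), of u] i by (auto simp: vec_space_def coords_def params_def)
  show "((ell_lift H p u)(Ca i := t)) c = (u(Ca i := t)) c" if "c \<in> params H" for c
    using ell_lift_props(2)[OF assms(1,2) that, of u] by simp
  fix j assume j: "j \<in> compl H p"
  then have "j \<noteq> i" "j < dim_n H" using assms(3) by (auto simp: compl_def)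
  then show "chern_root H ((ell_lift H p u)(Ca i := t)) j = chern_at H p ((ell_lift H p u)(Ca i := t)) j"
    using ell_lift_props(3)[OF assms(1,2), of j u] ell_lift_Ch[OF assms(1,2), of u]
    by (simp add: chern_root_upd chern_at_compl[OF assms(1,2) j])
qed

lemma params_upd: "i < dim_n H \<Longrightarrow> u \<in> vec_space (params H) \<Longrightarrow> u(Ca i := t) \<in> vec_space (params H)"
  by (auto simp: vec_space_def params_def)

lemma A_plus_finite [simp]: "finite (A_plus H p)" "finite (A_minus H p)"
  by (auto simp: A_plus_def A_minus_def)

text \<open>Only \<open>x_i\<close> depends on \<open>a_i\<close>; as \<open>i\<close> is off
  \<open>p\<close>, it indexes exactly one theta quotient, in \<open>A_plus\<close> or in
  \<open>A_minus\<close>. A vanishing denominator merely makes \<open>K\<close> zero.\<close>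

lemma bundle_fun_one_variable:
  assumes "generic_data H" "is_basis H p" "i \<in> compl H p"
  shows "\<exists>K. \<forall>t. bundle_fun q H p (v(Ca i := t))
    = K * theta q (chern_root H v i - v (Ca i) + t + kahler_shift H p v i)"
proof -
  have ip: "i \<notin> p" using assms(3) by (simp add: compl_def)
  define x where "x = chern_root H v"
  define y where "y = kahler_shift H p v"
  define T where "T t = theta q (x i - v (Ca i) + t + y i)" for t
  define K0 where "K0 = (\<Prod>i\<in>p_plus H p. theta q (v Ch + x i)) * (\<Prod>i\<in>p_minus H p. theta q (x i))"
  have K0: "(\<Prod>j\<in>p_plus H p. theta q ((v(Ca i := t)) Ch + chern_root H (v(Ca i := t)) j)) *
      (\<Prod>j\<in>p_minus H p. theta q (chern_root H (v(Ca i := t)) j)) = K0" for t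
    unfolding K0_def x_def using ip
    by (intro arg_cong2[where f = "(*)"] prod.cong refl) (auto simp: chern_root_upd p_plus_eq p_minus_eq)
  have prod_out: "\<exists>K. \<forall>t. (\<Prod>j\<in>A. theta q (chern_root H (v(Ca i := t)) j + y j) / D j) = K * (if i \<in> A then T t else 1)"
    if "finite A" for A D
  proof (cases "i \<in> A")
    case True
    have "(\<Prod>j\<in>A - {i}. theta q (chern_root H (v(Ca i := t)) j + y j) / D j)
        = (\<Prod>j\<in>A - {i}. theta q (x j + y j) / D j)" for t
      by (intro prod.cong) (auto simp: chern_root_upd x_def)
    then show ?thesis
      using True that by (intro exI[of _ "(\<Prod>j\<in>A - {i}. theta q (x j + y j) / D j) / D i"])
        (simp add: prod.remove[OF that True] chern_root_upd T_def x_def)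
  next
    case False
    then have "(\<Prod>j\<in>A. theta q (chern_root H (v(Ca i := t)) j + y j) / D j)
        = (\<Prod>j\<in>A. theta q (x j + y j) / D j)" for t
      by (intro prod.cong) (auto simp: chern_root_upd x_def)
    then show ?thesis using False by auto
  qed
  obtain K1 where K1: "\<And>t. (\<Prod>j\<in>A_plus H p. theta q (chern_root H (v(Ca i := t)) j + y j) / theta q (y j))
      = K1 * (if i \<in> A_plus H p then T t else 1)"
    using prod_out[of "A_plus H p" "\<lambda>j. theta q (y j)"] by auto
  obtain K2 where K2: "\<And>t. (\<Prod>j\<in>A_minus H p. theta q (chern_root H (v(Ca i := t)) j + y j) / theta q (- v Ch + y j))
      = K2 * (if i \<in> A_minus H p then T t else 1)"
    using prod_out[of "A_minus H p" "\<lambda>j. theta q (- v Ch + y j)"] by auto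
  have "(i \<in> A_plus H p) \<noteq> (i \<in> A_minus H p)"
    using assms unfolding A_plus_generic[OF assms(1,2)] A_minus_generic[OF assms(1,2)] generic_data_def
    by (auto simp: neq_iff)
  then have "bundle_fun q H p (v(Ca i := t)) = K0 * K1 * K2 * T t" for t
    unfolding bundle_fun_eq kahler_shift_upd
    using K0[of t] K1[of t] K2[of t] by (auto simp: y_def)
  then show ?thesis unfolding T_def x_def y_def by blast
qed

text \<open>A direction in which all arguments of \<open>theta\<close> in \<open>bundle_fun\<close> grow.\<close>

definition generic_direction :: "hypertoric \<Rightarrow> nat set \<Rightarrow> nat set \<Rightarrow> coord \<Rightarrow> complex" where
  "generic_direction H r s = (\<lambda>c. case c of Ca i \<Rightarrow> if i \<in> r then 1 else 0 | Cz j \<Rightarrow> if j \<in> s then 1 else 0 | _ \<Rightarrow> 0)"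

lemma generic_direction_kahler_shift:
  assumes "j \<in> compl H p"
  shows "kahler_shift H p (generic_direction H r (compl H p)) j = 1"
  using assms by (simp add: kahler_shift_def kahler_at_def generic_direction_def compl_def)

lemma generic_direction_chern_root:
  assumes "i \<in> r"
  shows "chern_root H (generic_direction H r s) i = 1"
  using assms by (simp add: chern_root_def generic_direction_def)

lemma countable_theta_zeros:
  assumes "0 < norm q" "norm q < 1" "b \<noteq> 0"
  shows "countable {t. theta q (a + t * b) = 0}"
  unfolding theta_eq_0_iff[OF assms(1,2)] by (rule countable_affine_periods[OF assms(3)])

lemma prod_zero_factor:
  fixes f :: "'a \<Rightarrow> 'b::semidom"
  assumes "prod f A = 0"
  shows "\<exists>a\<in>A. f a = 0"
  using assms by (induction A rule: infinite_finite_induct) auto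

text \<open>Each theta argument grows at rate 1 or 2 along the line. The zeros of the denominators
  are counted as well, because division by zero yields 0.\<close>

lemma bundle_fun_countable_zeros:
  assumes q: "0 < norm q" "norm q < 1" and p: "is_basis H p"
  defines "d \<equiv> generic_direction H {..<dim_n H} (compl H p)"
  shows "countable {t. bundle_fun q H p (\<lambda>c. u c + t * d c) = 0}"
proof -
  have pn: "p \<subseteq> {..<dim_n H}" by (rule is_basis_subset[OF p])
  have dC: "d Ch = 0" by (simp add: d_def generic_direction_def)
  define x where "x = chern_root H u"
  define y where "y = kahler_shift H p u"
  have x: "chern_root H (\<lambda>c. u c + t * d c) i = x i + t * 1" if "i < dim_n H" for i t
    unfolding chern_root_affine x_def using generic_direction_chern_root[of i "{..<dim_n H}"] that
    by (simp add: d_def)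
  have y: "kahler_shift H p (\<lambda>c. u c + t * d c) j = y j + t * 1" if "j \<in> compl H p" for j t
    unfolding kahler_shift_affine y_def d_def generic_direction_kahler_shift[OF that] by simp
  define Z where "Z = (\<lambda>a b. {t. theta q (a + t * b) = 0})"
  have Z: "countable (Z a b)" if "b \<noteq> 0" for a b
    unfolding Z_def by (rule countable_theta_zeros[OF q that])
  have "{t. bundle_fun q H p (\<lambda>c. u c + t * d c) = 0} \<subseteq>
      (\<Union>i\<in>p. Z (u Ch + x i) 1 \<union> Z (x i) 1) \<union>
      (\<Union>j\<in>compl H p. Z (x j + y j) 2 \<union> Z (y j) 1 \<union> Z (- u Ch + y j) 1)"
  proof
    fix t assume "t \<in> {t. bundle_fun q H p (\<lambda>c. u c + t * d c) = 0}"
    then have "bundle_fun q H p (\<lambda>c. u c + t * d c) = 0" by simp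
    then consider i where "i \<in> p_plus H p" "theta q (u Ch + chern_root H (\<lambda>c. u c + t * d c) i) = 0"
      | i where "i \<in> p_minus H p" "theta q (chern_root H (\<lambda>c. u c + t * d c) i) = 0"
      | j where "j \<in> A_plus H p" "theta q (chern_root H (\<lambda>c. u c + t * d c) j + kahler_shift H p (\<lambda>c. u c + t * d c) j) = 0
          \<or> theta q (kahler_shift H p (\<lambda>c. u c + t * d c) j) = 0"
      | j where "j \<in> A_minus H p" "theta q (chern_root H (\<lambda>c. u c + t * d c) j + kahler_shift H p (\<lambda>c. u c + t * d c) j) = 0
          \<or> theta q (- u Ch + kahler_shift H p (\<lambda>c. u c + t * d c) j) = 0"
      unfolding bundle_fun_eq mult_eq_0_iff
      by (elim disjE) (auto simp: dC dest!: prod_zero_factor)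
    then show "t \<in> (\<Union>i\<in>p. Z (u Ch + x i) 1 \<union> Z (x i) 1) \<union>
      (\<Union>j\<in>compl H p. Z (x j + y j) 2 \<union> Z (y j) 1 \<union> Z (- u Ch + y j) 1)"
    proof cases
      case (1 i)
      then have "i \<in> p" "i < dim_n H" using pn by (auto simp: p_plus_eq)
      then show ?thesis using 1(2) by (auto simp: x Z_def add.assoc intro!: bexI[of _ i])
    next
      case (2 i)
      then have "i \<in> p" "i < dim_n H" using pn by (auto simp: p_minus_eq)
      then show ?thesis using 2(2) by (auto simp: x Z_def intro!: bexI[of _ i])
    next
      case (3 j)
      then have j: "j \<in> compl H p" "j < dim_n H" by (auto simp: A_plus_def compl_def)
      then have e: "chern_root H (\<lambda>c. u c + t * d c) j + kahler_shift H p (\<lambda>c. u c + t * d c) j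
          = x j + y j + t * 2" by (simp add: x y)
      have "t \<in> Z (x j + y j) 2 \<union> Z (y j) 1"
        using 3(2) unfolding e unfolding y[OF \<open>j \<in> compl H p\<close>] Z_def by blast
      then show ?thesis using \<open>j \<in> compl H p\<close> by blast
    next
      case (4 j)
      then have j: "j \<in> compl H p" "j < dim_n H" by (auto simp: A_minus_def compl_def)
      then have e: "chern_root H (\<lambda>c. u c + t * d c) j + kahler_shift H p (\<lambda>c. u c + t * d c) j
          = x j + y j + t * 2" by (simp add: x y)
      have "t \<in> Z (x j + y j) 2 \<union> Z (- u Ch + y j) 1"
        using 4(2) unfolding e unfolding y[OF \<open>j \<in> compl H p\<close>] Z_def add.assoc[symmetric] by blast
      then show ?thesis using \<open>j \<in> compl H p\<close> by blast
    qed
  qed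
  moreover have "countable \<dots>"
    using Z is_basis_finite[OF p] by (intro countable_Un countable_UN) (auto intro: countable_finite)
  ultimately show ?thesis by (rule countable_subset)
qed

section \<open>Uniqueness of stable envelopes\<close>

lemma continuous_on_affine_path:
  "continuous_on UNIV (\<lambda>t::complex. (\<lambda>c. u c + t * d c) :: 'i \<Rightarrow> complex)"
  by (intro continuous_on_coordinatewise_then_product continuous_intros)

lemma continuous_on_upd_path:
  "continuous_on UNIV (\<lambda>t::complex. (v(i := t)) :: 'i \<Rightarrow> complex)"
proof (rule continuous_on_coordinatewise_then_product)
  show "continuous_on UNIV (\<lambda>t. (v(i := t)) j)" for j
    by (cases "j = i") auto
qed

lemma isCont_UNIV:
  fixes f :: "'a::t2_space \<Rightarrow> 'b::topological_space"
  shows "continuous_on UNIV f \<Longrightarrow> isCont f x"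
  using continuous_on_eq_continuous_at by blast

lemma eventually_path_in_openin:
  fixes P :: "complex \<Rightarrow> 'a::topological_space"
  assumes "openin (top_of_set X) W" "P t0 \<in> W" "continuous_on UNIV P" "\<And>t. P t \<in> X"
  shows "\<forall>\<^sub>F t in nhds t0. P t \<in> W"
proof -
  obtain T where T: "open T" "W = X \<inter> T" using assms(1) by (auto simp: openin_open)
  have "open (P -` T)" using assms(3) T(1) by (simp add: continuous_on_open_vimage)
  moreover have "t0 \<in> P -` T" using assms(2) T(2) by simp
  ultimately have "\<forall>\<^sub>F t in nhds t0. t \<in> P -` T" by (rule eventually_nhds_in_open)
  then show ?thesis by eventually_elim (use T(2) assms(4) in auto)
qed

lemma ell_subset: "ell q H \<subseteq> vec_space (coords H)"
  by (auto simp: ell_def ell_comp_def)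

lemma regular_local_extension:
  assumes "regular_at q H F (kproj H u)" "u \<in> ell q H"
  shows "\<exists>W G. u \<in> W \<and> holo_on (coords H) W G \<and> (\<forall>v\<in>W \<inter> ell q H. F v = G v)"
proof -
  obtain V where "holo_on_ell q H V F" "kproj H u \<in> V"
    using assms(1) unfolding regular_at_def by blast
  then show ?thesis using assms(2) unfolding holo_on_ell_def by blast
qed

lemma field_differentiable_cong_ev:
  assumes "f field_differentiable at x" "\<forall>\<^sub>F t in nhds x. f t = g t"
  shows "g field_differentiable at x"
  using assms by (metis DERIV_cong_ev field_differentiable_def)

text \<open>No poles are allowed in \<open>a_i\<close>: regularity depends on \<open>kproj\<close>
  only, so it holds along the whole line and yields an entire function.\<close>

lemma regular_upd_holomorphic:
  assumes "i < dim_n H" and ell: "\<And>t. v(Ca i := t) \<in> ell q H"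
    and reg: "regular_at q H F (kproj H v)"
  shows "(\<lambda>t. F (v(Ca i := t))) holomorphic_on UNIV"
proof -
  have "(\<lambda>t. F (v(Ca i := t))) field_differentiable at t0" for t0
  proof -
    have "regular_at q H F (kproj H (v(Ca i := t0)))" using reg by (simp only: kproj_upd)
    from regular_local_extension[OF this ell] obtain W G where W1: "v(Ca i := t0) \<in> W"
      and holo: "holo_on (coords H) W G" and FG: "\<forall>v\<in>W \<inter> ell q H. F v = G v"
      by blast
    have W: "v(Ca i := t0) \<in> W" "openin (top_of_set (vec_space (coords H))) W"
      using W1 conjunct1[OF holo[unfolded holo_on_def]] by simp_all
    have "\<forall>\<^sub>F t in nhds t0. v(Ca i := t) \<in> W"
      by (rule eventually_path_in_openin[OF W(2,1) continuous_on_upd_path]) (use ell ell_subset in blast)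
    then have ev: "\<forall>\<^sub>F t in nhds t0. G (v(Ca i := t)) = F (v(Ca i := t))"
      by eventually_elim (simp add: FG ell)
    have "Ca i \<in> coords H" using assms(1) by (simp add: coords_def params_def)
    with holo W(1) have "(\<lambda>t. G ((v(Ca i := t0))(Ca i := t))) field_differentiable (at ((v(Ca i := t0)) (Ca i)))"
      unfolding holo_on_def by blast
    then have "(\<lambda>t. G (v(Ca i := t))) field_differentiable at t0" by simp
    then show ?thesis by (rule field_differentiable_cong_ev[OF _ ev])
  qed
  then show ?thesis by (simp add: holomorphic_on_def)
qed

text \<open>Since \<open>ell\<close> is not open in the ambient space, continuity is borrowed from a
  local ambient extension.\<close>

lemma regular_path_isCont:
  fixes P :: "complex \<Rightarrow> coord \<Rightarrow> complex"
  assumes "continuous_on UNIV P" "\<And>t. P t \<in> ell q H" "regular_at q H F (kproj H (P t0))"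
  shows "isCont (\<lambda>t. F (P t)) t0"
proof -
  from regular_local_extension[OF assms(3,2)] obtain W G where W1: "P t0 \<in> W"
    and holo: "holo_on (coords H) W G" and FG: "\<forall>v\<in>W \<inter> ell q H. F v = G v"
    by blast
  have W: "P t0 \<in> W" "openin (top_of_set (vec_space (coords H))) W" and G: "continuous_on W G"
    using W1 holo unfolding holo_on_def by simp_all
  have ev: "\<forall>\<^sub>F t in nhds t0. P t \<in> W"
    by (rule eventually_path_in_openin[OF W(2,1) assms(1)]) (use assms(2) ell_subset in blast)
  then obtain T where T: "open T" "t0 \<in> T" "\<And>t. t \<in> T \<Longrightarrow> P t \<in> W"
    unfolding eventually_nhds by blast
  have "continuous_on T (\<lambda>t. G (P t))"
    using T(3) by (intro continuous_on_compose2[OF G continuous_on_subset[OF assms(1)]]) auto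
  then have "isCont (\<lambda>t. G (P t)) t0" using T(1,2) continuous_on_eq_continuous_at by blast
  moreover have "\<forall>\<^sub>F t in nhds t0. G (P t) = F (P t)"
    using ev by eventually_elim (simp add: FG assms(2))
  ultimately show ?thesis by (simp add: isCont_cong)
qed

lemma kproj_continuous:
  assumes "continuous_on S P"
  shows "continuous_on S (\<lambda>t. kproj H (P t))"
  unfolding kproj_def
proof (rule continuous_on_coordinatewise_then_product)
  show "continuous_on S (\<lambda>t. if c \<in> kcoords H then P t c else 0)" for c
    using continuous_on_product_then_coordinatewise[OF assms, of c] by (cases "c \<in> kcoords H") auto
qed

text \<open>
  The multiplier of \<open>bundle_fun\<close> is that of its only factor depending on \<open>a\<^sub>i\<close>: it can be computed
  where \<open>bundle_fun\<close> does not vanish, and extends by continuity.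
\<close>

lemma bundle_section_shift:
  assumes q: "0 < norm q" "norm q < 1"
    and gen: "generic_data H" and p: "is_basis H p" and i: "i \<in> compl H p"
    and sqp: "same_quasi_periods q H (bundle_fun q H p) F"
    and L: "L \<in> periods q" and M: "\<And>w. theta q (w + L) = M w * theta q w" "continuous_on UNIV M"
    and v: "v \<in> ell q H" and reg: "regular_at q H F (kproj H v)"
  shows "F (v(Ca i := v (Ca i) + L)) = M (chern_root H v i + kahler_shift H p v i) * F v"
proof -
  have i_n: "i < dim_n H" using i by (simp add: compl_def)
  define l where "l = (\<lambda>c. if c = Ca i then L else 0)"
  have l: "l \<in> vec_space (coords H)" "\<forall>c\<in>coords H. l c \<in> periods q"
    using i_n L by (auto simp: l_def vec_space_def coords_def params_def)
  have add_l: "(\<lambda>c. u c + l c) = u(Ca i := u (Ca i) + L)" for u by (auto simp: l_def)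
  obtain e where e: "holo_on (coords H) (vec_space (coords H)) e"
    and e\<Phi>: "\<And>u. u \<in> vec_space (coords H) \<Longrightarrow> bundle_fun q H p (\<lambda>c. u c + l c) = e u * bundle_fun q H p u"
    and eF: "\<And>u. u \<in> ell q H \<Longrightarrow> regular_at q H F (kproj H u) \<Longrightarrow> F (\<lambda>c. u c + l c) = e u * F u"
    using sqp l unfolding same_quasi_periods_def by blast
  define w where "w u = chern_root H u i + kahler_shift H p u i" for u
  have mult: "bundle_fun q H p (\<lambda>c. u c + l c) = M (w u) * bundle_fun q H p u" for u
  proof -
    obtain K where K: "\<And>t. bundle_fun q H p (u(Ca i := t))
        = K * theta q (chern_root H u i - u (Ca i) + t + kahler_shift H p u i)"
      using bundle_fun_one_variable[OF gen p i] by blast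
    have "bundle_fun q H p (u(Ca i := u (Ca i) + L)) = K * theta q (w u + L)"
      unfolding K w_def by (simp add: algebra_simps)
    moreover have "bundle_fun q H p u = K * theta q (w u)"
      using K[of "u (Ca i)"] by (simp add: w_def)
    ultimately show ?thesis unfolding add_l by (simp add: M(1))
  qed
  have vs: "v \<in> vec_space (coords H)" using v ell_subset by blast
  \<comment> \<open>\<open>bundle_fun\<close> may vanish at \<open>v\<close> itself. On a generic
    line through \<open>v\<close> this happens for countably many parameters only, and the
    continuous functions \<open>e\<close> and \<open>M\<close> agree elsewhere.\<close>
  define d where "d = generic_direction H {..<dim_n H} (compl H p)"
  have d: "d c = 0" if "c \<notin> coords H" for c
    using that by (cases c) (auto simp: d_def generic_direction_def coords_def params_def kcoords_def compl_def)
  define P where "P t = (\<lambda>c. v c + t * d c)" for t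
  have P0: "P 0 = v" by (simp add: P_def)
  have Pc: "P t \<in> vec_space (coords H)" for t
    using vs d by (simp add: P_def vec_space_def)
  have cont: "continuous_on UNIV P" unfolding P_def[abs_def] by (rule continuous_on_affine_path)
  have "e (P 0) = M (w (P 0))"
  proof (rule isCont_eq_off_countable[where f = "\<lambda>t. e (P t)" and g = "\<lambda>t. M (w (P t))"])
    have "continuous_on (vec_space (coords H)) e" using e by (simp add: holo_on_def)
    then have "continuous_on UNIV (\<lambda>t. e (P t))"
      by (rule continuous_on_compose2[OF _ cont]) (use Pc in auto)
    then show "isCont (\<lambda>t. e (P t)) 0" by (rule isCont_UNIV)
    have "w (P t) = w v + t * w d" for t
      unfolding w_def P_def chern_root_affine kahler_shift_affine by (simp add: algebra_simps)
    then have "continuous_on UNIV (\<lambda>t. w (P t))" by (simp add: continuous_intros)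
    then have "continuous_on UNIV (\<lambda>t. M (w (P t)))"
      by (rule continuous_on_compose2[OF M(2)]) auto
    then show "isCont (\<lambda>t. M (w (P t))) 0" by (rule isCont_UNIV)
    show "countable {t. bundle_fun q H p (P t) = 0}"
      unfolding P_def d_def by (rule bundle_fun_countable_zeros[OF q p])
    show "\<forall>\<^sub>F t in nhds 0. t \<notin> {t. bundle_fun q H p (P t) = 0} \<longrightarrow> e (P t) = M (w (P t))"
    proof (intro always_eventually allI impI)
      fix t assume "t \<notin> {t. bundle_fun q H p (P t) = 0}"
      then show "e (P t) = M (w (P t))"
        using e\<Phi>[OF Pc, of t] mult[of "P t"] by simp
    qed
  qed
  then have "e v = M (w v)" by (simp add: P0)
  then show ?thesis using eF[OF v reg] unfolding add_l w_def by simp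
qed

text \<open>
  In the single variable \<open>a\<^sub>i\<close>, both sides are theta functions of degree one with the same
  multipliers, so agreement at one non-exceptional point suffices.
\<close>

lemma bundle_section_step:
  assumes q: "0 < norm q" "norm q < 1"
    and gen: "generic_data H" and p: "is_basis H p" and i: "i \<in> compl H p"
    and sqp: "same_quasi_periods q H (bundle_fun q H p) F"
    and reg: "regular_at q H F (kproj H v)" and ell: "\<And>t. v(Ca i := t) \<in> ell q H"
    and eq: "F (v(Ca i := t0)) = bundle_fun q H p (v(Ca i := t0))"
    and np: "chern_root H (v(Ca i := t0)) i + kahler_shift H p v i \<notin> periods q"
  shows "F v = bundle_fun q H p v"
proof -
  have i_n: "i < dim_n H" using i by (simp add: compl_def)
  define \<tau> where "\<tau> = Ln q"
  have \<tau>: "exp \<tau> = q" using q by (auto simp: \<tau>_def)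
  \<comment> \<open>The part of the theta argument that is independent of \<open>a_i\<close>, so
    that \<open>t + y\<close> is the full argument.\<close>
  define y where "y = chern_root H v i - v (Ca i) + kahler_shift H p v i"
  obtain K where K: "\<And>t. bundle_fun q H p (v(Ca i := t))
      = K * theta q (chern_root H v i - v (Ca i) + t + kahler_shift H p v i)"
    using bundle_fun_one_variable[OF gen p i] by blast
  have K': "bundle_fun q H p (v(Ca i := t)) = K * theta q (t + y)" for t
    unfolding K y_def by (simp add: algebra_simps)
  define D where "D t = F (v(Ca i := t)) - bundle_fun q H p (v(Ca i := t))" for t
  have theta_shift: "(\<lambda>t. theta q (t + y)) holomorphic_on UNIV"
    using holomorphic_on_compose_gen[of "\<lambda>t. t + y" UNIV "theta q" UNIV] theta_holomorphic[OF q(2)]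
    by (simp add: o_def holomorphic_on_add holomorphic_on_ident)
  have D_hol: "D holomorphic_on UNIV"
    unfolding D_def K'
    by (intro holomorphic_intros regular_upd_holomorphic[OF i_n ell reg] theta_shift)
  have D_shift: "D (t + L) = M (t + y) * D t"
    if L: "L \<in> periods q" and M: "\<And>w. theta q (w + L) = M w * theta q w" "continuous_on UNIV M" for L M t
  proof -
    have "F ((v(Ca i := t))(Ca i := (v(Ca i := t)) (Ca i) + L))
        = M (chern_root H (v(Ca i := t)) i + kahler_shift H p (v(Ca i := t)) i) * F (v(Ca i := t))"
      using reg by (intro bundle_section_shift[OF q gen p i sqp L M ell]) (simp_all only: kproj_upd)
    then have "F (v(Ca i := t + L)) = M (t + y) * F (v(Ca i := t))"
      by (simp add: chern_root_upd kahler_shift_upd y_def algebra_simps)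
    moreover have "theta q (t + L + y) = M (t + y) * theta q (t + y)"
      using M(1)[of "t + y"] by (simp add: algebra_simps)
    ultimately show ?thesis unfolding D_def K' by (simp add: algebra_simps)
  qed
  have "2 * pi * \<i> \<in> periods q"
    unfolding periods_def by (auto intro!: exI[of _ 0])
  moreover have "\<tau> \<in> periods q"
    unfolding periods_def using \<tau> by (auto intro!: exI[of _ 1])
  moreover have "continuous_on UNIV (\<lambda>w. - exp (- w - \<tau> / 2))"
    by (intro continuous_intros) auto
  ultimately have D1: "D (t + 2 * pi * \<i>) = - 1 * D t"
    and D2: "D (t + \<tau>) = - exp (- (t + y) - \<tau> / 2) * D t" for t
    using D_shift[of "2 * pi * \<i>" "\<lambda>_. - 1" t] theta_add_2pi[OF q(2)]
      D_shift[of \<tau> "\<lambda>w. - exp (- w - \<tau> / 2)" t] theta_add_tau[OF q(2) \<tau>]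
    by auto
  have "D (v (Ca i)) = 0"
  proof (rule theta_section_eq_0[OF q \<tau> D_hol _ D2])
    show "D (t + 2 * pi * \<i>) = - D t" for t using D1[of t] by simp
    show "D t0 = 0" using eq by (simp add: D_def)
    show "t0 + y \<notin> periods q" using np by (simp add: chern_root_upd y_def algebra_simps)
  qed
  then show ?thesis by (simp add: D_def)
qed

text \<open>These conditions keep the denominators of \<open>bundle_fun\<close> nonzero. They also
  say that the theta argument of index \<open>j\<close> is no period when the root is 0 or
  \<open>- u Ch\<close>.\<close>

definition generic_params :: "complex \<Rightarrow> hypertoric \<Rightarrow> nat set \<Rightarrow> (coord \<Rightarrow> complex) \<Rightarrow> bool" where
  "generic_params q H p u \<longleftrightarrow>
     (\<forall>j\<in>compl H p. kahler_shift H p u j \<notin> periods q \<and> - u Ch + kahler_shift H p u j \<notin> periods q)"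

lemma kahler_shift_ell_lift:
  assumes "generic_data H" "is_basis H r" "p \<subseteq> {..<dim_n H}" "j < dim_n H"
  shows "kahler_shift H p (ell_lift H r u) j = kahler_shift H p u j"
  using ell_lift_props(2)[OF assms(1,2)] assms(3,4) by (intro kahler_shift_cong) auto

text \<open>On the component of \<open>p\<close> the roots are 0 on \<open>A_plus\<close> and
  \<open>- u Ch\<close> on \<open>A_minus\<close>, so every Kaehler quotient equals 1 and the
  normalisation remains.\<close>

lemma stable_envelope_diagonal:
  assumes q: "0 < norm q" "norm q < 1"
    and gen: "generic_data H" and p: "is_basis H p" and F: "elliptic_stable_envelope q H p F"
    and u: "u \<in> vec_space (params H)" "regular_at q H F (kproj H u)" "generic_params q H p u"
  shows "F (ell_lift H p u) = bundle_fun q H p (ell_lift H p u)"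
proof -
  define v where "v = ell_lift H p u"
  have pn: "p \<subseteq> {..<dim_n H}" by (rule is_basis_subset[OF p])
  have Ch: "v Ch = u Ch" unfolding v_def by (rule ell_lift_Ch[OF gen p])
  have x: "chern_root H v i = chern_at H p u i" if "i < dim_n H" for i
    unfolding v_def by (rule ell_lift_props(3)[OF gen p that])
  have y: "kahler_shift H p v j = kahler_shift H p u j" if "j < dim_n H" for j
    unfolding v_def by (rule kahler_shift_ell_lift[OF gen p pn that])
  have plus: "(\<Prod>j\<in>A_plus H p. theta q (chern_root H v j + kahler_shift H p v j) / theta q (kahler_shift H p v j)) = 1"
  proof (rule prod.neutral, rule ballI)
    fix j assume "j \<in> A_plus H p"
    then have j: "j \<in> compl H p" "j < dim_n H" "chern_at H p u j = 0"
      by (auto simp: A_plus_def compl_def chern_at_def)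
    then show "theta q (chern_root H v j + kahler_shift H p v j) / theta q (kahler_shift H p v j) = 1"
      using u(3) by (simp add: x y generic_params_def theta_eq_0_iff[OF q])
  qed
  have minus: "(\<Prod>j\<in>A_minus H p. theta q (chern_root H v j + kahler_shift H p v j) /
      theta q (- v Ch + kahler_shift H p v j)) = 1"
  proof (rule prod.neutral, rule ballI)
    fix j assume jm: "j \<in> A_minus H p"
    then have j: "j \<in> compl H p" "j < dim_n H" by (auto simp: A_minus_def compl_def)
    moreover have "chern_at H p u j = - u Ch"
      using chern_at_compl[OF gen p j(1), of u] jm unfolding A_minus_generic[OF gen p] by auto
    ultimately show "theta q (chern_root H v j + kahler_shift H p v j) / theta q (- v Ch + kahler_shift H p v j) = 1"
      using u(3) by (simp add: x y Ch generic_params_def theta_eq_0_iff[OF q])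
  qed
  have "F v = (\<Prod>i\<in>p_plus H p. theta q (u Ch + chern_at H p u i)) * (\<Prod>i\<in>p_minus H p. theta q (chern_at H p u i))"
    using F u(1,2) unfolding elliptic_stable_envelope_def restr_def v_def by blast
  also have "\<dots> = (\<Prod>i\<in>p_plus H p. theta q (v Ch + chern_root H v i)) * (\<Prod>i\<in>p_minus H p. theta q (chern_root H v i))"
    using pn by (intro arg_cong2[where f = "(*)"] prod.cong refl) (auto simp: x Ch p_plus_eq p_minus_eq)
  also have "\<dots> = bundle_fun q H p v"
    unfolding bundle_fun_eq plus minus by simp
  finally show ?thesis by (simp add: v_def)
qed

text \<open>Up to a constant independent of the vertex, this is the value of \<sigma> at the vertex;
  integrality and finiteness make it fit for induction.\<close>

definition sigma_height :: "hypertoric \<Rightarrow> nat set \<Rightarrow> int" where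
  "sigma_height H r = (\<Sum>l<dim_n H. sigma_lift H l * height H r l)"

lemma bundle_fun_eq_0_plus:
  assumes "i \<in> p_plus H p" "finite p" "theta q (u Ch + chern_root H u i) = 0"
  shows "bundle_fun q H p u = 0"
proof -
  have "(\<Prod>i\<in>p_plus H p. theta q (u Ch + chern_root H u i)) = 0"
    using assms by (intro prod_zero) (auto simp: p_plus_eq)
  then show ?thesis unfolding bundle_fun_eq by simp
qed

lemma bundle_fun_eq_0_minus:
  assumes "i \<in> p_minus H p" "finite p" "theta q (chern_root H u i) = 0"
  shows "bundle_fun q H p u = 0"
proof -
  have "(\<Prod>i\<in>p_minus H p. theta q (chern_root H u i)) = 0"
    using assms by (intro prod_zero) (auto simp: p_minus_eq)
  then show ?thesis unfolding bundle_fun_eq by simp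
qed

lemma theta_0 [simp]: "theta q 0 = 0"
  by (simp add: theta_def)

text \<open>
  An unbounded descending edge: the corresponding curve lies outside the full attracting set, and
  the edge leaves the cone of \<open>p\<close>, so both sides vanish there.
\<close>

lemma unbounded_edge:
  assumes gen: "generic_data H" and p: "is_basis H p" and r: "is_basis H r" and i: "i \<in> r"
    and F: "elliptic_stable_envelope q H p F"
    and \<epsilon>: "\<epsilon> = - sgn (slope H r i)"
    and unb: "\<And>j. j \<in> compl H r \<Longrightarrow> height H r j * (\<epsilon> * edge H r i j) \<ge> 0"
    and v: "v \<in> vec_space (coords H)" and reg: "regular_at q H F (kproj H v)"
    and root: "\<And>j. j \<in> compl H r \<Longrightarrow> chern_root H v j = (if height H r j > 0 then 0 else - v Ch)"
    and root_i: "chern_root H v i = (if \<epsilon> = 1 then 0 else - v Ch)"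
  shows "F v = 0" and "bundle_fun q H p v = 0"
proof -
  have rn: "r \<subseteq> {..<dim_n H}" by (rule is_basis_subset[OF r])
  have i_n: "i < dim_n H" using rn i by auto
  have slope: "slope H r i \<noteq> 0" using gen r i unfolding generic_data_def by blast
  then have \<epsilon>1: "\<epsilon> = 1 \<or> \<epsilon> = - 1" by (auto simp: \<epsilon> sgn_if)
  \<comment> \<open>The edge direction, oriented so that \<sigma> decreases along it.\<close>
  define \<delta> where "\<delta> j = \<epsilon> * edge H r i j" for j
  have \<delta>_row: "\<delta> \<in> row_space H"
  proof -
    have "(\<lambda>_. 0) \<in> row_space H"
      unfolding row_space_def by (intro CollectI exI[of _ "\<lambda>_. 0"]) simp
    from row_space_add[OF this edge_in_row_space[OF r i], of \<epsilon>] show ?thesis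
      by (simp add: \<delta>_def[abs_def])
  qed
  have \<delta>_slope: "(\<Sum>j<dim_n H. sigma_lift H j * \<delta> j) < 0"
  proof -
    have "(\<Sum>j<dim_n H. sigma_lift H j * \<delta> j) = \<epsilon> * slope H r i"
      unfolding edge_slope[OF r i, symmetric] \<delta>_def by (simp add: sum_distrib_left mult.left_commute)
    also have "\<dots> < 0" using slope by (auto simp: \<epsilon> sgn_if)
    finally show ?thesis .
  qed
  have \<delta>_r: "\<delta> j = (if j = i then \<epsilon> else 0)" if "j \<in> r" for j
    using that by (simp add: \<delta>_def edge_def)
  have hj: "height H r j \<noteq> 0" if "j \<in> compl H r" for j by (rule generic_height[OF gen r that])
  have pos: "height H r j > 0" if "j \<in> compl H r" "\<delta> j > 0" for j
    using unb[OF that(1)] hj[OF that(1)] that(2) by (simp add: \<delta>_def[symmetric] zero_le_mult_iff)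
  have neg: "height H r j < 0" if "j \<in> compl H r" "\<delta> j < 0" for j
    using unb[OF that(1)] hj[OF that(1)] that(2) by (simp add: \<delta>_def[symmetric] zero_le_mult_iff)
  show "F v = 0"
  proof -
    \<comment> \<open>A point of the curve: the coordinates of the vertex together with
      \<open>z_i\<close> or \<open>w_i\<close>, according to the side of hyperplane \<open>i\<close>
      on which the edge runs.\<close>
    define z :: "nat \<Rightarrow> complex" where
      "z j = (if (j \<in> compl H r \<and> height H r j > 0) \<or> (j = i \<and> \<epsilon> = 1) then 1 else 0)" for j
    define w :: "nat \<Rightarrow> complex" where
      "w j = (if (j \<in> compl H r \<and> height H r j < 0) \<or> (j = i \<and> \<epsilon> = - 1) then 1 else 0)" for j
    have ir: "i \<notin> compl H r" using i by (simp add: compl_def)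
    have edge: "edge_point H r (z, w)"
      unfolding edge_point_def
    proof (intro conjI ballI impI)
      show "fst (z, w) \<in> vec_space {..<dim_n H}" "snd (z, w) \<in> vec_space {..<dim_n H}"
        using i_n by (auto simp: vec_space_def z_def w_def compl_def)
      show "fst (z, w) j \<noteq> 0 \<longleftrightarrow> height H r j > 0" "snd (z, w) j \<noteq> 0 \<longleftrightarrow> height H r j < 0"
        if "j \<in> compl H r" for j using that ir by (auto simp: z_def w_def)
      show "fst (z, w) i' = 0 \<or> snd (z, w) i' = 0" if "i' \<in> r" for i'
        using that by (auto simp: z_def w_def compl_def)
      show "height H r j * edge H r i' j \<ge> 0" if "i' \<in> r" "j \<in> compl H r" "fst (z, w) i' \<noteq> 0" for i' j
        using that unb[OF that(2)] by (auto simp: z_def compl_def split: if_splits)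
      show "height H r j * edge H r i' j \<le> 0" if "i' \<in> r" "j \<in> compl H r" "snd (z, w) i' \<noteq> 0" for i' j
        using that unb[OF that(2)] by (auto simp: w_def compl_def split: if_splits)
    qed
    have st: "(z, w) \<in> stable H" by (rule edge_point_stable[OF gen r edge])
    have "monomial H \<delta> (z, w) \<noteq> 0"
    proof
      assume "monomial H \<delta> (z, w) = 0"
      then obtain j where "j < dim_n H" "(\<delta> j > 0 \<and> z j = 0) \<or> (\<delta> j < 0 \<and> w j = 0)"
        unfolding monomial_eq_0_iff by auto
      then show False
        using pos[of j] neg[of j] \<delta>_r[of j] \<epsilon>1 by (cases "j \<in> r") (auto simp: z_def w_def compl_def split: if_splits)
    qed
    then have "K_orbit H (z, w) \<in> points H - attr_full H p"
      using not_in_attr_full[OF gen p \<delta>_row \<delta>_slope st] st by (simp add: K_orbit_in_points)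
    moreover have "v \<in> ell_orbit q H (K_orbit H (z, w))"
    proof -
      have "(z' j \<noteq> 0 \<longrightarrow> chern_root H v j \<in> periods q) \<and> (w' j \<noteq> 0 \<longrightarrow> chern_root H v j + v Ch \<in> periods q)"
        if zw: "(z', w') \<in> K_orbit H (z, w)" for z' w' j
      proof -
        obtain g where "g \<in> K_torus H" "(z', w') = K_act H g (z, w)"
          using zw unfolding K_orbit_def by blast
        then have "z' j \<noteq> 0 \<Longrightarrow> z j \<noteq> 0" "w' j \<noteq> 0 \<Longrightarrow> w j \<noteq> 0" by (auto simp: K_act_eq)
        then show ?thesis
          using root[of j] root_i by (auto simp: z_def w_def split: if_splits)
      qed
      then show ?thesis using v unfolding ell_orbit_def by blast
    qed
    ultimately show "F v = 0"
      using F reg unfolding elliptic_stable_envelope_def supported_on_def by blast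
  qed
  show "bundle_fun q H p v = 0"
  proof -
    \<comment> \<open>The decrease of \<sigma> along \<delta>, expanded in slopes at
      \<open>p\<close>, must have a negative term. The sign of \<delta> at that index determines the
      root there, and the matching theta factor vanishes.\<close>
    have "(\<Sum>l\<in>p. slope H p l * \<delta> l) < 0"
      using \<delta>_slope unfolding row_space_slope[OF p \<delta>_row] .
    then obtain l where l: "l \<in> p" "slope H p l * \<delta> l < 0"
      using sum_nonneg[of p "\<lambda>l. slope H p l * \<delta> l"] by (meson not_le)
    have "\<delta> l \<noteq> 0" using l(2) by auto
    then have l_cases: "l = i \<or> l \<in> compl H r"
      using \<delta>_r[of l] is_basis_subset[OF p] l(1) by (auto simp: compl_def split: if_splits)
    have minus: "chern_root H v l = - v Ch" if "\<delta> l < 0"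
      using l_cases root[of l] root_i neg[of l] \<delta>_r[OF i] \<epsilon>1 that by auto
    have plus: "chern_root H v l = 0" if "\<delta> l > 0"
      using l_cases root[of l] root_i pos[of l] \<delta>_r[OF i] \<epsilon>1 that by auto
    have fin: "finite p" by (rule is_basis_finite[OF p])
    show ?thesis
    proof (cases "slope H p l > 0")
      case True
      then have "\<delta> l < 0" using l(2) by (simp add: mult_less_0_iff)
      then show ?thesis
        using bundle_fun_eq_0_plus[OF _ fin, of l H q v] minus True l(1) by (simp add: p_plus_eq)
    next
      case False
      then have "slope H p l < 0" "\<delta> l > 0" using l(2) by (auto simp: mult_less_0_iff)
      then show ?thesis
        using bundle_fun_eq_0_minus[OF _ fin, of l H q v] plus l(1) by (simp add: p_minus_eq)
    qed
  qed
qed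

text \<open>A bounded descending edge ends at the first hyperplane it meets, in a lower vertex.\<close>

lemma bounded_edge:
  assumes gen: "generic_data H" and r: "is_basis H r" and i: "i \<in> r"
    and \<epsilon>: "\<epsilon> = - sgn (slope H r i)"
    and bd: "j \<in> compl H r" "height H r j * (\<epsilon> * edge H r i j) < 0"
  obtains r2 where "is_basis H r2" "sigma_height H r2 < sigma_height H r"
    "\<And>l. l \<in> compl H r2 \<Longrightarrow> l \<noteq> i \<Longrightarrow> l \<in> compl H r \<and> sgn (height H r2 l) = sgn (height H r l)"
    "i \<in> compl H r2" "sgn (height H r2 i) = \<epsilon>"
proof -
  have rn: "r \<subseteq> {..<dim_n H}" by (rule is_basis_subset[OF r])
  have i_n: "i < dim_n H" using rn i by auto
  have slope: "slope H r i \<noteq> 0" using gen r i unfolding generic_data_def by blast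
  then have \<epsilon>1: "\<epsilon> = 1 \<or> \<epsilon> = - 1" by (auto simp: \<epsilon> sgn_if)
  define \<delta> where "\<delta> j = \<epsilon> * edge H r i j" for j
  \<comment> \<open>The hyperplanes that the edge approaches.\<close>
  define B where "B = {j \<in> compl H r. height H r j * \<delta> j < 0}"
  have "finite B" "B \<noteq> {}" using bd by (auto simp: B_def \<delta>_def)
  then obtain j0 where j0: "j0 \<in> B" and min: "\<And>j. j \<in> B \<Longrightarrow> \<bar>height H r j0\<bar> \<le> \<bar>height H r j\<bar>"
    using ex_min_if_finite[of "(\<lambda>j. \<bar>height H r j\<bar>) ` B"] by (force simp: not_less)
  \<comment> \<open>With unit steps, hyperplane \<open>j\<close> is reached after the absolute value
    of its height, so the minimal height belongs to the first one met.\<close>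
  have unit: "\<bar>\<delta> j\<bar> = 1" if "j \<in> B" for j
  proof -
    have "circ H r i j \<noteq> 0" "j \<in> compl H r" "j \<notin> r"
      using that by (auto simp: B_def \<delta>_def edge_def compl_def)
    then show ?thesis
      using pivot_circ_unit[OF gen r i, of j] \<epsilon>1 by (auto simp: \<delta>_def edge_def)
  qed
  have j0r: "j0 \<in> compl H r" "j0 \<notin> r" using j0 by (auto simp: B_def compl_def)
  define r2 where "r2 = insert j0 (r - {i})"
  have "circ H r i j0 \<noteq> 0" using j0 j0r by (auto simp: B_def \<delta>_def edge_def)
  then have r2: "is_basis H r2"
    using gen r i j0r unfolding generic_data_def r2_def by blast
  define s where "s = \<bar>height H r j0\<bar>"
  have s: "s > 0" using j0 by (auto simp: s_def B_def)
  have h2: "height H r2 l = height H r l + s * \<delta> l" if "l < dim_n H" for l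
  proof (rule height_unique[symmetric, OF r2 _ _ that])
    have "(\<lambda>j. (height H r j - theta_lift H j) + (s * \<epsilon>) * edge H r i j) \<in> row_space H"
      by (rule row_space_add[OF height_minus_theta_in_row_space[OF r] edge_in_row_space[OF r i]])
    then show "(\<lambda>j. height H r j + s * \<delta> j - theta_lift H j) \<in> row_space H"
      by (simp add: \<delta>_def algebra_simps)
    fix l assume l: "l \<in> r2"
    show "height H r l + s * \<delta> l = 0"
    proof (cases "l = j0")
      case True
      have "\<delta> j0 = 1 \<or> \<delta> j0 = - 1" using unit[OF j0] by linarith
      then show ?thesis using j0 True by (auto simp: B_def s_def abs_if mult_less_0_iff)
    next
      case False
      then show ?thesis using l by (auto simp: r2_def height_def \<delta>_def edge_def)
    qed
  qed
  have "sigma_height H r2 = sigma_height H r + s * (\<Sum>l<dim_n H. sigma_lift H l * \<delta> l)"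
    unfolding sigma_height_def using h2
    by (simp add: distrib_left sum.distrib sum_distrib_left mult.left_commute)
  moreover have "(\<Sum>l<dim_n H. sigma_lift H l * \<delta> l) = \<epsilon> * slope H r i"
    unfolding edge_slope[OF r i, symmetric] \<delta>_def by (simp add: sum_distrib_left mult.left_commute)
  moreover have "\<epsilon> * slope H r i < 0" using slope by (auto simp: \<epsilon> sgn_if)
  ultimately have sh: "sigma_height H r2 < sigma_height H r" using s by (simp add: mult_less_0_iff)
  have ic: "i \<in> compl H r2" using i i_n j0r by (auto simp: compl_def r2_def)
  have "sgn (height H r2 i) = \<epsilon>"
    using h2[OF i_n] i s \<epsilon>1 by (auto simp: height_def \<delta>_def edge_def sgn_mult)
  moreover have "l \<in> compl H r \<and> sgn (height H r2 l) = sgn (height H r l)"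
    if l: "l \<in> compl H r2" "l \<noteq> i" for l
  proof
    show lr: "l \<in> compl H r" using l by (auto simp: compl_def r2_def)
    have nz: "height H r2 l \<noteq> 0" "height H r l \<noteq> 0"
      using generic_height[OF gen] r r2 lr l(1) by auto
    have eq: "height H r2 l = height H r l + s * \<delta> l" using h2 lr by (simp add: compl_def)
    \<comment> \<open>No other hyperplane is crossed within distance \<open>s\<close>, and
      genericity rules out that one is met at exactly that distance.\<close>
    show "sgn (height H r2 l) = sgn (height H r l)"
    proof (cases "l \<in> B")
      case True
      then have "\<delta> l = 1 \<or> \<delta> l = - 1" "s \<le> \<bar>height H r l\<bar>" "height H r l * \<delta> l < 0"
        using unit[OF True] min[OF True] by (auto simp: s_def B_def)
      then show ?thesis using eq nz by (auto simp: sgn_if mult_less_0_iff)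
    next
      case False
      then have "height H r l * \<delta> l \<ge> 0" using lr by (simp add: B_def)
      moreover define t where "t = s * \<delta> l"
      have "\<delta> l \<ge> 0 \<Longrightarrow> t \<ge> 0" "\<delta> l \<le> 0 \<Longrightarrow> t \<le> 0"
        using s by (auto simp: t_def zero_le_mult_iff mult_le_0_iff)
      moreover have "height H r2 l = height H r l + t" using eq by (simp add: t_def)
      ultimately show ?thesis
        using nz by (auto simp: sgn_if zero_le_mult_iff)
    qed
  qed
  ultimately show ?thesis using that r2 sh ic by blast
qed

text \<open>The measure counts the bases of smaller \<open>sigma_height\<close>. A lowest vertex
  needs no separate base case: its descending edges are all unbounded.\<close>

theorem stable_envelope_eq_bundle_fun:
  assumes q: "0 < norm q" "norm q < 1"
    and gen: "generic_data H" and p: "is_basis H p" and F: "elliptic_stable_envelope q H p F"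
    and r: "is_basis H r"
    and u: "u \<in> vec_space (params H)" "regular_at q H F (kproj H u)" "generic_params q H p u"
  shows "F (ell_lift H r u) = bundle_fun q H p (ell_lift H r u)"
  using r u
proof (induction "card {r'. is_basis H r' \<and> sigma_height H r' < sigma_height H r}" arbitrary: r u
    rule: less_induct)
  case less
  note r = less.prems(1) and u = less.prems(2-4)
  show ?case
  proof (cases "r = p")
    case True
    then show ?thesis using stable_envelope_diagonal[OF q gen p F u] by simp
  next
    case False
    have rn: "r \<subseteq> {..<dim_n H}" and pn: "p \<subseteq> {..<dim_n H}"
      using is_basis_subset r p by auto
    have "\<not> r \<subseteq> p"
      using False is_basis_finite[OF p] is_basis_card[OF p] is_basis_card[OF r] card_subset_eq by metis
    then obtain i where i: "i \<in> r" "i \<notin> p" by blast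
    then have ip: "i \<in> compl H p" and i_n: "i < dim_n H" using rn by (auto simp: compl_def)
    define \<epsilon> where "\<epsilon> = - sgn (slope H r i)"
    have "slope H r i \<noteq> 0" using gen r i unfolding generic_data_def by blast
    then have \<epsilon>1: "\<epsilon> = 1 \<or> \<epsilon> = - 1" by (auto simp: \<epsilon>_def sgn_if)
    define v where "v = ell_lift H r u"
    \<comment> \<open>On the curve \<open>z_i\<close> is nonzero if \<epsilon> is 1, and
      \<open>w_i\<close> otherwise; \<rho> is the value which this forces on the root
      \<open>x_i\<close>.\<close>
    define \<rho> where "\<rho> = (if \<epsilon> = 1 then 0 else - u Ch)"
    define t0 where "t0 = \<rho> - (chern_root H v i - v (Ca i))"
    define v0 where "v0 = v(Ca i := t0)"
    have upd: "v(Ca i := t) = ell_lift H r (u(Ca i := t))" for t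
      unfolding v_def by (rule ell_lift_upd[OF gen r i(1), symmetric])
    have Ch: "v0 Ch = u Ch" unfolding v0_def v_def using ell_lift_Ch[OF gen r] by simp
    have kp: "kproj H v = kproj H u" unfolding v_def by (rule kproj_ell_lift[OF gen r])
    have kp0: "kproj H v0 = kproj H u" unfolding v0_def kproj_upd kp ..
    have v0_space: "v0 \<in> vec_space (coords H)"
      unfolding v0_def upd by (rule ell_lift_props(1)[OF gen r])
    have root_i: "chern_root H v0 i = \<rho>" by (simp add: v0_def chern_root_upd t0_def)
    have root: "chern_root H v0 j = (if height H r j > 0 then 0 else - v0 Ch)" if "j \<in> compl H r" for j
    proof -
      have "j < dim_n H" "j \<noteq> i" using that i by (auto simp: compl_def)
      then show ?thesis
        using ell_lift_props(3)[OF gen r, of j u] chern_at_compl[OF gen r that, of u] Ch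
        by (simp add: v0_def chern_root_upd v_def)
    qed
    have eq0: "F v0 = bundle_fun q H p v0"
    proof (cases "\<exists>j\<in>compl H r. height H r j * (\<epsilon> * edge H r i j) < 0")
      case False
      have "F v0 = 0" "bundle_fun q H p v0 = 0"
        using unbounded_edge[OF gen p r i(1) F \<epsilon>_def _ v0_space _ root] False u(2) kp0 root_i Ch
        by (auto simp: \<rho>_def not_less)
      then show ?thesis by simp
    next
      case True
      then obtain r2 where r2: "is_basis H r2" and lower: "sigma_height H r2 < sigma_height H r"
        and sgn2: "\<And>l. l \<in> compl H r2 \<Longrightarrow> l \<noteq> i \<Longrightarrow> l \<in> compl H r \<and> sgn (height H r2 l) = sgn (height H r l)"
        and i2: "i \<in> compl H r2" "sgn (height H r2 i) = \<epsilon>"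
        using bounded_edge[OF gen r i(1) \<epsilon>_def] by blast
      define u0 where "u0 = u(Ca i := t0)"
      \<comment> \<open>The same point seen from the other end of the edge: the heights keep their
        signs off \<open>r\<close> and the root \<open>x_i\<close> was set according to \<epsilon>,
        so the roots off \<open>r2\<close> are those of that component.\<close>
      have "v0 = ell_lift H r2 u0"
      proof (rule ell_lift_eqI[symmetric, OF gen r2 v0_space])
        show "v0 c = u0 c" if "c \<in> params H" for c
          using ell_lift_props(2)[OF gen r that, of u] by (simp add: v0_def u0_def v_def)
        show "chern_root H v0 j = chern_at H r2 v0 j" if j: "j \<in> compl H r2" for j
        proof (cases "j = i")
          case True
          have "height H r2 i > 0 \<longleftrightarrow> \<epsilon> = 1" using i2(2) \<epsilon>1 by (auto simp: sgn_if split: if_splits)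
          then show ?thesis
            using True root_i Ch by (simp add: chern_at_compl[OF gen r2 i2(1)] \<rho>_def)
        next
          case False
          have "height H r2 j > 0 \<longleftrightarrow> height H r j > 0"
            using sgn2[OF j False] by (metis sgn_greater)
          then show ?thesis
            using root[of j] sgn2[OF j False] by (simp add: chern_at_compl[OF gen r2 j])
        qed
      qed
      moreover have "F (ell_lift H r2 u0) = bundle_fun q H p (ell_lift H r2 u0)"
      proof (rule less.hyps[OF _ r2])
        show "card {r'. is_basis H r' \<and> sigma_height H r' < sigma_height H r2}
            < card {r'. is_basis H r' \<and> sigma_height H r' < sigma_height H r}"
        proof (rule psubset_card_mono)
          have "{r'. is_basis H r' \<and> sigma_height H r' < sigma_height H r} \<subseteq> Pow {..<dim_n H}"
            using is_basis_subset by blast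
          then show "finite {r'. is_basis H r' \<and> sigma_height H r' < sigma_height H r}"
            by (rule finite_subset) simp
          show "{r'. is_basis H r' \<and> sigma_height H r' < sigma_height H r2}
              \<subset> {r'. is_basis H r' \<and> sigma_height H r' < sigma_height H r}"
            using lower r2 by auto
        qed
        \<comment> \<open>\<open>a_i\<close> is neither a pole coordinate nor part of a Kaehler
          shift, so regularity and genericity pass to the moved parameters.\<close>
        show "u0 \<in> vec_space (params H)" unfolding u0_def by (rule params_upd[OF i_n u(1)])
        show "regular_at q H F (kproj H u0)" unfolding u0_def kproj_upd by (rule u(2))
        show "generic_params q H p u0"
          using u(3) by (simp add: u0_def generic_params_def kahler_shift_upd)
      qed
      ultimately show ?thesis by simp
    qed
    then have eq: "F (v(Ca i := t0)) = bundle_fun q H p (v(Ca i := t0))"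
      unfolding v0_def .
    \<comment> \<open>At the meeting point the theta argument is the Kaehler shift or its translate
      by \<open>- u Ch\<close>, and \<open>generic_params\<close> excludes both from the
      periods.\<close>
    have np: "chern_root H (v(Ca i := t0)) i + kahler_shift H p v i \<notin> periods q"
      unfolding v0_def[symmetric]
      using u(3) ip root_i kahler_shift_ell_lift[OF gen r pn i_n, of u]
      by (auto simp: generic_params_def \<rho>_def v_def)
    have sqp: "same_quasi_periods q H (bundle_fun q H p) F"
      using F by (simp add: elliptic_stable_envelope_def bundle_section_def)
    have ell: "v(Ca i := t) \<in> ell q H" for t unfolding upd by (rule ell_lift_in_ell[OF gen r])
    have "regular_at q H F (kproj H v)" using u(2) kp by simp
    from bundle_section_step[OF q gen p ip sqp this ell eq np] show ?thesis by (simp add: v_def)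
  qed
qed

section \<open>Comparison with the mirror\<close>

lemma holo_on_quotient:
  assumes G: "holo_on (coords H) W G" and g: "holo_on (kcoords H) V g"
  shows "holo_on (coords H) {u \<in> W. kproj H u \<in> V \<and> g (kproj H u) \<noteq> 0} (\<lambda>u. G u / g (kproj H u))"
    (is "holo_on _ ?W _")
  unfolding holo_on_def
proof (intro conjI ballI)
  have Wo: "openin (top_of_set (vec_space (coords H))) W" and Gc: "continuous_on W G"
    and Gd: "\<And>u i. u \<in> W \<Longrightarrow> i \<in> coords H \<Longrightarrow> (\<lambda>t. G (u(i := t))) field_differentiable (at (u i))"
    using G unfolding holo_on_def by blast+
  have Vo: "openin (top_of_set (vec_space (kcoords H))) V" and gc: "continuous_on V g"
    and gd: "\<And>c i. c \<in> V \<Longrightarrow> i \<in> kcoords H \<Longrightarrow> (\<lambda>t. g (c(i := t))) field_differentiable (at (c i))"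
    using g unfolding holo_on_def by blast+
  have Wsub: "W \<subseteq> vec_space (coords H)" using openin_subset[OF Wo] by simp
  have kc: "continuous_on S (kproj H)" for S
    using kproj_continuous[OF continuous_on_id, of S H] by simp
  have "openin (top_of_set V) (V \<inter> g -` (- {0}))"
    by (rule continuous_openin_preimage_gen[OF gc]) (simp add: open_Compl)
  then have Vnz: "openin (top_of_set (vec_space (kcoords H))) (V \<inter> g -` (- {0}))"
    using Vo openin_trans by blast
  have "openin (top_of_set W) (W \<inter> kproj H -` (V \<inter> g -` (- {0})))"
    by (rule continuous_openin_preimage[OF kc _ Vnz]) (auto simp: kproj_def vec_space_def)
  then have "openin (top_of_set (vec_space (coords H))) (W \<inter> kproj H -` (V \<inter> g -` (- {0})))"
    using Wo openin_trans by blast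
  moreover have "W \<inter> kproj H -` (V \<inter> g -` (- {0})) = ?W" by auto
  ultimately show "openin (top_of_set (vec_space (coords H))) ?W" by simp
  show "continuous_on ?W (\<lambda>u. G u / g (kproj H u))"
  proof (rule continuous_on_divide)
    show "continuous_on ?W G" by (rule continuous_on_subset[OF Gc]) auto
    show "continuous_on ?W (\<lambda>u. g (kproj H u))"
      by (rule continuous_on_compose2[OF gc kc]) auto
  qed auto
  fix u i assume u: "u \<in> ?W" and i: "i \<in> coords H"
  have "(\<lambda>t. g (kproj H (u(i := t)))) field_differentiable (at (u i))"
  proof (cases "i \<in> kcoords H")
    case True
    then have "kproj H (u(i := t)) = (kproj H u)(i := t)" "kproj H u i = u i" for t
      by (auto simp: kproj_def)
    then show ?thesis using gd[of "kproj H u" i] u True by simp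
  next
    case False
    then have "kproj H (u(i := t)) = kproj H u" for t by (auto simp: kproj_def)
    then show ?thesis by simp
  qed
  then show "(\<lambda>t. G (u(i := t)) / g (kproj H (u(i := t)))) field_differentiable (at (u i))"
    using u Gd[OF _ i, of u] by (intro field_differentiable_divide) auto
qed

text \<open>Where the local denominator is nonzero the function is locally a holomorphic quotient,
  hence regular, and such points are dense by the definition of meromorphy.\<close>

lemma mero_regular_dense:
  assumes mero: "mero_on_ell q H F" and W: "openin (top_of_set (vec_space (params H))) W" "u0 \<in> W"
  shows "\<exists>u\<in>W. regular_at q H F (kproj H u)"
proof -
  have u0: "u0 \<in> vec_space (params H)" using openin_subset[OF W(1)] W(2) by auto
  have k0: "kproj H u0 \<in> vec_space (kcoords H)" by (simp add: kproj_def vec_space_def)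
  obtain V g G where V: "kproj H u0 \<in> V" "holo_on (kcoords H) V g"
    and dense: "\<forall>V'. openin (top_of_set (vec_space (kcoords H))) V' \<and> V' \<subseteq> V \<and> V' \<noteq> {} \<longrightarrow> (\<exists>c'\<in>V'. g c' \<noteq> 0)"
    and G: "holo_on_ell q H V G"
    and FG: "\<forall>u\<in>ell q H. kproj H u \<in> V \<and> g (kproj H u) \<noteq> 0 \<longrightarrow> g (kproj H u) * F u = G u"
    using bspec[OF mero[unfolded mero_on_ell_def] k0] by (elim exE conjE) (rule that)
  have Vo: "openin (top_of_set (vec_space (kcoords H))) V" using V(2) unfolding holo_on_def by blast
  \<comment> \<open>Only \<open>hbar\<close> and the Kaehler parameters have to move; the
    equivariant ones stay those of \<open>u0\<close>.\<close>
  define join where "join c = (\<lambda>x. if x \<in> kcoords H then c x else u0 x)" for c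
  have join_params: "join c \<in> vec_space (params H)" for c
    using u0 by (auto simp: join_def vec_space_def params_def)
  have "continuous_on (vec_space (kcoords H)) join"
    unfolding join_def[abs_def]
  proof (rule continuous_on_coordinatewise_then_product)
    fix x
    show "continuous_on (vec_space (kcoords H)) (\<lambda>c. if x \<in> kcoords H then c x else u0 x)"
      by (cases "x \<in> kcoords H") (auto intro: continuous_on_product_then_coordinatewise continuous_on_id)
  qed
  then have "openin (top_of_set (vec_space (kcoords H))) (vec_space (kcoords H) \<inter> join -` W)"
    by (rule continuous_openin_preimage[OF _ _ W(1)]) (use join_params in auto)
  then have V'o: "openin (top_of_set (vec_space (kcoords H))) (V \<inter> (vec_space (kcoords H) \<inter> join -` W))"
    using Vo by blast
  have "join (kproj H u0) = u0" by (auto simp: join_def kproj_def)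
  then have "kproj H u0 \<in> V \<inter> (vec_space (kcoords H) \<inter> join -` W)" using V(1) k0 W(2) by simp
  then obtain c where c: "c \<in> V" "c \<in> vec_space (kcoords H)" "join c \<in> W" "g c \<noteq> 0"
    using dense V'o by blast
  have kj: "kproj H (join c) = c" using c(2) by (auto simp: kproj_def join_def vec_space_def)
  have "regular_at q H F c"
    unfolding regular_at_def
  proof (intro exI conjI)
    have "openin (top_of_set V) (V \<inter> g -` (- {0}))"
      using V(2) unfolding holo_on_def by (intro continuous_openin_preimage_gen) (auto simp: open_Compl)
    then show "openin (top_of_set (vec_space (kcoords H))) (V \<inter> g -` (- {0}))"
      using Vo openin_trans by blast
    show "c \<in> V \<inter> g -` (- {0})" using c by simp
    show "holo_on_ell q H (V \<inter> g -` (- {0})) F"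
      unfolding holo_on_ell_def
    proof (intro ballI impI)
      fix u assume u: "u \<in> ell q H" "kproj H u \<in> V \<inter> g -` (- {0})"
      then obtain W' G' where W': "u \<in> W'" "holo_on (coords H) W' G'" "\<forall>v\<in>W' \<inter> ell q H. G v = G' v"
        using G unfolding holo_on_ell_def by blast
      have "u \<in> {u \<in> W'. kproj H u \<in> V \<and> g (kproj H u) \<noteq> 0}" using u W'(1) by simp
      moreover have "F v = G' v / g (kproj H v)"
        if "v \<in> {u \<in> W'. kproj H u \<in> V \<and> g (kproj H u) \<noteq> 0} \<inter> ell q H" for v
        using that FG W'(3) by (auto simp: field_simps)
      ultimately show "\<exists>W G. u \<in> W \<and> holo_on (coords H) W G \<and> (\<forall>v\<in>W \<inter> ell q H. F v = G v)"
        by (intro exI[of _ "{u \<in> W'. kproj H u \<in> V \<and> g (kproj H u) \<noteq> 0}"]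
            exI[of _ "\<lambda>u. G' u / g (kproj H u)"] conjI ballI holo_on_quotient[OF W'(2) V(2)])
    qed
  qed
  then show ?thesis using c(3) kj by metis
qed

lemma regular_params_openin:
  "openin (top_of_set (vec_space (params H))) {u \<in> vec_space (params H). regular_at q H F (kproj H u)}"
proof -
  define U where "U = \<Union>{V. openin (top_of_set (vec_space (kcoords H))) V \<and> holo_on_ell q H V F}"
  have "openin (top_of_set (vec_space (kcoords H))) U" unfolding U_def by (rule openin_Union) auto
  then have "openin (top_of_set (vec_space (params H))) (vec_space (params H) \<inter> kproj H -` U)"
    using kproj_continuous[OF continuous_on_id, of _ H]
    by (intro continuous_openin_preimage) (auto simp: kproj_def vec_space_def)
  moreover have "regular_at q H F (kproj H u) \<longleftrightarrow> kproj H u \<in> U" for u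
    unfolding regular_at_def U_def by blast
  then have "{u \<in> vec_space (params H). regular_at q H F (kproj H u)} = vec_space (params H) \<inter> kproj H -` U"
    by auto
  ultimately show ?thesis by simp
qed

section \<open>Exchange of parameters and the factorwise identity\<close>

lemma mirror_coord_sets [simp]: "kcoords (mirror H) = kcoords H" "params (mirror H) = params H"
  by (simp_all add: kcoords_def params_def)

lemma mirror_params_simps [simp]:
  "mirror_params u (Ca i) = u (Cz i)" "mirror_params u Ch = - u Ch" "mirror_params u (Cz i) = u (Ca i)"
  "mirror_params u (Cs l) = 0"
  by (simp_all add: mirror_params_def)

lemma mirror_params_affine:
  "mirror_params (\<lambda>c. u c + t * d c) = (\<lambda>c. mirror_params u c + t * mirror_params d c)"
  by (auto simp: mirror_params_def split: coord.split)

lemma mirror_params_params: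
  assumes "u \<in> vec_space (params H)"
  shows "mirror_params u \<in> vec_space (params H)"
proof -
  have "mirror_params u c = 0" if "c \<notin> params H" for c
    using assms that by (cases c) (auto simp: vec_space_def params_def kcoords_def)
  then show ?thesis by (simp add: vec_space_def)
qed

lemma mirror_params_involution:
  assumes "u \<in> vec_space (params H)"
  shows "mirror_params (mirror_params u) = u"
proof
  fix c
  show "mirror_params (mirror_params u) c = u c"
    using assms by (cases c) (auto simp: vec_space_def params_def kcoords_def)
qed

lemma mirror_params_continuous: "continuous_on S mirror_params"
proof -
  have "continuous_on S (\<lambda>u. mirror_params u c)" for c
  proof -
    have "continuous_on S (\<lambda>u. u c' :: complex)" for c' :: coord
      by (rule continuous_on_product_then_coordinatewise[OF continuous_on_id])
    then show ?thesis by (cases c) (auto intro!: continuous_intros)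
  qed
  then show ?thesis by (rule continuous_on_coordinatewise_then_product)
qed

lemma mirror_preimage_openin:
  assumes "openin (top_of_set (vec_space (params H))) W"
  shows "openin (top_of_set (vec_space (params H))) (vec_space (params H) \<inter> mirror_params -` W)"
  by (rule continuous_openin_preimage[OF mirror_params_continuous _ assms])
    (auto intro: mirror_params_params)

lemma A_plus_mirror:
  assumes "generic_data H" "is_basis H p"
  shows "A_plus (mirror H) (compl H p) = p_minus H p" "A_minus (mirror H) (compl H p) = p_plus H p"
  unfolding A_plus_generic[OF generic_data_mirror[OF assms(1)] is_basis_mirror[OF assms(2)]]
    A_minus_generic[OF generic_data_mirror[OF assms(1)] is_basis_mirror[OF assms(2)]]
    p_plus_eq p_minus_eq
  using height_mirror[OF assms(2)] compl_compl[OF is_basis_subset[OF assms(2)]] by auto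

text \<open>\<open>A_minus\<close> of the mirror is \<open>p_plus\<close>, and the sign of the
  circuit matrix combines with that of \<open>hbar\<close>; the correction by \<open>hbar\<close> in
  the root becomes the shift in the Kaehler argument.\<close>

lemma chern_at_mirror:
  assumes "generic_data H" "is_basis H p" "j \<in> compl H p"
  shows "chern_at (mirror H) (compl H p) (mirror_params u) j = kahler_shift H p u j"
proof -
  have pn: "p \<subseteq> {..<dim_n H}" by (rule is_basis_subset[OF assms(2)])
  have circ: "circ (mirror H) (compl H p) j i = - circ H p i j" if "i \<in> p" for i
    by (rule circ_mirror[OF assms(2) that assms(3)])
  have "j \<notin> p" using assms(3) by (simp add: compl_def)
  then have "j \<notin> p_minus H p" "j \<notin> p_plus H p" by (auto simp: p_plus_eq p_minus_eq)
  moreover have "(\<Sum>i\<in>p_plus H p. of_int (circ (mirror H) (compl H p) j i)) = (\<Sum>i\<in>p_plus H p. - of_int (circ H p i j) :: complex)"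
    using circ by (intro sum.cong) (auto simp: p_plus_eq)
  moreover have "(\<Sum>i\<in>p. of_int (circ (mirror H) (compl H p) j i) * u (Cz i)) = (\<Sum>i\<in>p. - of_int (circ H p i j) * u (Cz i))"
    using circ by (intro sum.cong) auto
  ultimately show ?thesis
    unfolding chern_at_def A_plus_mirror[OF assms(1,2)] kahler_shift_def kahler_at_def
    by (simp add: compl_compl[OF pn] sum_negf)
qed

text \<open>\<open>chern_at_mirror\<close> applied to the mirror; the parameter exchange is an
  involution on everything that \<open>chern_at\<close> reads.\<close>

lemma kahler_shift_mirror:
  assumes "generic_data H" "is_basis H r" "i \<in> r"
  shows "kahler_shift (mirror H) (compl H r) (mirror_params u) i = chern_at H r u i"
proof -
  have rn: "r \<subseteq> {..<dim_n H}" by (rule is_basis_subset[OF assms(2)])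
  have "chern_at (mirror (mirror H)) (compl (mirror H) (compl H r)) (mirror_params (mirror_params u)) i
      = kahler_shift (mirror H) (compl H r) (mirror_params u) i"
    by (rule chern_at_mirror[OF generic_data_mirror[OF assms(1)] is_basis_mirror[OF assms(2)]])
      (simp add: compl_compl[OF rn] assms(3))
  moreover have "chern_at H r (mirror_params (mirror_params u)) i = chern_at H r u i"
    by (simp add: chern_at_def)
  ultimately show ?thesis by (simp add: mirror_mirror compl_compl[OF rn])
qed

text \<open>
  The factor of index \<open>i\<close> in \<open>bundle_fun\<close>: each index contributes exactly one. Mirror symmetry
  already holds for the individual factors.
\<close>

definition bundle_factor ::
  "complex \<Rightarrow> hypertoric \<Rightarrow> nat set \<Rightarrow> complex \<Rightarrow> (nat \<Rightarrow> complex) \<Rightarrow> (nat \<Rightarrow> complex) \<Rightarrow> nat \<Rightarrow> complex" where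
  "bundle_factor q H p h x y i =
     (if i \<in> p then (if slope H p i > 0 then theta q (h + x i) else theta q (x i))
      else (if height H p i > 0 then theta q (x i + y i) / theta q (y i)
            else theta q (x i + y i) / theta q (- h + y i)))"

definition diagonal_factor ::
  "complex \<Rightarrow> hypertoric \<Rightarrow> nat set \<Rightarrow> complex \<Rightarrow> (nat \<Rightarrow> complex) \<Rightarrow> nat \<Rightarrow> complex" where
  "diagonal_factor q H p h x i =
     (if i \<in> p then (if slope H p i > 0 then theta q (h + x i) else theta q (x i)) else 1)"

lemma prod_disjoint_union:
  fixes f :: "'a \<Rightarrow> 'b::comm_monoid_mult"
  assumes "finite C" "A \<union> B = C" "A \<inter> B = {}" "\<And>a. a \<in> A \<Longrightarrow> f a = g a" "\<And>b. b \<in> B \<Longrightarrow> f b = h b"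
  shows "(\<Prod>c\<in>C. f c) = (\<Prod>a\<in>A. g a) * (\<Prod>b\<in>B. h b)"
proof -
  have fin: "finite A" "finite B" using assms(1,2) by auto
  have "(\<Prod>c\<in>C. f c) = (\<Prod>a\<in>A. f a) * (\<Prod>b\<in>B. f b)"
    unfolding assms(2)[symmetric] by (rule prod.union_disjoint[OF fin assms(3)])
  also have "(\<Prod>a\<in>A. f a) = (\<Prod>a\<in>A. g a)" using assms(4) by (rule prod.cong[OF refl])
  also have "(\<Prod>b\<in>B. f b) = (\<Prod>b\<in>B. h b)" using assms(5) by (rule prod.cong[OF refl])
  finally show ?thesis .
qed

lemma basis_products:
  assumes gen: "generic_data H" and p: "is_basis H p"
  shows "(\<Prod>i<dim_n H. diagonal_factor q H p h x i) =
      (\<Prod>i\<in>p_plus H p. theta q (h + x i)) * (\<Prod>i\<in>p_minus H p. theta q (x i))" (is ?D)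
    and "(\<Prod>i<dim_n H. bundle_factor q H p h x y i) =
      (\<Prod>i\<in>p_plus H p. theta q (h + x i)) * (\<Prod>i\<in>p_minus H p. theta q (x i)) *
      (\<Prod>j\<in>A_plus H p. theta q (x j + y j) / theta q (y j)) *
      (\<Prod>j\<in>A_minus H p. theta q (x j + y j) / theta q (- h + y j))" (is ?B)
proof -
  have pn: "p \<subseteq> {..<dim_n H}" and fin: "finite p"
    using is_basis_subset[OF p] is_basis_finite[OF p] by auto
  have slope: "slope H p i \<noteq> 0" if "i \<in> p" for i using gen p that unfolding generic_data_def by blast
  have "(\<Prod>i\<in>p. if slope H p i > 0 then theta q (h + x i) else theta q (x i))
      = (\<Prod>i\<in>p_plus H p. theta q (h + x i)) * (\<Prod>i\<in>p_minus H p. theta q (x i))"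
    by (rule prod_disjoint_union[OF fin]) (use slope in \<open>auto simp: p_plus_eq p_minus_eq neq_iff\<close>)
  moreover have "(\<Prod>j\<in>compl H p. if height H p j > 0 then theta q (x j + y j) / theta q (y j)
            else theta q (x j + y j) / theta q (- h + y j))
      = (\<Prod>j\<in>A_plus H p. theta q (x j + y j) / theta q (y j)) *
        (\<Prod>j\<in>A_minus H p. theta q (x j + y j) / theta q (- h + y j))"
    by (rule prod_disjoint_union[OF finite_compl])
      (use generic_height[OF gen p] in \<open>auto simp: A_plus_generic[OF gen p] A_minus_generic[OF gen p] neq_iff\<close>)
  moreover have "j \<notin> p" if "j \<in> compl H p" for j using that by (simp add: compl_def)
  ultimately show ?D ?B
    unfolding prod_split_compl[OF pn] diagonal_factor_def bundle_factor_def by (simp_all cong: prod.cong)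
qed

lemma bundle_fun_ell_lift:
  assumes gen: "generic_data H" and p: "is_basis H p" and r: "is_basis H r"
  shows "bundle_fun q H p (ell_lift H r u) =
    (\<Prod>i<dim_n H. bundle_factor q H p (u Ch) (chern_at H r u) (kahler_shift H p u) i)"
proof -
  have pn: "p \<subseteq> {..<dim_n H}" by (rule is_basis_subset[OF p])
  have "bundle_fun q H p (ell_lift H r u) = (\<Prod>i<dim_n H. bundle_factor q H p (ell_lift H r u Ch)
      (chern_root H (ell_lift H r u)) (kahler_shift H p (ell_lift H r u)) i)"
    unfolding bundle_fun_eq basis_products(2)[OF gen p] ..
  also have "\<dots> = (\<Prod>i<dim_n H. bundle_factor q H p (u Ch) (chern_at H r u) (kahler_shift H p u) i)"
    using ell_lift_Ch[OF gen r] ell_lift_props(3)[OF gen r] kahler_shift_ell_lift[OF gen r pn]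
    by (intro prod.cong refl) (simp add: bundle_factor_def)
  finally show ?thesis .
qed

text \<open>Four cases. For \<open>i\<close> in \<open>r\<close> only, both sides are one quotient
  with the root and the Kaehler argument exchanged. For \<open>i\<close> in \<open>p\<close> only,
  both are theta at 0, \<open>hbar\<close> or \<open>- hbar\<close> (in logarithmic form). For
  \<open>i\<close> in both or in neither, the Kaehler quotient of one side is the quotient of the
  two torus factors of the other.\<close>

lemma mirror_factor_identity:
  assumes gen: "generic_data H" and p: "is_basis H p" and r: "is_basis H r" and i: "i < dim_n H"
  shows "bundle_factor q H p (u Ch) (chern_at H r u) (kahler_shift H p u) i /
      diagonal_factor q H r (u Ch) (chern_at H r u) i
    = bundle_factor q (mirror H) (compl H r) (- u Ch) (chern_at (mirror H) (compl H p) (mirror_params u))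
        (kahler_shift (mirror H) (compl H r) (mirror_params u)) i /
      diagonal_factor q (mirror H) (compl H p) (- u Ch)
        (chern_at (mirror H) (compl H p) (mirror_params u)) i"
proof -
  have gen': "generic_data (mirror H)" by (rule generic_data_mirror[OF gen])
  have pn: "p \<subseteq> {..<dim_n H}" and rn: "r \<subseteq> {..<dim_n H}" using is_basis_subset p r by auto
  have basis': "is_basis (mirror H) (compl H p)" by (rule is_basis_mirror[OF p])
  define x where "x = chern_at H r u i"
  define y where "y = kahler_shift H p u i"
  define x' where "x' = chern_at (mirror H) (compl H p) (mirror_params u) i"
  define y' where "y' = kahler_shift (mirror H) (compl H r) (mirror_params u) i"
  have slope: "slope H s j > 0 \<longleftrightarrow> \<not> slope H s j < 0" if "is_basis H s" "j \<in> s" for s j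
    using gen that unfolding generic_data_def by (metis linorder_neqE_linordered_idom less_asym)
  have height: "height H s j > 0 \<longleftrightarrow> \<not> height H s j < 0" if "is_basis H s" "j \<in> compl H s" for s j
    using generic_height[OF gen that] by linarith
  have mem: "i \<in> compl H s \<longleftrightarrow> i \<notin> s" for s using i by (simp add: compl_def)
  have x: "x = (if height H r i > 0 then 0 else - u Ch)" if "i \<notin> r"
    using chern_at_compl[OF gen r] that mem by (simp add: x_def)
  have x': "x' = (if slope H p i < 0 then 0 else u Ch)" if "i \<in> p"
    using chern_at_compl[OF gen' basis', of i "mirror_params u"] that compl_compl[OF pn]
      height_mirror[OF p that] by (simp add: x'_def)
  have x'_y: "x' = y" if "i \<notin> p"
    using chern_at_mirror[OF gen p] that mem by (simp add: x'_def y_def)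
  have y'_x: "y' = x" if "i \<in> r"
    using kahler_shift_mirror[OF gen r that] by (simp add: y'_def x_def)
  have slope': "slope (mirror H) (compl H s) i > 0 \<longleftrightarrow> height H s i < 0" if "is_basis H s" "i \<notin> s" for s
    using slope_mirror[OF that(1)] that(2) mem by simp
  have height': "height (mirror H) (compl H s) i > 0 \<longleftrightarrow> slope H s i < 0" if "is_basis H s" "i \<in> s" for s
    using height_mirror[OF that] by simp
  show ?thesis
    unfolding bundle_factor_def diagonal_factor_def mem
      x_def[symmetric] y_def[symmetric] x'_def[symmetric] y'_def[symmetric]
    using x x' x'_y y'_x slope'[OF p] slope'[OF r] height'[OF r] slope[OF p] slope[OF r]
      height[OF p] height[OF r] mem
    by (cases "i \<in> p"; cases "i \<in> r") (auto simp: add.commute)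
qed

section \<open>Restrictions along complex lines\<close>

text \<open>The equations of the lift are linear, so a line of parameters lifts to a line on one
  lift of the component, where continuity on \<open>ell\<close> applies.\<close>

lemma ell_lift_affine:
  assumes gen: "generic_data H" and r: "is_basis H r"
  shows "ell_lift H r (\<lambda>c. u c + t * d c) = (\<lambda>c. ell_lift H r u c + t * ell_lift H r d c)"
proof (rule ell_lift_eqI[OF gen r])
  show "(\<lambda>c. ell_lift H r u c + t * ell_lift H r d c) \<in> vec_space (coords H)"
    using ell_lift_props(1)[OF gen r, of u] ell_lift_props(1)[OF gen r, of d] by (simp add: vec_space_def)
  show "ell_lift H r u c + t * ell_lift H r d c = u c + t * d c" if "c \<in> params H" for c
    using ell_lift_props(2)[OF gen r that] by simp
  fix j assume "j \<in> compl H r"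
  then have jn: "j < dim_n H" by (simp add: compl_def)
  show "chern_root H (\<lambda>c. ell_lift H r u c + t * ell_lift H r d c) j
      = chern_at H r (\<lambda>c. ell_lift H r u c + t * ell_lift H r d c) j"
    unfolding chern_root_affine chern_at_affine ell_lift_props(3)[OF gen r jn]
    using chern_at_cong[OF ell_lift_props(2)[OF gen r] jn] by simp
qed

lemma restr_affine_isCont:
  assumes gen: "generic_data H" and r: "is_basis H r" and reg: "regular_at q H F (kproj H u)"
  shows "isCont (\<lambda>t. restr H F r (\<lambda>c. u c + t * d c)) 0"
proof -
  have "isCont (\<lambda>t. F (\<lambda>c. ell_lift H r u c + t * ell_lift H r d c)) 0"
  proof (rule regular_path_isCont[OF continuous_on_affine_path])
    show "(\<lambda>c. ell_lift H r u c + t * ell_lift H r d c) \<in> ell q H" for t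
      unfolding ell_lift_affine[OF gen r, symmetric] by (rule ell_lift_in_ell[OF gen r])
    show "regular_at q H F (kproj H (\<lambda>c. ell_lift H r u c + 0 * ell_lift H r d c))"
      using reg by (simp add: kproj_ell_lift[OF gen r])
  qed
  then show ?thesis unfolding restr_def ell_lift_affine[OF gen r] .
qed

lemma restr_diagonal:
  assumes gen: "generic_data H" and r: "is_basis H r" and F: "elliptic_stable_envelope q H r F"
    and u: "u \<in> vec_space (params H)" "regular_at q H F (kproj H u)"
  shows "restr H F r u = (\<Prod>i<dim_n H. diagonal_factor q H r (u Ch) (chern_at H r u) i)"
  using F u unfolding elliptic_stable_envelope_def basis_products(1)[OF gen r] by blast

lemma countable_not_generic_params:
  shows "countable {t. \<not> generic_params q H p (\<lambda>c. u c + t * generic_direction H r (compl H p) c)}"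
proof -
  define d where "d = generic_direction H r (compl H p)"
  have Ch: "d Ch = 0" by (simp add: d_def generic_direction_def)
  have y: "kahler_shift H p (\<lambda>c. u c + t * d c) j = kahler_shift H p u j + t * 1" if "j \<in> compl H p" for j t
    unfolding kahler_shift_affine d_def generic_direction_kahler_shift[OF that] ..
  have "{t. \<not> generic_params q H p (\<lambda>c. u c + t * d c)} \<subseteq>
      (\<Union>j\<in>compl H p. {t. kahler_shift H p u j + t * 1 \<in> periods q} \<union>
        {t. (- u Ch + kahler_shift H p u j) + t * 1 \<in> periods q})"
  proof
    fix t assume "t \<in> {t. \<not> generic_params q H p (\<lambda>c. u c + t * d c)}"
    then obtain j where j: "j \<in> compl H p" "kahler_shift H p (\<lambda>c. u c + t * d c) j \<in> periods q \<or>
        - u Ch + kahler_shift H p (\<lambda>c. u c + t * d c) j \<in> periods q"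
      by (auto simp: generic_params_def Ch)
    then show "t \<in> (\<Union>j\<in>compl H p. {t. kahler_shift H p u j + t * 1 \<in> periods q} \<union>
        {t. (- u Ch + kahler_shift H p u j) + t * 1 \<in> periods q})"
      unfolding y[OF j(1)] add.assoc[symmetric] by blast
  qed
  moreover have "countable \<dots>"
    using countable_affine_periods[of 1] by (intro countable_UN countable_Un) (auto intro: countable_finite)
  ultimately show ?thesis unfolding d_def by (rule countable_subset)
qed

lemma countable_diagonal_zeros:
  assumes q: "0 < norm q" "norm q < 1" and r: "is_basis H r"
  defines "d \<equiv> \<lambda>s. generic_direction H r s"
  shows "countable {t. (\<Prod>i<dim_n H. diagonal_factor q H r (u Ch + t * d s Ch)
    (chern_at H r (\<lambda>c. u c + t * d s c)) i) = 0}"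
proof -
  have at: "chern_at H r (\<lambda>c. u c + t * d s c) i = chern_at H r u i + t * 1" if "i \<in> r" for t i
  proof -
    have "(\<Sum>j\<in>compl H r. of_int (circ H r i j) * d s (Ca j)) = 0"
      by (intro sum.neutral) (auto simp: d_def generic_direction_def compl_def)
    moreover have "i \<notin> A_plus H r" "i \<notin> A_minus H r"
      using that by (auto simp: A_plus_def A_minus_def compl_def)
    ultimately have "chern_at H r (d s) i = 1"
      using that by (simp add: chern_at_def) (simp add: d_def generic_direction_def)
    then show ?thesis unfolding chern_at_affine by simp
  qed
  have Ch: "d s Ch = 0" by (simp add: d_def generic_direction_def)
  have "{t. (\<Prod>i<dim_n H. diagonal_factor q H r (u Ch + t * d s Ch) (chern_at H r (\<lambda>c. u c + t * d s c)) i) = 0}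
      \<subseteq> (\<Union>i\<in>r. {t. theta q ((u Ch + chern_at H r u i) + t * 1) = 0} \<union> {t. theta q (chern_at H r u i + t * 1) = 0})"
  proof
    fix t assume "t \<in> {t. (\<Prod>i<dim_n H. diagonal_factor q H r (u Ch + t * d s Ch) (chern_at H r (\<lambda>c. u c + t * d s c)) i) = 0}"
    then obtain i where "diagonal_factor q H r (u Ch + t * d s Ch) (chern_at H r (\<lambda>c. u c + t * d s c)) i = 0"
      using prod_zero_factor by blast
    then have "i \<in> r" "theta q ((u Ch + chern_at H r u i) + t * 1) = 0 \<or> theta q (chern_at H r u i + t * 1) = 0"
      using at[of i t] Ch by (auto simp: diagonal_factor_def add.assoc split: if_splits)
    then show "t \<in> (\<Union>i\<in>r. {t. theta q ((u Ch + chern_at H r u i) + t * 1) = 0} \<union> {t. theta q (chern_at H r u i + t * 1) = 0})"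
      by blast
  qed
  moreover have "countable \<dots>"
    using is_basis_finite[OF r] countable_theta_zeros[OF q, of 1]
    by (intro countable_UN countable_Un) (auto intro: countable_finite)
  ultimately show ?thesis by (rule countable_subset)
qed

theorem corollary1p4:
  fixes q :: complex and H :: hypertoric
    and Stab Stab' :: "nat set \<Rightarrow> (coord \<Rightarrow> complex) \<Rightarrow> complex"
    and p r p' r' :: "nat set"
  assumes "0 < norm q" and "norm q < 1"
    and "smooth_hypertoric H" and "generic_sigma H"
    and "\<And>s. s \<in> fixed_points H \<Longrightarrow> elliptic_stable_envelope q H s (Stab s)"
    and "\<And>s. s \<in> fixed_points (mirror H) \<Longrightarrow> elliptic_stable_envelope q (mirror H) s (Stab' s)"
    and "p \<in> fixed_points H" and "r \<in> fixed_points H"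
    and "p' = {..<dim_n H} - p" and "r' = {..<dim_n H} - r"
  defines "D \<equiv> ratio_domain q H r (Stab p) (Stab r) p' (Stab' r') (Stab' p')"
  shows "vec_space (params H) \<subseteq> closure D \<and>
    (\<forall>u\<in>D. restr H (Stab p) r u / restr H (Stab r) r u
           = restr (mirror H) (Stab' r') p' (mirror_params u)
             / restr (mirror H) (Stab' p') p' (mirror_params u))"
proof -
  note q = assms(1,2)
  define H' where "H' = mirror H"
  have gen: "generic_data H" by (rule smooth_generic_data[OF assms(3,4)])
  have gen': "generic_data H'" unfolding H'_def by (rule generic_data_mirror[OF gen])
  have p: "is_basis H p" and r: "is_basis H r"
    using smooth_fixed_point_basis[OF assms(3)] assms(7,8) by auto
  have p'_eq: "p' = compl H p" and r'_eq: "r' = compl H r" using assms(9,10) by (auto simp: compl_def)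
  have p': "is_basis H' p'" and r': "is_basis H' r'"
    unfolding H'_def p'_eq r'_eq using is_basis_mirror p r by auto
  have Fp: "elliptic_stable_envelope q H p (Stab p)" and Fr: "elliptic_stable_envelope q H r (Stab r)"
    using assms(5,7,8) by auto
  have Fp': "elliptic_stable_envelope q H' p' (Stab' p')" and Fr': "elliptic_stable_envelope q H' r' (Stab' r')"
    using assms(6) vertex_eq(2)[OF p'] vertex_eq(2)[OF r'] unfolding H'_def by auto
  have pc: "compl H' r' = r" "compl H' p' = p"
    unfolding H'_def r'_eq p'_eq using compl_compl[OF is_basis_subset[OF r]] compl_compl[OF is_basis_subset[OF p]]
    by simp_all
  define X :: "(coord \<Rightarrow> complex) set" where "X = vec_space (params H)"
  define reg where "reg F u \<longleftrightarrow> regular_at q H F (kproj H u)" for F u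
  define reg' where "reg' F u \<longleftrightarrow> regular_at q H' F (kproj H' (mirror_params u))" for F u
  define Reg where "Reg = {u \<in> X. reg (Stab p) u \<and> reg (Stab r) u \<and> reg' (Stab' r') u \<and> reg' (Stab' p') u}"
  \<comment> \<open>One direction serves both sides: it moves \<open>a_i\<close> for
    \<open>i\<close> in \<open>r\<close> and \<open>z_j\<close> for \<open>j\<close> off
    \<open>p\<close>, and the exchange of parameters turns it into the corresponding direction for
    \<open>p'\<close> and \<open>r'\<close>.\<close>
  define d where "d = generic_direction H r (compl H p)"
  define path where "path u t = (\<lambda>c. u c + t * d c)" for u and t :: complex
  have path0: "path u 0 = u" for u by (simp add: path_def)
  have dX: "d c = 0" if "c \<notin> params H" for c
    using that is_basis_subset[OF r]
    by (cases c) (auto simp: d_def generic_direction_def params_def kcoords_def compl_def)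
  have pathX: "path u t \<in> X" if "u \<in> X" for u t
    using that dX by (simp add: path_def X_def vec_space_def)
  have path_cont: "continuous_on UNIV (path u)" for u
    unfolding path_def[abs_def] by (rule continuous_on_affine_path)
  have path_Ch: "path u t Ch = u Ch" for u t by (simp add: path_def d_def generic_direction_def)
  have d': "mirror_params d = generic_direction H' p' r"
  proof
    fix c show "mirror_params d c = generic_direction H' p' r c"
      by (cases c) (auto simp: d_def generic_direction_def p'_eq)
  qed
  have mp_path: "mirror_params (path u t) = (\<lambda>c. mirror_params u c + t * mirror_params d c)" for u t
    unfolding path_def by (rule mirror_params_affine)
  have mpX: "mirror_params u \<in> vec_space (params H')" if "u \<in> X" for u
    using mirror_params_params that by (simp add: X_def H'_def)

  have reg_open: "openin (top_of_set X) {u \<in> X. reg F u}" for F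
    unfolding X_def reg_def by (rule regular_params_openin)
  have reg'_open: "openin (top_of_set X) {u \<in> X. reg' F u}" for F
  proof -
    have "openin (top_of_set X) {u \<in> X. regular_at q H' F (kproj H' u)}"
      using regular_params_openin[of H' q F] by (simp add: X_def H'_def)
    from mirror_preimage_openin[OF this[unfolded X_def]]
    have "openin (top_of_set X) (X \<inter> mirror_params -` {u \<in> X. regular_at q H' F (kproj H' u)})"
      by (simp add: X_def)
    moreover have "X \<inter> mirror_params -` {u \<in> X. regular_at q H' F (kproj H' u)} = {u \<in> X. reg' F u}"
      using mirror_params_params by (auto simp: reg'_def X_def)
    ultimately show ?thesis by simp
  qed
  have Reg_open: "openin (top_of_set X) Reg"
  proof -
    have "Reg = {u \<in> X. reg (Stab p) u} \<inter> {u \<in> X. reg (Stab r) u} \<inter> {u \<in> X. reg' (Stab' r') u} \<inter> {u \<in> X. reg' (Stab' p') u}"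
      by (auto simp: Reg_def)
    then show ?thesis using reg_open reg'_open by (simp add: openin_Int)
  qed
  \<comment> \<open>The four regularity conditions are imposed one at a time, each open and dense;
    those of the mirror are pulled back along the involution of the parameter space.\<close>
  have Reg_dense: "W \<inter> Reg \<noteq> {}" if W: "openin (top_of_set X) W" "W \<noteq> {}" for W
  proof -
    have 1: "openin (top_of_set X) (W \<inter> {u \<in> X. reg F u}) \<and> W \<inter> {u \<in> X. reg F u} \<noteq> {}"
      if "openin (top_of_set X) W" "W \<noteq> {}" "mero_on_ell q H F" for W F
    proof
      show "openin (top_of_set X) (W \<inter> {u \<in> X. reg F u})"
        using that(1) reg_open by (rule openin_Int)
      show "W \<inter> {u \<in> X. reg F u} \<noteq> {}"
        using mero_regular_dense[OF that(3)] that(1,2) openin_subset[OF that(1)]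
        unfolding X_def reg_def by fastforce
    qed
    have 2: "openin (top_of_set X) (W \<inter> {u \<in> X. reg' F u}) \<and> W \<inter> {u \<in> X. reg' F u} \<noteq> {}"
      if W: "openin (top_of_set X) W" "W \<noteq> {}" and F: "mero_on_ell q H' F" for W F
    proof -
      have WX: "W \<subseteq> X" using openin_subset[OF W(1)] by simp
      have inv: "mirror_params (mirror_params u) = u" "mirror_params u \<in> X" if "u \<in> X" for u
        using mirror_params_involution mirror_params_params that by (auto simp: X_def)
      have o1: "openin (top_of_set X) (X \<inter> mirror_params -` W)"
        using mirror_preimage_openin W(1) by (simp add: X_def)
      have X': "X = vec_space (params H')" by (simp add: X_def H'_def)
      obtain u0 where "u0 \<in> W" using W(2) by blast
      then have "mirror_params u0 \<in> X \<inter> mirror_params -` W" using inv[of u0] WX by auto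
      then obtain u where u: "u \<in> X \<inter> mirror_params -` W" "regular_at q H' F (kproj H' u)"
        using mero_regular_dense[OF F o1[unfolded X']] unfolding X' by blast
      then have "mirror_params u \<in> W \<inter> {u \<in> X. reg' F u}"
        using inv[of u] by (simp add: reg'_def)
      then show ?thesis using W(1) reg'_open by (auto intro: openin_Int)
    qed
    have mero: "mero_on_ell q H (Stab p)" "mero_on_ell q H (Stab r)"
      "mero_on_ell q H' (Stab' r')" "mero_on_ell q H' (Stab' p')"
      using Fp Fr Fp' Fr' by (auto simp: elliptic_stable_envelope_def bundle_section_def)
    define W1 where "W1 = W \<inter> {u \<in> X. reg (Stab p) u}"
    define W2 where "W2 = W1 \<inter> {u \<in> X. reg (Stab r) u}"
    define W3 where "W3 = W2 \<inter> {u \<in> X. reg' (Stab' r') u}"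
    define W4 where "W4 = W3 \<inter> {u \<in> X. reg' (Stab' p') u}"
    have W1: "openin (top_of_set X) W1" "W1 \<noteq> {}" using 1[OF W mero(1)] by (simp_all add: W1_def)
    have W2: "openin (top_of_set X) W2" "W2 \<noteq> {}" using 1[OF W1 mero(2)] by (simp_all add: W2_def)
    have W3: "openin (top_of_set X) W3" "W3 \<noteq> {}" using 2[OF W2 mero(3)] by (simp_all add: W3_def)
    have "W4 \<noteq> {}" using 2[OF W3 mero(4)] by (simp add: W4_def)
    moreover have "W4 \<subseteq> W \<inter> Reg" by (auto simp: W4_def W3_def W2_def W1_def Reg_def)
    ultimately show ?thesis by blast
  qed

  have diag: "restr H (Stab r) r u = (\<Prod>i<dim_n H. diagonal_factor q H r (u Ch) (chern_at H r u) i)"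
    if "u \<in> Reg" for u
    using that unfolding Reg_def X_def reg_def by (intro restr_diagonal[OF gen r Fr]) auto
  have diag': "restr H' (Stab' p') p' (mirror_params u) =
      (\<Prod>i<dim_n H. diagonal_factor q H' p' (- u Ch) (chern_at H' p' (mirror_params u)) i)"
    if "u \<in> Reg" for u
  proof -
    have "restr H' (Stab' p') p' (mirror_params u) =
        (\<Prod>i<dim_n H'. diagonal_factor q H' p' (mirror_params u Ch) (chern_at H' p' (mirror_params u)) i)"
      using that mpX unfolding Reg_def reg'_def by (intro restr_diagonal[OF gen' p' Fp']) auto
    then show ?thesis by (simp add: H'_def)
  qed
  have D_eq: "D = {u \<in> Reg. restr H (Stab r) r u \<noteq> 0 \<and> restr H' (Stab' p') p' (mirror_params u) \<noteq> 0}"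
    by (auto simp: D_def ratio_domain_def Reg_def reg_def reg'_def X_def H'_def)

  \<comment> \<open>The parameters on the line at which an explicit formula does not apply or a
    diagonal value vanishes.\<close>
  define Z where "Z u = {t. \<not> generic_params q H p (path u t)} \<union>
      {t. \<not> generic_params q H' r' (mirror_params (path u t))} \<union>
      {t. (\<Prod>i<dim_n H. diagonal_factor q H r (path u t Ch) (chern_at H r (path u t)) i) = 0} \<union>
      {t. (\<Prod>i<dim_n H. diagonal_factor q H' p' (- path u t Ch) (chern_at H' p' (mirror_params (path u t))) i) = 0}" for u
  have Z: "countable (Z u)" for u
  proof -
    have "countable {t. \<not> generic_params q H p (path u t)}"
      unfolding path_def d_def by (rule countable_not_generic_params)
    moreover have "countable {t. \<not> generic_params q H' r' (mirror_params (path u t))}"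
      unfolding mp_path d' using countable_not_generic_params[of q H' r' "mirror_params u" p'] by (simp add: pc)
    moreover have "countable {t. (\<Prod>i<dim_n H. diagonal_factor q H r (path u t Ch) (chern_at H r (path u t)) i) = 0}"
      unfolding path_def d_def by (rule countable_diagonal_zeros[OF q r])
    moreover have "countable {t. (\<Prod>i<dim_n H. diagonal_factor q H' p' (- path u t Ch) (chern_at H' p' (mirror_params (path u t))) i) = 0}"
    proof -
      have Ch': "- path u t Ch = mirror_params u Ch + t * generic_direction H' p' r Ch" for t
        unfolding path_Ch by (simp add: generic_direction_def)
      have "dim_n H' = dim_n H" by (simp add: H'_def)
      with countable_diagonal_zeros[OF q p', of "mirror_params u" r] show ?thesis
        unfolding Ch' mp_path d' by simp
    qed
    ultimately show ?thesis unfolding Z_def by (intro countable_Un)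
  qed

  have identity: "restr H (Stab p) r u / restr H (Stab r) r u
      = restr H' (Stab' r') p' (mirror_params u) / restr H' (Stab' p') p' (mirror_params u)"
    if u: "u \<in> Reg" and g: "generic_params q H p u" "generic_params q H' r' (mirror_params u)" for u
  proof -
    have uX: "u \<in> vec_space (params H)" and up: "regular_at q H (Stab p) (kproj H u)"
      and ur': "regular_at q H' (Stab' r') (kproj H' (mirror_params u))"
      using u by (auto simp: Reg_def X_def reg_def reg'_def)
    have "restr H (Stab p) r u =
        (\<Prod>i<dim_n H. bundle_factor q H p (u Ch) (chern_at H r u) (kahler_shift H p u) i)"
      unfolding restr_def stable_envelope_eq_bundle_fun[OF q gen p Fp r uX up g(1)]
      by (rule bundle_fun_ell_lift[OF gen p r])
    moreover have "restr H' (Stab' r') p' (mirror_params u) =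
        (\<Prod>i<dim_n H'. bundle_factor q H' r' (mirror_params u Ch) (chern_at H' p' (mirror_params u))
          (kahler_shift H' r' (mirror_params u)) i)"
      unfolding restr_def
        stable_envelope_eq_bundle_fun[OF q gen' r' Fr' p' mpX[OF uX[folded X_def]] ur' g(2)]
      by (rule bundle_fun_ell_lift[OF gen' r' p'])
    moreover have "dim_n H' = dim_n H" by (simp add: H'_def)
    ultimately show ?thesis
      unfolding diag[OF u] diag'[OF u]
      using mirror_factor_identity[OF gen p r, of _ q u]
      by (simp add: prod_dividef[symmetric] H'_def p'_eq r'_eq)
  qed

  have "restr H (Stab p) r u / restr H (Stab r) r u
      = restr H' (Stab' r') p' (mirror_params u) / restr H' (Stab' p') p' (mirror_params u)" if u: "u \<in> D" for u
  proof -
    have uR: "u \<in> Reg" and nz: "restr H (Stab r) r u \<noteq> 0" "restr H' (Stab' p') p' (mirror_params u) \<noteq> 0"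
      using u by (auto simp: D_eq)
    have uX: "u \<in> X" and regs: "regular_at q H (Stab p) (kproj H u)" "regular_at q H (Stab r) (kproj H u)"
      "regular_at q H' (Stab' r') (kproj H' (mirror_params u))" "regular_at q H' (Stab' p') (kproj H' (mirror_params u))"
      using uR by (auto simp: Reg_def reg_def reg'_def)
    define f where "f t = restr H (Stab p) r (path u t) / restr H (Stab r) r (path u t)" for t
    define f' where "f' t = restr H' (Stab' r') p' (mirror_params (path u t)) /
        restr H' (Stab' p') p' (mirror_params (path u t))" for t
    \<comment> \<open>\<open>u\<close> itself may violate \<open>generic_params\<close>. Both ratios
      are continuous at 0 along the line, and they agree off a countable set.\<close>
    have "f 0 = f' 0"
    proof (rule isCont_eq_off_countable[where f = f and g = f' and z = 0, OF _ _ Z])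
      show "isCont f 0"
        unfolding f_def[abs_def] using nz(1)
        by (intro continuous_divide)
          (auto simp: path_def intro!: restr_affine_isCont[OF gen r] regs)
      show "isCont f' 0"
        unfolding f'_def[abs_def] mp_path using nz(2)
        by (intro continuous_divide) (auto intro!: restr_affine_isCont[OF gen' p'] regs)
      have "\<forall>\<^sub>F t in nhds 0. path u t \<in> Reg"
        by (rule eventually_path_in_openin[OF Reg_open _ path_cont]) (use uR path0 pathX[OF uX] in auto)
      then show "\<forall>\<^sub>F t in nhds 0. t \<notin> Z u \<longrightarrow> f t = f' t"
      proof eventually_elim
        case (elim t)
        show ?case unfolding f_def f'_def using identity[OF elim] by (auto simp: Z_def)
      qed
    qed
    then show ?thesis by (simp add: f_def f'_def path0)
  qed
  moreover have "X \<subseteq> closure D"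
  proof
    fix u assume uX: "u \<in> X"
    show "u \<in> closure D"
    proof (rule ccontr)
      assume "u \<notin> closure D"
      define V where "V = - closure D"
      have "open V" "u \<in> V" using \<open>u \<notin> closure D\<close> by (auto simp: V_def)
      have "openin (top_of_set X) (X \<inter> V)" using \<open>open V\<close> by (simp add: openin_open_Int)
      moreover have "X \<inter> V \<noteq> {}" using uX \<open>u \<in> V\<close> by blast
      ultimately obtain u1 where u1: "u1 \<in> X \<inter> V" "u1 \<in> Reg" using Reg_dense by blast
      have o: "openin (top_of_set X) (X \<inter> V \<inter> Reg)"
        using Reg_open \<open>open V\<close> by (simp add: openin_Int openin_open_Int)
      have "\<forall>\<^sub>F t in nhds 0. path u1 t \<in> X \<inter> V \<inter> Reg"
        by (rule eventually_path_in_openin[OF o _ path_cont]) (use u1 path0 pathX in auto)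
      then obtain S where S: "open S" "0 \<in> S" "\<And>t. t \<in> S \<Longrightarrow> path u1 t \<in> X \<inter> V \<inter> Reg"
        unfolding eventually_nhds by blast
      \<comment> \<open>Within the regular parameters the diagonal restrictions are explicit
        products of theta functions, so almost every nearby point of the line lies in
        \<open>D\<close>.\<close>
      obtain t where t: "t \<in> S" "t \<notin> Z u1" using open_not_subset_countable[OF S(1,2) Z] by blast
      then have "path u1 t \<in> Reg" "path u1 t \<in> V" using S(3) by auto
      moreover have "path u1 t \<in> D"
        using t(2) diag[OF \<open>path u1 t \<in> Reg\<close>] diag'[OF \<open>path u1 t \<in> Reg\<close>] \<open>path u1 t \<in> Reg\<close>
        by (simp add: D_eq Z_def)
      ultimately show False using closure_subset[of D] by (auto simp: V_def)
    qed
  qed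
  ultimately show ?thesis unfolding X_def H'_def by blast
qed

end
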